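(* Let $w$ be any permutation, say $w\in S_m$, and for $n\ge m$ let $X_w[n]$ be the Schubert variety in the variety $\mathcal{F}_n$ of complete flags in $\mathbb{C}^n$ associated to $w$ regarded as an element of $S_n$. Then for each fixed $i\ge0$ the sequence $\{H^i_T(X_w[n];\mathbb{Q})\}_{n\ge m}$ of $S_n$-representations is multiplicity stable.
   Context: Let $G=\mathrm{GL}_n\mathbb{C}$, $B$ the Borel subgroup of upper triangular matrices, $T$ the maximal torus of diagonal matrices, $\mathcal{F}_n=G/B$. For $w\in S_n$ (a permutation matrix), $X_w=\overline{B[w]}\subset G/B$, the closure of the Bruhat cell. The left $T$-action on $G/B$ preserves $X_w$, and $H^*_T(X_w;\mathbb{Q})$ is $T$-equivariant cohomology. It carries the $S_n$-action constructed by Tymoczko ("Permutation representations on Schubert varieties"); up to isomorphism this graded $S_n$-representation is $$H^*_T(X_w;\mathbb{Q})\cong\bigoplus_{v\in S_n,\ [v]\in X_w}\mathbb{Q}[t_1,\dots,t_n][\ell(v)],$$ where $S_n$ acts on $\mathbb{Q}[t_1,\dots,t_n]$ by permuting the variables, $\ell(v)$ is Coxeter length, $[\ell(v)]$ denotes a shift of grading, and $[v]\in X_w$ is equivalent to $v\le w$ in Bruhat order. The grading is indexed so that each $t_j$ has degree $1$; thus $H^i_T(X_w;\mathbb{Q})\cong\bigoplus_{v\leq w}\{\text{homogeneous polynomials of degree } i-\ell(v)\text{ in }t_1,\dots,t_n\}$ as $S_n$-representations. For a partition $\lambda=(\lambda_1\ge\dots\ge\lambda_\ell)$ of $k$ and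 $n\ge k+\lambda_1$, $V(\lambda)_n$ is the irreducible $\mathbb{Q}S_n$-representation corresponding to the partition $(n-k,\lambda_1,\dots,\lambda_\ell)$ of $n$. A sequence of $S_n$-representations $V_n=\bigoplus_\lambda c_{\lambda,n}V(\lambda)_n$ is multiplicity stable if for each $\lambda$ the multiplicity $c_{\lambda,n}$ is eventually independent of $n$. *)

theory Defs
  imports
    "HOL-Homology.Homology"
    "HOL-Algebra.Sym_Groups"
    "Jordan_Normal_Form.Matrix"
begin

section \<open>Rational representations\<close>

definition rat_ring :: "rat ring" where
  "rat_ring = \<lparr>carrier = UNIV, monoid.mult = (*), one = 1, zero = 0, add = (+)\<rparr>"

text \<open>The record fields \<^const>\<open>monoid.mult\<close> and \<^const>\<open>one\<close> play no role in a module; they are left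
  undefined below.\<close>

record ('g, 'v) rat_rep = "(rat, 'v) module" +
  act :: "'g \<Rightarrow> 'v \<Rightarrow> 'v"

definition with_action :: "(rat, 'v) module \<Rightarrow> ('g \<Rightarrow> 'v \<Rightarrow> 'v) \<Rightarrow> ('g, 'v) rat_rep" where
  "with_action M \<rho> =
     \<lparr>carrier = carrier M, monoid.mult = monoid.mult M, one = one M, zero = zero M, add = add M,
      smult = smult M, act = \<rho>\<rparr>"

locale rat_representation = group G + module rat_ring V
  for G :: "('g, 'a) monoid_scheme" and V :: "('g, 'v) rat_rep" +
  assumes act_closed: "\<lbrakk>g \<in> carrier G; x \<in> carrier V\<rbrakk> \<Longrightarrow> act V g x \<in> carrier V"
    and act_add: "\<lbrakk>g \<in> carrier G; x \<in> carrier V; y \<in> carrier V\<rbrakk>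
      \<Longrightarrow> act V g (x \<oplus>\<^bsub>V\<^esub> y) = act V g x \<oplus>\<^bsub>V\<^esub> act V g y"
    and act_smult: "\<lbrakk>g \<in> carrier G; x \<in> carrier V\<rbrakk>
      \<Longrightarrow> act V g (q \<odot>\<^bsub>V\<^esub> x) = q \<odot>\<^bsub>V\<^esub> act V g x"
    and act_one: "x \<in> carrier V \<Longrightarrow> act V \<one>\<^bsub>G\<^esub> x = x"
    and act_mult: "\<lbrakk>g \<in> carrier G; h \<in> carrier G; x \<in> carrier V\<rbrakk>
      \<Longrightarrow> act V (g \<otimes>\<^bsub>G\<^esub> h) x = act V g (act V h x)"

definition rat_rep_iso ::
  "('g, 'a) monoid_scheme \<Rightarrow> ('g, 'v) rat_rep \<Rightarrow> ('g, 'u) rat_rep \<Rightarrow> bool" where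
  "rat_rep_iso G V W \<longleftrightarrow>
     (\<exists>f. bij_betw f (carrier V) (carrier W) \<and>
          (\<forall>x\<in>carrier V. \<forall>y\<in>carrier V. f (x \<oplus>\<^bsub>V\<^esub> y) = f x \<oplus>\<^bsub>W\<^esub> f y) \<and>
          (\<forall>q. \<forall>x\<in>carrier V. f (q \<odot>\<^bsub>V\<^esub> x) = q \<odot>\<^bsub>W\<^esub> f x) \<and>
          (\<forall>g\<in>carrier G. \<forall>x\<in>carrier V. f (act V g x) = act W g (f x)))"

definition direct_sum :: "'i set \<Rightarrow> ('i \<Rightarrow> ('g, 'v) rat_rep) \<Rightarrow> ('g, 'i \<Rightarrow> 'v) rat_rep" where
  "direct_sum I V =
     \<lparr>carrier = {x \<in> \<Pi>\<^sub>E i\<in>I. carrier (V i). finite {i \<in> I. x i \<noteq> \<zero>\<^bsub>V i\<^esub>}},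
      monoid.mult = undefined, one = undefined,
      zero = (\<lambda>i\<in>I. \<zero>\<^bsub>V i\<^esub>),
      add = (\<lambda>x y. \<lambda>i\<in>I. x i \<oplus>\<^bsub>V i\<^esub> y i),
      smult = (\<lambda>q x. \<lambda>i\<in>I. q \<odot>\<^bsub>V i\<^esub> x i),
      act = (\<lambda>g x. \<lambda>i\<in>I. act (V i) g (x i))\<rparr>"

definition quotient_module :: "('r, 'v) module \<Rightarrow> 'v set \<Rightarrow> ('r, 'v set) module" where
  "quotient_module M N =
     \<lparr>carrier = a_rcosets\<^bsub>M\<^esub> N, monoid.mult = undefined, one = undefined, zero = N,
      add = (<+>\<^bsub>M\<^esub>),
      smult = (\<lambda>q A. \<Union>x\<in>A. N +>\<^bsub>M\<^esub> (q \<odot>\<^bsub>M\<^esub> x))\<rparr>"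

section \<open>Specht modules and multiplicity stability\<close>

text \<open>A partition is a weakly decreasing list of positive integers. Cells of diagrams are numbered
  from 0, entries of tableaux from 1.\<close>

definition is_partition :: "nat list \<Rightarrow> bool" where
  "is_partition l \<longleftrightarrow> sorted_wrt (\<ge>) l \<and> 0 \<notin> set l"

definition young_diagram :: "nat list \<Rightarrow> (nat \<times> nat) set" where
  "young_diagram l = {(r, c). r < length l \<and> c < l ! r}"

definition tableaux :: "nat list \<Rightarrow> (nat \<times> nat \<Rightarrow> nat) set" where
  "tableaux l = {t. bij_betw t (young_diagram l) {1..sum_list l}}"

definition cell_of :: "nat list \<Rightarrow> (nat \<times> nat \<Rightarrow> nat) \<Rightarrow> nat \<Rightarrow> nat \<times> nat" where
  "cell_of l t x = inv_into (young_diagram l) t x"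

text \<open>A tabloid is encoded by the function sending each entry to its row; a permutation
  \<open>g\<close> sends the tabloid \<open>s\<close> to \<open>s \<circ> inv g\<close>.\<close>

definition tabloid :: "nat list \<Rightarrow> (nat \<times> nat \<Rightarrow> nat) \<Rightarrow> nat \<Rightarrow> nat" where
  "tabloid l t = (\<lambda>x. if x \<in> {1..sum_list l} then fst (cell_of l t x) else 0)"

definition column_stabilizer :: "nat list \<Rightarrow> (nat \<times> nat \<Rightarrow> nat) \<Rightarrow> (nat \<Rightarrow> nat) set" where
  "column_stabilizer l t =
     {p. p permutes {1..sum_list l} \<and>
         (\<forall>x\<in>{1..sum_list l}. snd (cell_of l t (p x)) = snd (cell_of l t x))}"

definition polytabloid :: "nat list \<Rightarrow> (nat \<times> nat \<Rightarrow> nat) \<Rightarrow> (nat \<Rightarrow> nat) \<Rightarrow> rat" where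
  "polytabloid l t =
     (\<lambda>s. \<Sum>p\<in>column_stabilizer l t. if s = tabloid l t \<circ> inv_into UNIV p then of_int (sign p) else 0)"

text \<open>The Specht module of \<open>l\<close>, the span of the polytabloids inside the rational functions on
  tabloids. With this convention a single row gives the trivial representation.\<close>

definition specht_module :: "nat list \<Rightarrow> (nat \<Rightarrow> nat, (nat \<Rightarrow> nat) \<Rightarrow> rat) rat_rep" where
  "specht_module l =
     \<lparr>carrier = {\<lambda>s. \<Sum>t\<in>F. c t * polytabloid l t s | F c. finite F \<and> F \<subseteq> tableaux l},
      monoid.mult = undefined, one = undefined,
      zero = (\<lambda>_. 0),
      add = (\<lambda>x y s. x s + y s),
      smult = (\<lambda>q x s. q * x s),
      act = (\<lambda>g x s. x (s \<circ> g))\<rparr>"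

text \<open>\<open>V_irr l n\<close> is $V(\lambda)_n$; it is used only when \<open>n\<close> belongs to \<open>admissible l\<close>, where
  $\lambda_1$ is read as 0 for the empty partition.\<close>

definition admissible :: "nat list \<Rightarrow> nat set" where
  "admissible l = {n. sum_list l + (if l = [] then 0 else hd l) \<le> n}"

definition V_irr :: "nat list \<Rightarrow> nat \<Rightarrow> (nat \<Rightarrow> nat, (nat \<Rightarrow> nat) \<Rightarrow> rat) rat_rep" where
  "V_irr l n = specht_module ((n - sum_list l) # l)"

definition multiplicity_stable :: "nat \<Rightarrow> (nat \<Rightarrow> (nat \<Rightarrow> nat, 'v) rat_rep) \<Rightarrow> bool" where
  "multiplicity_stable m V \<longleftrightarrow>
     (\<exists>c :: nat list \<Rightarrow> nat \<Rightarrow> nat.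
        (\<forall>n\<ge>m. rat_rep_iso (sym_group n) (V n)
           (direct_sum (SIGMA l : {l. is_partition l \<and> n \<in> admissible l}. {..<c l n})
              (\<lambda>(l, _). V_irr l n))) \<and>
        (\<forall>l. is_partition l \<longrightarrow> (\<exists>N. \<forall>n\<ge>N. c l n = c l N)))"

section \<open>Singular cohomology with rational coefficients\<close>

definition cochain_eval :: "(((nat \<Rightarrow> real) \<Rightarrow> 'a) \<Rightarrow> rat) \<Rightarrow> 'a chain \<Rightarrow> rat" where
  "cochain_eval \<phi> c = (\<Sum>f\<in>Poly_Mapping.keys c. of_int (Poly_Mapping.lookup c f) * \<phi> f)"

definition cochains :: "nat \<Rightarrow> 'a topology \<Rightarrow> (rat, ((nat \<Rightarrow> real) \<Rightarrow> 'a) \<Rightarrow> rat) module" where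
  "cochains p X =
     \<lparr>carrier = {\<phi>. \<forall>f. \<not> singular_simplex p X f \<longrightarrow> \<phi> f = 0},
      monoid.mult = undefined, one = undefined,
      zero = (\<lambda>_. 0),
      add = (\<lambda>\<phi> \<psi> f. \<phi> f + \<psi> f),
      smult = (\<lambda>q \<phi> f. q * \<phi> f)\<rparr>"

definition coboundary_map ::
  "nat \<Rightarrow> 'a topology \<Rightarrow> (((nat \<Rightarrow> real) \<Rightarrow> 'a) \<Rightarrow> rat) \<Rightarrow> ((nat \<Rightarrow> real) \<Rightarrow> 'a) \<Rightarrow> rat" where
  "coboundary_map p X \<phi> =
     (\<lambda>f. if singular_simplex (Suc p) X f
          then cochain_eval \<phi> (chain_boundary (Suc p) (frag_of f)) else 0)"

definition cocycles :: "nat \<Rightarrow> 'a topology \<Rightarrow> (((nat \<Rightarrow> real) \<Rightarrow> 'a) \<Rightarrow> rat) set" where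
  "cocycles p X = {\<phi> \<in> carrier (cochains p X). coboundary_map p X \<phi> = (\<lambda>_. 0)}"

definition coboundaries :: "nat \<Rightarrow> 'a topology \<Rightarrow> (((nat \<Rightarrow> real) \<Rightarrow> 'a) \<Rightarrow> rat) set" where
  "coboundaries p X =
     (if p = 0 then {\<lambda>_. 0} else coboundary_map (p - 1) X ` carrier (cochains (p - 1) X))"

definition cohomology ::
  "nat \<Rightarrow> 'a topology \<Rightarrow> (rat, (((nat \<Rightarrow> real) \<Rightarrow> 'a) \<Rightarrow> rat) set) module" where
  "cohomology p X = quotient_module (cochains p X \<lparr>carrier := cocycles p X\<rparr>) (coboundaries p X)"

section \<open>Flag varieties and Schubert varieties\<close>

definition quotient_topology :: "'a topology \<Rightarrow> ('a \<Rightarrow> 'b) \<Rightarrow> 'b topology" where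
  "quotient_topology X q =
     topology (\<lambda>U. U \<subseteq> q ` topspace X \<and> openin X {x \<in> topspace X. q x \<in> U})"

definition GL :: "nat \<Rightarrow> complex mat set" where
  "GL n = {g \<in> carrier_mat n n. invertible_mat g}"

definition borel_subgroup :: "nat \<Rightarrow> complex mat set" where
  "borel_subgroup n = {g \<in> GL n. upper_triangular g}"

definition torus :: "nat \<Rightarrow> complex mat set" where
  "torus n = {g \<in> GL n. diagonal_mat g}"

definition GL_topology :: "nat \<Rightarrow> complex mat topology" where
  "GL_topology n =
     pullback_topology (GL n) (\<lambda>g (i, j). if i < n \<and> j < n then g $$ (i, j) else 0) euclidean"

definition left_coset :: "nat \<Rightarrow> complex mat \<Rightarrow> complex mat set" where
  "left_coset n g = (\<lambda>b. g * b) ` borel_subgroup n"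

definition flag_variety :: "nat \<Rightarrow> complex mat set topology" where
  "flag_variety n = quotient_topology (GL_topology n) (left_coset n)"

text \<open>The matrix of \<open>w\<close> sends the \<open>j\<close>-th to the \<open>w j\<close>-th basis vector. Permutations act on
  \<open>{1..n}\<close> whereas matrix indices start at 0.\<close>

definition perm_matrix :: "nat \<Rightarrow> (nat \<Rightarrow> nat) \<Rightarrow> complex mat" where
  "perm_matrix n w = mat n n (\<lambda>(i, j). if Suc i = w (Suc j) then 1 else 0)"

definition schubert_variety :: "nat \<Rightarrow> (nat \<Rightarrow> nat) \<Rightarrow> complex mat set topology" where
  "schubert_variety n w =
     subtopology (flag_variety n)
       (flag_variety n closure_of ((\<lambda>b. left_coset n (b * perm_matrix n w)) ` borel_subgroup n))"

section \<open>Torus-equivariant cohomology\<close>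

text \<open>The total space of the universal bundle of the torus: \<open>n\<close>-tuples of nonzero complex sequences.
  The space of nonzero sequences is contractible, for the product topology, by means of
  the shift operator, and the nonzero complex numbers act on it freely by scaling, with local sections
  over the sets where a given entry does not vanish.\<close>

definition ET :: "nat \<Rightarrow> (nat \<Rightarrow> nat \<Rightarrow> complex) topology" where
  "ET n = product_topology (\<lambda>_. top_of_set {z. z \<noteq> (\<lambda>_. 0)}) {..<n}"

definition ET_act :: "nat \<Rightarrow> complex mat \<Rightarrow> (nat \<Rightarrow> nat \<Rightarrow> complex) \<Rightarrow> nat \<Rightarrow> nat \<Rightarrow> complex" where
  "ET_act n t e = (\<lambda>j\<in>{..<n}. \<lambda>k. t $$ (j, j) * e j k)"

definition borel_construction ::
  "nat \<Rightarrow> complex mat set topology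
    \<Rightarrow> ((nat \<Rightarrow> nat \<Rightarrow> complex) \<times> complex mat set) set topology" where
  "borel_construction n X =
     quotient_topology (prod_topology (ET n) X)
       (\<lambda>(e, x). (\<lambda>t. (ET_act n t e, (\<lambda>g. t * g) ` x)) ` torus n)"

type_synonym eq_class =
  "(((nat \<Rightarrow> real) \<Rightarrow> ((nat \<Rightarrow> nat \<Rightarrow> complex) \<times> complex mat set) set) \<Rightarrow> rat) set"

text \<open>The grading is indexed so that the generators \<open>t_j\<close> of the cohomology of the classifying
  space have degree 1; they have topological degree 2.\<close>

definition equivariant_cohomology ::
  "nat \<Rightarrow> complex mat set topology \<Rightarrow> nat \<Rightarrow> (rat, eq_class) module" where
  "equivariant_cohomology n X i = cohomology (2 * i) (borel_construction n X)"

section \<open>Coxeter length, Bruhat order and the permutation action on polynomials\<close>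

definition coxeter_length :: "nat \<Rightarrow> (nat \<Rightarrow> nat) \<Rightarrow> nat" where
  "coxeter_length n v =
     (LEAST k. \<exists>js. length js = k \<and> set js \<subseteq> {1..<n} \<and>
        v = foldr (\<lambda>j p. Transposition.transpose j (Suc j) \<circ> p) js id)"

definition bruhat_step :: "nat \<Rightarrow> (nat \<Rightarrow> nat) \<Rightarrow> (nat \<Rightarrow> nat) \<Rightarrow> bool" where
  "bruhat_step n u v \<longleftrightarrow>
     u \<in> carrier (sym_group n) \<and> v \<in> carrier (sym_group n) \<and>
     (\<exists>a\<in>{1..n}. \<exists>b\<in>{1..n}. v = u \<circ> Transposition.transpose a b) \<and>
     coxeter_length n u < coxeter_length n v"

definition bruhat_le :: "nat \<Rightarrow> (nat \<Rightarrow> nat) \<Rightarrow> (nat \<Rightarrow> nat) \<Rightarrow> bool" where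
  "bruhat_le n = (bruhat_step n)\<^sup>*\<^sup>*"

text \<open>Monomials in \<open>t_1, \<dots>, t_n\<close> are finitely supported exponent vectors. Both occurrences of
  \<^const>\<open>Poly_Mapping.map_key\<close> precompose with the given bijection, so that \<open>g\<close> sends \<open>t_j\<close> to
  \<open>t_(g j)\<close>. In negative degree the space is zero.\<close>

definition hom_polys :: "nat \<Rightarrow> int \<Rightarrow> (nat \<Rightarrow> nat, (nat \<Rightarrow>\<^sub>0 nat) \<Rightarrow>\<^sub>0 rat) rat_rep" where
  "hom_polys n d =
     \<lparr>carrier = {p. \<forall>a\<in>Poly_Mapping.keys p. Poly_Mapping.keys a \<subseteq> {1..n} \<and>
                   int (\<Sum>j\<in>Poly_Mapping.keys a. Poly_Mapping.lookup a j) = d},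
      monoid.mult = undefined, one = undefined,
      zero = 0,
      add = (+),
      smult = (\<lambda>q. Poly_Mapping.map ((*) q)),
      act = (\<lambda>g. Poly_Mapping.map_key (Poly_Mapping.map_key g))\<rparr>"

text \<open>The degree \<open>i\<close> part of the direct sum, over \<open>v \<le> w\<close>, of the polynomial ring shifted by
  \<open>\<ell>(v)\<close>.\<close>

definition shifted_poly_sum ::
  "nat \<Rightarrow> (nat \<Rightarrow> nat) \<Rightarrow> nat
    \<Rightarrow> (nat \<Rightarrow> nat, (nat \<Rightarrow> nat) \<Rightarrow> (nat \<Rightarrow>\<^sub>0 nat) \<Rightarrow>\<^sub>0 rat) rat_rep" where
  "shifted_poly_sum n w i =
     direct_sum {v \<in> carrier (sym_group n). bruhat_le n v w}
       (\<lambda>v. hom_polys n (int i - int (coxeter_length n v)))"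

section \<open>Well-definedness: quotient topologies are topologies, cohomology is a rational vector space\<close>

lemma openin_quotient_topology:
  "openin (quotient_topology X q) U \<longleftrightarrow> U \<subseteq> q ` topspace X \<and> openin X {x \<in> topspace X. q x \<in> U}"
proof -
  have "istopology (\<lambda>U. U \<subseteq> q ` topspace X \<and> openin X {x \<in> topspace X. q x \<in> U})"
    unfolding istopology_def
  proof (intro conjI allI impI; (elim conjE)?)
    fix S T assume "openin X {x \<in> topspace X. q x \<in> S}" "openin X {x \<in> topspace X. q x \<in> T}"
    then have "openin X ({x \<in> topspace X. q x \<in> S} \<inter> {x \<in> topspace X. q x \<in> T})" by blast
    moreover have "{x \<in> topspace X. q x \<in> S} \<inter> {x \<in> topspace X. q x \<in> T} = {x \<in> topspace X. q x \<in> S \<inter> T}" by blast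
    ultimately show "openin X {x \<in> topspace X. q x \<in> S \<inter> T}" by simp
  next
    fix K assume "\<forall>S\<in>K. S \<subseteq> q ` topspace X \<and> openin X {x \<in> topspace X. q x \<in> S}"
    then have "openin X (\<Union>S\<in>K. {x \<in> topspace X. q x \<in> S})" by blast
    moreover have "(\<Union>S\<in>K. {x \<in> topspace X. q x \<in> S}) = {x \<in> topspace X. q x \<in> \<Union>K}" by blast
    ultimately show "openin X {x \<in> topspace X. q x \<in> \<Union>K}" by simp
  qed auto
  then show ?thesis unfolding quotient_topology_def by (simp add: topology_inverse')
qed

lemma topspace_quotient_topology: "topspace (quotient_topology X q) = q ` topspace X"
proof -
  have "{x \<in> topspace X. q x \<in> q ` topspace X} = topspace X" by blast
  then have "openin (quotient_topology X q) (q ` topspace X)" by (simp add: openin_quotient_topology)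
  then have "q ` topspace X \<subseteq> topspace (quotient_topology X q)" by (rule openin_subset)
  moreover have "topspace (quotient_topology X q) \<subseteq> q ` topspace X"
    using openin_topspace[of "quotient_topology X q"] unfolding openin_quotient_topology by simp
  ultimately show ?thesis by simp
qed

lemma quotient_map_quotient_topology: "quotient_map X (quotient_topology X q) q"
  by (auto simp: quotient_map_def topspace_quotient_topology openin_quotient_topology)

lemma cring_rat: "cring rat_ring"
proof (intro cringI abelian_groupI comm_monoidI)
  show "\<exists>y\<in>carrier rat_ring. y \<oplus>\<^bsub>rat_ring\<^esub> x = \<zero>\<^bsub>rat_ring\<^esub>" for x
    by (intro bexI[of _ "-x"]) (simp_all add: rat_ring_def)
qed (simp_all add: rat_ring_def algebra_simps)

lemma cochain_eval_alt: assumes "finite S" "Poly_Mapping.keys c \<subseteq> S"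
  shows "cochain_eval \<phi> c = (\<Sum>f\<in>S. of_int (Poly_Mapping.lookup c f) * \<phi> f)"
  unfolding cochain_eval_def using assms
  by (intro sum.mono_neutral_left) (auto simp: in_keys_iff)

lemma cochain_eval_add: "cochain_eval \<phi> (a + b) = cochain_eval \<phi> a + cochain_eval \<phi> b"
proof -
  let ?S = "Poly_Mapping.keys a \<union> Poly_Mapping.keys b"
  have "Poly_Mapping.keys (a+b) \<subseteq> ?S" by (rule Poly_Mapping.keys_add)
  then show ?thesis
    by (subst (1 2 3) cochain_eval_alt[of ?S]) (auto simp: lookup_add algebra_simps sum.distrib)
qed

lemma cochain_eval_cmul: "cochain_eval \<phi> (frag_cmul k a) = of_int k * cochain_eval \<phi> a"
  by (subst (1 2) cochain_eval_alt[of "Poly_Mapping.keys a"])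
     (auto simp: in_keys_iff sum_distrib_left algebra_simps)

lemma cochain_eval_of: "cochain_eval \<phi> (frag_of f) = \<phi> f"
  by (simp add: cochain_eval_def)

lemma cochain_eval_0: "cochain_eval \<phi> 0 = 0" by (simp add: cochain_eval_def)

lemma cochain_eval_diff: "cochain_eval \<phi> (a - b) = cochain_eval \<phi> a - cochain_eval \<phi> b"
  using cochain_eval_add[of \<phi> "a-b" b] by simp

lemma eval_coboundary:
  assumes "singular_chain (Suc p) X c"
  shows "cochain_eval (coboundary_map p X \<phi>) c = cochain_eval \<phi> (chain_boundary (Suc p) c)"
  using assms unfolding singular_chain_def
  by (induction c rule: frag_induction)
     (auto simp: coboundary_map_def cochain_eval_of cochain_eval_0 cochain_eval_diff chain_boundary_diff)

lemma coboundary_coboundary: "coboundary_map (Suc p) X (coboundary_map p X \<phi>) = (\<lambda>_. 0)"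
proof
  fix f show "coboundary_map (Suc p) X (coboundary_map p X \<phi>) f = 0"
  proof (cases "singular_simplex (Suc (Suc p)) X f")
    case True
    then have c: "singular_chain (Suc (Suc p)) X (frag_of f)" by (simp add: singular_chain_of)
    have d: "singular_chain (Suc p) X (chain_boundary (Suc (Suc p)) (frag_of f))"
      using singular_chain_boundary[OF c] by simp
    have "chain_boundary (Suc p) (chain_boundary (Suc (Suc p)) (frag_of f)) = 0"
      using chain_boundary_boundary[OF c] by simp
    with True show ?thesis
      by (simp add: coboundary_map_def[of "Suc p"] eval_coboundary[OF d] cochain_eval_0)
  qed (simp add: coboundary_map_def)
qed

lemma coboundary_add: "coboundary_map p X (\<lambda>f. \<phi> f + \<psi> f) = (\<lambda>f. coboundary_map p X \<phi> f + coboundary_map p X \<psi> f)"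
  by (auto simp: coboundary_map_def cochain_eval_def algebra_simps sum.distrib)

lemma coboundary_smult: "coboundary_map p X (\<lambda>f. q * \<phi> f) = (\<lambda>f. q * coboundary_map p X \<phi> f)"
  by (auto simp: coboundary_map_def cochain_eval_def algebra_simps sum_distrib_left)

lemma module_fun:
  assumes "(\<lambda>_. 0) \<in> S" "\<And>x y. x \<in> S \<Longrightarrow> y \<in> S \<Longrightarrow> (\<lambda>s. x s + y s) \<in> S" "\<And>q x. x \<in> S \<Longrightarrow> (\<lambda>s. q * x s) \<in> S"
    and M: "carrier M = S" "zero M = (\<lambda>_. 0)" "add M = (\<lambda>x y s. x s + y s)" "smult M = (\<lambda>(q::rat) x s. q * x s)"
  shows "module rat_ring M"
proof (intro moduleI cring_rat abelian_groupI)
  fix x assume x: "x \<in> carrier M"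
  then have "(\<lambda>s. (-1) * x s) \<in> S" using assms(3)[of x "-1"] M(1) by simp
  then show "\<exists>y\<in>carrier M. y \<oplus>\<^bsub>M\<^esub> x = \<zero>\<^bsub>M\<^esub>" by (intro bexI[of _ "\<lambda>s. (-1) * x s"]) (simp_all add: M)
next
  show "\<And>x y. x \<in> carrier M \<Longrightarrow> y \<in> carrier M \<Longrightarrow> x \<oplus>\<^bsub>M\<^esub> y \<in> carrier M" unfolding M by (rule assms(2))
  show "\<zero>\<^bsub>M\<^esub> \<in> carrier M" unfolding M by (rule assms(1))
  show "\<And>a x. a \<in> carrier rat_ring \<Longrightarrow> x \<in> carrier M \<Longrightarrow> a \<odot>\<^bsub>M\<^esub> x \<in> carrier M" unfolding M by (rule assms(3))
qed (unfold M, simp_all add: rat_ring_def fun_eq_iff distrib_left distrib_right add.assoc add.commute mult.assoc)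

lemma module_quotient:
  assumes M: "module R M" and N: "submodule N R M"
  shows "module R (quotient_module M N)"
proof -
  interpret module R M by fact
  interpret S: submodule N R M by fact
  interpret A: abelian_subgroup N M
    by (intro abelian_subgroupI3 additive_subgroup.intro S.subgroup_axioms abelian_group_axioms)
  have rep: "\<exists>x\<in>carrier M. A = N +>\<^bsub>M\<^esub> x" if "A \<in> a_rcosets\<^bsub>M\<^esub> N" for A
    using that unfolding A_RCOSETS_defs a_r_coset_def r_coset_def by auto
  have sm: "(\<Union>y\<in>(N +>\<^bsub>M\<^esub> x). N +>\<^bsub>M\<^esub> (q \<odot>\<^bsub>M\<^esub> y)) = N +>\<^bsub>M\<^esub> (q \<odot>\<^bsub>M\<^esub> x)"
    if "x \<in> carrier M" "q \<in> carrier R" for q x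
  proof -
    have "N +>\<^bsub>M\<^esub> (q \<odot>\<^bsub>M\<^esub> y) = N +>\<^bsub>M\<^esub> (q \<odot>\<^bsub>M\<^esub> x)" if "y \<in> N +>\<^bsub>M\<^esub> x" for y
    proof -
      from that obtain h where h: "h \<in> N" "y = h \<oplus>\<^bsub>M\<^esub> x" unfolding a_r_coset_def r_coset_def by auto
      then have hc: "h \<in> carrier M" using S.subset by auto
      have e: "q \<odot>\<^bsub>M\<^esub> y = q \<odot>\<^bsub>M\<^esub> h \<oplus>\<^bsub>M\<^esub> q \<odot>\<^bsub>M\<^esub> x"
        using h hc \<open>x \<in> carrier M\<close> \<open>q \<in> carrier R\<close> smult_r_distr by simp
      have "q \<odot>\<^bsub>M\<^esub> y \<in> N +>\<^bsub>M\<^esub> (q \<odot>\<^bsub>M\<^esub> x)"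
        using e h \<open>q \<in> carrier R\<close> unfolding a_r_coset_def r_coset_def by auto
      then show ?thesis using A.a_repr_independence'[of "q \<odot>\<^bsub>M\<^esub> y" "q \<odot>\<^bsub>M\<^esub> x"] \<open>x \<in> carrier M\<close> \<open>q \<in> carrier R\<close>
        by simp
    qed
    moreover have "x \<in> N +>\<^bsub>M\<^esub> x" using \<open>x \<in> carrier M\<close> A.a_rcos_self by blast
    ultimately show ?thesis by blast
  qed
  have add: "(N +>\<^bsub>M\<^esub> x) <+>\<^bsub>M\<^esub> (N +>\<^bsub>M\<^esub> y) = N +>\<^bsub>M\<^esub> (x \<oplus>\<^bsub>M\<^esub> y)" if "x \<in> carrier M" "y \<in> carrier M" for x y
    using that A.a_rcos_sum by blast
  have z: "N = N +>\<^bsub>M\<^esub> \<zero>\<^bsub>M\<^esub>" 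
  proof -
    have "h \<oplus>\<^bsub>M\<^esub> \<zero>\<^bsub>M\<^esub> = h" if "h \<in> N" for h using that S.subset by auto
    then show ?thesis unfolding a_r_coset_def r_coset_def by simp
  qed
  have c: "N +>\<^bsub>M\<^esub> x \<in> a_rcosets\<^bsub>M\<^esub> N" if "x \<in> carrier M" for x using that a_rcosetsI[of N x] S.subset by simp
  define Q where "Q = quotient_module M N"
  have cQ: "carrier Q = (\<lambda>x. N +>\<^bsub>M\<^esub> x) ` carrier M"
    
  proof (intro equalityI subsetI)
    fix A assume "A \<in> carrier Q"
    then have "A \<in> a_rcosets\<^bsub>M\<^esub> N" by (simp add: Q_def quotient_module_def)
    from rep[OF this] show "A \<in> (\<lambda>x. N +>\<^bsub>M\<^esub> x) ` carrier M" by blast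
  next
    fix A assume "A \<in> (\<lambda>x. N +>\<^bsub>M\<^esub> x) ` carrier M"
    then obtain x where "x \<in> carrier M" "A = N +>\<^bsub>M\<^esub> x" by blast
    with c[of x] show "A \<in> carrier Q" by (simp add: Q_def quotient_module_def)
  qed
  have aQ: "add Q = (<+>\<^bsub>M\<^esub>)" and zQ: "zero Q = N +>\<^bsub>M\<^esub> \<zero>\<^bsub>M\<^esub>"
    unfolding Q_def quotient_module_def by (simp_all add: z[symmetric])
  have sQ: "smult Q q (N +>\<^bsub>M\<^esub> x) = N +>\<^bsub>M\<^esub> (q \<odot>\<^bsub>M\<^esub> x)" if "x \<in> carrier M" "q \<in> carrier R" for q x
    unfolding Q_def quotient_module_def using sm[OF that] by simp
  have addQ: "(N +>\<^bsub>M\<^esub> x) \<oplus>\<^bsub>Q\<^esub> (N +>\<^bsub>M\<^esub> y) = N +>\<^bsub>M\<^esub> (x \<oplus>\<^bsub>M\<^esub> y)" if "x \<in> carrier M" "y \<in> carrier M" for x y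
    using add[OF that] aQ by simp
  have "module R Q"
  proof (intro moduleI abelian_groupI is_cring)
    fix A assume "A \<in> carrier Q"
    then obtain x where x: "x \<in> carrier M" "A = N +>\<^bsub>M\<^esub> x" using cQ by auto
    have "(N +>\<^bsub>M\<^esub> (\<ominus>\<^bsub>M\<^esub> x)) \<oplus>\<^bsub>Q\<^esub> A = \<zero>\<^bsub>Q\<^esub>" using x by (simp add: addQ zQ M.l_neg)
    then show "\<exists>y\<in>carrier Q. y \<oplus>\<^bsub>Q\<^esub> A = \<zero>\<^bsub>Q\<^esub>" using x cQ by auto
  next
    have ind: "(\<And>x. x \<in> carrier M \<Longrightarrow> P (N +>\<^bsub>M\<^esub> x)) \<Longrightarrow> A \<in> carrier Q \<Longrightarrow> P A" for P A using cQ by auto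
    have mem: "\<And>x. x \<in> carrier M \<Longrightarrow> N +>\<^bsub>M\<^esub> x \<in> carrier Q" using cQ by auto
    show "x \<oplus>\<^bsub>Q\<^esub> y \<in> carrier Q" if "x \<in> carrier Q" "y \<in> carrier Q" for x y
      using that unfolding cQ by (elim imageE) (simp add: addQ)
    show "\<zero>\<^bsub>Q\<^esub> \<in> carrier Q" unfolding zQ by (simp add: mem)
    show "x \<oplus>\<^bsub>Q\<^esub> y \<oplus>\<^bsub>Q\<^esub> z = x \<oplus>\<^bsub>Q\<^esub> (y \<oplus>\<^bsub>Q\<^esub> z)" if "x \<in> carrier Q" "y \<in> carrier Q" "z \<in> carrier Q" for x y z
      using that unfolding cQ by (elim imageE) (simp add: addQ M.a_assoc)
    show "x \<oplus>\<^bsub>Q\<^esub> y = y \<oplus>\<^bsub>Q\<^esub> x" if "x \<in> carrier Q" "y \<in> carrier Q" for x y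
      using that unfolding cQ by (elim imageE) (simp add: addQ M.a_comm)
    show "\<zero>\<^bsub>Q\<^esub> \<oplus>\<^bsub>Q\<^esub> x = x" if "x \<in> carrier Q" for x
      using that unfolding cQ by (elim imageE) (simp add: addQ zQ)
    show "a \<odot>\<^bsub>Q\<^esub> x \<in> carrier Q" if "a \<in> carrier R" "x \<in> carrier Q" for a x
      using that unfolding cQ by (elim imageE) (simp add: sQ)
    show "(a \<oplus>\<^bsub>R\<^esub> b) \<odot>\<^bsub>Q\<^esub> x = a \<odot>\<^bsub>Q\<^esub> x \<oplus>\<^bsub>Q\<^esub> b \<odot>\<^bsub>Q\<^esub> x" if "a \<in> carrier R" "b \<in> carrier R" "x \<in> carrier Q" for a b x
      using that unfolding cQ by (elim imageE) (simp add: addQ sQ mem smult_l_distr)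
    show "a \<odot>\<^bsub>Q\<^esub> (x \<oplus>\<^bsub>Q\<^esub> y) = a \<odot>\<^bsub>Q\<^esub> x \<oplus>\<^bsub>Q\<^esub> a \<odot>\<^bsub>Q\<^esub> y" if "a \<in> carrier R" "x \<in> carrier Q" "y \<in> carrier Q" for a x y
      using that unfolding cQ by (elim imageE) (simp add: addQ sQ mem smult_r_distr)
    show "(a \<otimes>\<^bsub>R\<^esub> b) \<odot>\<^bsub>Q\<^esub> x = a \<odot>\<^bsub>Q\<^esub> (b \<odot>\<^bsub>Q\<^esub> x)" if "a \<in> carrier R" "b \<in> carrier R" "x \<in> carrier Q" for a b x
      using that unfolding cQ by (elim imageE) (simp add: addQ sQ mem smult_assoc1)
    show "\<one>\<^bsub>R\<^esub> \<odot>\<^bsub>Q\<^esub> x = x" if "x \<in> carrier Q" for x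
      using that unfolding cQ by (elim imageE) (simp add: sQ)
  qed
  then show ?thesis by (simp add: Q_def)
qed

lemma module_cochains: "module rat_ring (cochains p X)"
  by (rule module_fun[where S = "carrier (cochains p X)"]) (simp_all add: cochains_def)

lemma module_cocycles: "module rat_ring (cochains p X \<lparr>carrier := cocycles p X\<rparr>)"
proof (rule module_fun[where S = "cocycles p X"])
  show "(\<lambda>_. 0) \<in> cocycles p X" by (auto simp: cocycles_def cochains_def coboundary_map_def cochain_eval_def)
next
  show "(\<lambda>s. x s + y s) \<in> cocycles p X" if "x \<in> cocycles p X" "y \<in> cocycles p X" for x y
    using that by (simp add: cocycles_def cochains_def coboundary_add)
  show "(\<lambda>s. q * x s) \<in> cocycles p X" if "x \<in> cocycles p X" for q x
    using that by (simp add: cocycles_def cochains_def coboundary_smult)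
qed (simp_all add: cochains_def)

lemma sub_coboundaries: "submodule (coboundaries p X) rat_ring (cochains p X \<lparr>carrier := cocycles p X\<rparr>)"
proof -
  interpret M: Module.module rat_ring "cochains p X \<lparr>carrier := cocycles p X\<rparr>" by (rule module_cocycles)
  have lin: "(\<lambda>_. 0) \<in> coboundaries p X"
     "\<And>x y. x \<in> coboundaries p X \<Longrightarrow> y \<in> coboundaries p X \<Longrightarrow> (\<lambda>s. x s + y s) \<in> coboundaries p X"
     "\<And>q x. x \<in> coboundaries p X \<Longrightarrow> (\<lambda>s. q * x s) \<in> coboundaries p X"
  proof -
    have z: "coboundary_map (p-1) X (\<lambda>_. 0) = (\<lambda>_. 0)" by (auto simp: coboundary_map_def cochain_eval_def)
    let ?C = "carrier (cochains (p-1) X)"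
    have C: "(\<lambda>_. 0) \<in> ?C" "\<And>a b. a \<in> ?C \<Longrightarrow> b \<in> ?C \<Longrightarrow> (\<lambda>s. a s + b s) \<in> ?C" "\<And>q a. a \<in> ?C \<Longrightarrow> (\<lambda>s. q * a s) \<in> ?C"
      by (simp_all add: cochains_def)
    show "(\<lambda>_. 0) \<in> coboundaries p X"
      unfolding coboundaries_def using C(1) z by (metis (no_types, lifting) imageI singletonI)
    show "(\<lambda>s. x s + y s) \<in> coboundaries p X" if "x \<in> coboundaries p X" "y \<in> coboundaries p X" for x y
    proof (cases "p = 0")
      case False
      with that obtain a b where "a \<in> ?C" "b \<in> ?C" "x = coboundary_map (p-1) X a" "y = coboundary_map (p-1) X b"
        by (auto simp: coboundaries_def)
      then show ?thesis using C(2)[of a b] False unfolding coboundaries_def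
        by (simp add: coboundary_add[symmetric])
    qed (use that in \<open>simp add: coboundaries_def\<close>)
    show "(\<lambda>s. q * x s) \<in> coboundaries p X" if "x \<in> coboundaries p X" for q x
    proof (cases "p = 0")
      case False
      with that obtain a where "a \<in> ?C" "x = coboundary_map (p-1) X a"
        by (auto simp: coboundaries_def)
      then show ?thesis using C(3)[of a q] False unfolding coboundaries_def
        by (simp add: coboundary_smult[symmetric])
    qed (use that in \<open>simp add: coboundaries_def\<close>)
  qed
  have sub: "coboundaries p X \<subseteq> cocycles p X"
  proof (cases p)
    case 0 then show ?thesis by (auto simp: coboundaries_def cocycles_def cochains_def coboundary_map_def cochain_eval_def)
  next
    case (Suc k) then show ?thesis
      by (auto simp: coboundaries_def cocycles_def coboundary_coboundary) (auto simp: cochains_def coboundary_map_def)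
  qed
  show ?thesis
  proof (rule M.submoduleI)
    fix a assume a: "a \<in> coboundaries p X"
    then have b: "(\<lambda>s. (-1) * a s) \<in> coboundaries p X" using lin by blast
    have "\<ominus>\<^bsub>cochains p X \<lparr>carrier := cocycles p X\<rparr>\<^esub> a = (\<lambda>s. (-1) * a s)"
      by (rule M.minus_equality) (use a b sub in \<open>auto simp: cochains_def\<close>)
    then show "\<ominus>\<^bsub>cochains p X \<lparr>carrier := cocycles p X\<rparr>\<^esub> a \<in> coboundaries p X" using b by simp
  qed (use sub lin in \<open>auto simp: cochains_def\<close>)
qed

lemma module_cohomology: "module rat_ring (cohomology p X)"
  unfolding cohomology_def by (rule module_quotient[OF module_cocycles sub_coboundaries])
end

theory Submission
  imports Defs "HOL-Library.Function_Algebras"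
begin

text \<open>In degree \<open>i\<close> the hypothesis on the permutation action leaves a purely combinatorial
representation: the direct sum, over the permutations \<open>v \<le> w\<close>, of the polynomials of degree
\<open>i - \<ell>(v)\<close> in \<open>n\<close> variables. The Coxeter length is the number of inversions, which does not
see \<open>n\<close>, and a reflection that moves a point beyond \<open>m\<close> can only lengthen a permutation of
\<open>{1..m}\<close>. Hence neither the Bruhat interval below \<open>w\<close> nor the lengths in it depend on \<open>n\<close>
(\<open>coxeter_length_inversions\<close>, \<open>bruhat_interval_stable\<close>), and the representation is the space of
all functions on a finite set of pairs (permutation, monomial) on which \<open>S_n\<close> acts
(\<open>poly_sum_iso\<close>).

Multiplicities are read off with Young symmetrizers. For a tableau \<open>t\<close> let \<open>a\<close> be the sum of its
row stabilizer and \<open>b\<close> the signed sum of its column stabilizer. The operator \<open>b a\<close> kills the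
Specht modules of all other shapes, because it could be nonzero only if each of the two shapes
dominated the other one (\<open>dominance\<close>, \<open>young_op_other_shape\<close>), and it maps the Specht module of
its own shape to the line through the polytabloid of \<open>t\<close> (\<open>antisymmetrize_same_shape\<close>). The sum
of the conjugates of \<open>a b a\<close> is central, and a positivity argument shows that it is nonzero on the
Specht module of its own shape (\<open>conjugate_sum_nonzero\<close>). So these central elements, one for each
shape, are linearly independent; there are as many of them as conjugacy classes in \<open>S_n\<close>,
so they span all class functions, and the identity is a combination of them
(\<open>unit_decomposition\<close>). In other words the elements \<open>b a\<close>, one for each shape, generate the group
algebra as a two-sided ideal.

This gives the decomposition of every invariant space \<open>V\<close> of functions of finite dimension
(\<open>decomposition\<close>). A vector \<open>b a v\<close> determines a homomorphism from the Specht module to \<open>V\<close> that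
sends the polytabloid of \<open>t\<close> to it (\<open>specht_hom_polytabloid\<close>); the homomorphisms obtained from
bases of the spaces \<open>b a V\<close> add up to a map from a direct sum of Specht modules to \<open>V\<close>. Kernel and
cokernel of this map are annihilated by all \<open>b a\<close>, hence by the identity, and so they vanish.
Therefore the multiplicity is the dimension of \<open>b a V\<close>.

Stability is now a comparison of these dimensions for \<open>n\<close> and \<open>n + 1\<close>. For the shape with first
row \<open>n - k\<close> and remaining rows \<open>\<lambda>\<close>, the tableau can be chosen so that the rows below the first and
the first \<open>\<lambda>_1\<close> cells of the first row carry fixed small entries. Then the column stabilizer does
not depend on \<open>n\<close>, and \<open>b a V\<close> is the image under \<open>b\<close> of the functions invariant under the row
stabilizer. Restricting functions from monomials in \<open>n + 1\<close> variables to monomials in \<open>n\<close> variables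
identifies these spaces as soon as \<open>n \<ge> k + \<lambda>_1 + i\<close>: a monomial of degree at most \<open>i\<close> misses
one of the variables that are free to move along the first row, so that it can be moved into the
first \<open>n\<close> variables, and in only one way up to the row stabilizer
(\<open>restriction_row_invariants\<close>, \<open>dim_mult_space_stable\<close>).\<close>

section \<open>Permutations acting on functions\<close>

definition perm_group :: "nat \<Rightarrow> (nat \<Rightarrow> nat) set \<Rightarrow> bool" where
  "perm_group n C \<longleftrightarrow> C \<subseteq> {p. p permutes {1..n}} \<and> id \<in> C \<and>
     (\<forall>p\<in>C. \<forall>q\<in>C. p \<circ> q \<in> C) \<and> (\<forall>p\<in>C. inv' p \<in> C)"

lemma perm_groupD:
  assumes "perm_group n C"
  shows "p \<in> C \<Longrightarrow> p permutes {1..n}" "id \<in> C" "p \<in> C \<Longrightarrow> q \<in> C \<Longrightarrow> p \<circ> q \<in> C"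
    "p \<in> C \<Longrightarrow> inv' p \<in> C"
  using assms by (auto simp: perm_group_def)

lemma perm_group_permutations: "perm_group n {p. p permutes {1..n}}"
  by (auto simp: perm_group_def permutes_compose permutes_inv permutes_id)

lemma perm_group_finite: "perm_group n C \<Longrightarrow> finite C"
  unfolding perm_group_def by (rule finite_subset[OF _ finite_permutations[of "{1..n}"]]) auto

lemma permutes_comp_inv:
  assumes "p permutes S"
  shows "p \<circ> inv' p = id" "inv' p \<circ> p = id" "f \<circ> p \<circ> inv' p = f" "f \<circ> inv' p \<circ> p = f"
    "p \<circ> (inv' p \<circ> f') = f'" "inv' p \<circ> (p \<circ> f') = f'" "inv' (inv' p) = p"
  using permutes_inv_o[OF assms] permutes_inv_inv[OF assms] by (simp_all add: comp_assoc flip: comp_assoc[of _ _ f'])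

lemma perm_group_sum_left:
  assumes C: "perm_group n C" and g: "g \<in> C"
  shows "(\<Sum>h\<in>C. F (g \<circ> h)) = (\<Sum>h\<in>C. F h)"
  by (rule sum.reindex_bij_witness[where i = "\<lambda>h. inv' g \<circ> h" and j = "\<lambda>h. g \<circ> h"])
     (use perm_groupD[OF C] g permutes_comp_inv[OF perm_groupD(1)[OF C g]] in auto)

lemma perm_group_sum_right:
  assumes C: "perm_group n C" and g: "g \<in> C"
  shows "(\<Sum>h\<in>C. F (h \<circ> g)) = (\<Sum>h\<in>C. F h)"
  by (rule sum.reindex_bij_witness[where i = "\<lambda>h. h \<circ> inv' g" and j = "\<lambda>h. h \<circ> g"])
     (use perm_groupD[OF C] g permutes_comp_inv[OF perm_groupD(1)[OF C g]] in auto)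

lemma perm_group_sum_inv:
  assumes C: "perm_group n C"
  shows "(\<Sum>h\<in>C. F (inv' h)) = (\<Sum>h\<in>C. F h)"
  by (rule sum.reindex_bij_witness[where i = inv' and j = inv'])
     (use perm_groupD[OF C] permutes_comp_inv(7)[OF perm_groupD(1)[OF C]] in auto)

lemma sign_comp: "p permutes {1..n::nat} \<Longrightarrow> q permutes {1..n} \<Longrightarrow> sign (p \<circ> q) = sign p * sign q"
  by (meson finite_atLeastAtMost permutation_permutes sign_compose)

lemma sign_inv: "p permutes {1..n::nat} \<Longrightarrow> sign (inv' p) = sign p"
  by (meson finite_atLeastAtMost permutation_permutes sign_inverse)

text \<open>The symmetric group acts on functions of \<open>s\<close> by precomposition. Tabloids and, later on, monomials
are both encoded as functions \<open>s\<close> of the entries \<open>1, \<dots>, n\<close>, so one action serves the Specht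
modules and the polynomials.\<close>

definition translate :: "(nat \<Rightarrow> nat) \<Rightarrow> ((nat \<Rightarrow> 'y) \<Rightarrow> rat) \<Rightarrow> (nat \<Rightarrow> 'y) \<Rightarrow> rat" where
  "translate g f = (\<lambda>s. f (s \<circ> g))"

definition symmetrize :: "(nat \<Rightarrow> nat) set \<Rightarrow> ((nat \<Rightarrow> 'y) \<Rightarrow> rat) \<Rightarrow> (nat \<Rightarrow> 'y) \<Rightarrow> rat" where
  "symmetrize R f = (\<lambda>s. \<Sum>r\<in>R. f (s \<circ> r))"

definition antisymmetrize :: "(nat \<Rightarrow> nat) set \<Rightarrow> ((nat \<Rightarrow> 'y) \<Rightarrow> rat) \<Rightarrow> (nat \<Rightarrow> 'y) \<Rightarrow> rat" where
  "antisymmetrize C f = (\<lambda>s. \<Sum>p\<in>C. of_int (sign p) * f (s \<circ> p))"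

lemma antisymmetrize_sign:
  assumes C: "perm_group n C" and q: "q \<in> C"
  shows "antisymmetrize C f (s \<circ> q) = of_int (sign q) * antisymmetrize C f s"
proof -
  have "antisymmetrize C f (s \<circ> q) = (\<Sum>p\<in>C. of_int (sign q) * (of_int (sign (q \<circ> p)) * f (s \<circ> (q \<circ> p))))"
    unfolding antisymmetrize_def
  proof (rule sum.cong)
    fix p assume "p \<in> C"
    then have "sign (q \<circ> p) = sign q * sign p" using sign_comp perm_groupD(1)[OF C] q by blast
    then show "of_int (sign p) * f (s \<circ> q \<circ> p) = of_int (sign q) * (of_int (sign (q \<circ> p)) * f (s \<circ> (q \<circ> p)))"
      by (simp add: comp_assoc mult.assoc[symmetric] flip: of_int_mult)
  qed simp
  also have "\<dots> = of_int (sign q) * antisymmetrize C f s"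
    unfolding antisymmetrize_def sum_distrib_left[symmetric]
    by (subst perm_group_sum_left[OF C q, where F = "\<lambda>p. of_int (sign p) * f (s \<circ> p)"]) simp
  finally show ?thesis .
qed

text \<open>Right multiplication by an element of \<open>R\<close> permutes the summands; \<open>symmetrize_invariant\<close> is the same
fact for left multiplication.\<close>

lemma symmetrize_translate:
  assumes R: "perm_group n R" and r: "r \<in> R"
  shows "symmetrize R (translate r f) = symmetrize R f"
  unfolding symmetrize_def translate_def comp_assoc
  by (rule ext) (rule perm_group_sum_right[OF R r])

lemma symmetrize_invariant:
  assumes R: "perm_group n R" and r: "r \<in> R"
  shows "symmetrize R f (s \<circ> r) = symmetrize R f s"
  unfolding symmetrize_def comp_assoc by (rule perm_group_sum_left[OF R r])

lemma symmetrize_of_invariant: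
  assumes "\<And>s r. r \<in> R \<Longrightarrow> f (s \<circ> r) = f s"
  shows "symmetrize R f = (\<lambda>s. of_nat (card R) * f s)"
  unfolding symmetrize_def using assms by simp

section \<open>Tableaux and their stabilizers\<close>

definition row_stabilizer :: "nat list \<Rightarrow> (nat \<times> nat \<Rightarrow> nat) \<Rightarrow> (nat \<Rightarrow> nat) set" where
  "row_stabilizer l t = {r. r permutes {1..sum_list l} \<and> tabloid l t \<circ> r = tabloid l t}"

text \<open>The locale fixes one tableau. Its row function \<open>row_of\<close> is its tabloid, and together with the
column function it is a system of coordinates on the entries.\<close>

locale young_tableau =
  fixes l :: "nat list" and t :: "nat \<times> nat \<Rightarrow> nat"
  assumes tableau: "t \<in> tableaux l"
begin

abbreviation "n \<equiv> sum_list l"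
abbreviation "row_of \<equiv> tabloid l t"
definition "col_of x = snd (cell_of l t x)"
abbreviation "C \<equiv> column_stabilizer l t"
abbreviation "R \<equiv> row_stabilizer l t"

lemma bij: "bij_betw t (young_diagram l) {1..n}" using tableau by (simp add: tableaux_def)

lemma cell_in: "x \<in> {1..n} \<Longrightarrow> cell_of l t x \<in> young_diagram l"
  unfolding cell_of_def using bij by (metis bij_betw_imp_surj_on inv_into_into)

lemma t_cell: "x \<in> {1..n} \<Longrightarrow> t (cell_of l t x) = x"
  unfolding cell_of_def using bij by (metis bij_betw_inv_into_right)

lemma cell_t: "c \<in> young_diagram l \<Longrightarrow> cell_of l t (t c) = c"
  unfolding cell_of_def using bij by (metis bij_betw_inv_into_left)

lemma t_in: "c \<in> young_diagram l \<Longrightarrow> t c \<in> {1..n}" using bij bij_betwE by blast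

lemma cell_eq: "x \<in> {1..n} \<Longrightarrow> cell_of l t x = (row_of x, col_of x)"
  by (simp add: tabloid_def col_of_def)

lemma row_col: "x \<in> {1..n} \<Longrightarrow> row_of x < length l \<and> col_of x < l ! row_of x"
  using cell_in[of x] by (simp add: cell_eq young_diagram_def)

lemma t_row_col: "x \<in> {1..n} \<Longrightarrow> t (row_of x, col_of x) = x"
  using t_cell by (simp add: cell_eq)

lemma row_col_inj: "x \<in> {1..n} \<Longrightarrow> y \<in> {1..n} \<Longrightarrow> row_of x = row_of y \<Longrightarrow> col_of x = col_of y \<Longrightarrow> x = y"
  using t_row_col by metis

lemma row_outside: "x \<notin> {1..n} \<Longrightarrow> row_of x = 0" unfolding tabloid_def by auto

lemma C_alt: "C = {p. p permutes {1..n} \<and> (\<forall>x\<in>{1..n}. col_of (p x) = col_of x)}"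
  by (simp add: column_stabilizer_def col_of_def)

lemma group_C: "perm_group n C"
proof -
  have "inv' p \<in> C" if "p \<in> C" for p
  proof -
    have p: "p permutes {1..n}" "\<And>x. x \<in> {1..n} \<Longrightarrow> col_of (p x) = col_of x" using that by (auto simp: C_alt)
    have "col_of (inv' p x) = col_of x" if x: "x \<in> {1..n}" for x
      using p(2)[of "inv' p x"] permutes_in_image[OF permutes_inv[OF p(1)]] permutes_inverses(1)[OF p(1)] x by metis
    then show ?thesis using p(1) by (simp add: C_alt permutes_inv)
  qed
  moreover have "p \<circ> q \<in> C" if "p \<in> C" "q \<in> C" for p q
  proof -
    have "q x \<in> {1..n}" if "x \<in> {1..n}" for x
      using that \<open>q \<in> C\<close> permutes_in_image by (fastforce simp: C_alt)
    then show ?thesis using that unfolding C_alt by (auto simp: permutes_compose)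
  qed
  ultimately show ?thesis unfolding perm_group_def by (auto simp: C_alt permutes_id)
qed

lemma group_R: "perm_group n R"
proof -
  have "inv' r \<in> R" if "r \<in> R" for r
  proof -
    have r: "r permutes {1..n}" "row_of \<circ> r = row_of" using that by (auto simp: row_stabilizer_def)
    have "row_of \<circ> inv' r = row_of" using permutes_comp_inv(3)[OF r(1), of row_of] r(2) by simp
    then show ?thesis using r(1) by (simp add: row_stabilizer_def permutes_inv)
  qed
  moreover have "p \<circ> q \<in> R" if "p \<in> R" "q \<in> R" for p q
    using that unfolding row_stabilizer_def by (auto simp: permutes_compose comp_assoc[symmetric])
  ultimately show ?thesis unfolding perm_group_def by (auto simp: row_stabilizer_def permutes_id)
qed

text \<open>An entry is determined by its row and its column, so the row and the column stabilizer intersect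
trivially.\<close>

lemma C_row_trivial: assumes "p \<in> C" "row_of \<circ> p = row_of" shows "p = id"
proof
  fix x
  show "p x = id x"
  proof (cases "x \<in> {1..n}")
    case True
    have "p x \<in> {1..n}" using assms(1) True permutes_in_image by (fastforce simp: C_alt)
    then show ?thesis using row_col_inj[of "p x" x] True assms by (auto simp: C_alt fun_eq_iff)
  next
    case False
    then show ?thesis using assms(1) by (auto simp: C_alt permutes_def)
  qed
qed

lemma polytabloid_antisymmetrize:
  "polytabloid l t = antisymmetrize C (\<lambda>s. if s = row_of then 1 else 0)"
proof
  fix s
  have "(s = row_of \<circ> inv' p) = (s \<circ> p = row_of)" if "p \<in> C" for p
    using permutes_comp_inv(3,4)[OF perm_groupD(1)[OF group_C that]] by metis
  then show "polytabloid l t s = antisymmetrize C (\<lambda>s. if s = row_of then 1 else 0) s"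
    unfolding polytabloid_def antisymmetrize_def by (intro sum.cong) auto
qed

lemma polytabloid_row: "polytabloid l t row_of = 1"
proof -
  have "polytabloid l t row_of = (\<Sum>p\<in>C. if p = id then 1 else 0)"
    unfolding polytabloid_antisymmetrize antisymmetrize_def
    by (intro sum.cong) (use C_row_trivial in auto)
  also have "\<dots> = 1" using perm_group_finite[OF group_C] perm_groupD(2)[OF group_C] by simp
  finally show ?thesis .
qed

lemma polytabloid_sign: "q \<in> C \<Longrightarrow> polytabloid l t (s \<circ> q) = of_int (sign q) * polytabloid l t s"
  unfolding polytabloid_antisymmetrize by (rule antisymmetrize_sign[OF group_C])

lemma transpose_C: "x \<in> {1..n} \<Longrightarrow> y \<in> {1..n} \<Longrightarrow> col_of x = col_of y \<Longrightarrow> Transposition.transpose x y \<in> C"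
  by (auto simp: C_alt permutes_swap_id) (auto simp: Transposition.transpose_def)

lemma transpose_R: "x \<in> {1..n} \<Longrightarrow> y \<in> {1..n} \<Longrightarrow> row_of x = row_of y \<Longrightarrow> Transposition.transpose x y \<in> R"
  by (auto simp: row_stabilizer_def permutes_swap_id fun_eq_iff) (auto simp: Transposition.transpose_def)

text \<open>If two entries of the same column of the tableau lie in the same row of \<open>s\<close>, then their
transposition fixes \<open>s\<close> and has sign \<open>-1\<close>.\<close>

lemma antisymmetrize_vanish:
  assumes "x \<in> {1..n}" "y \<in> {1..n}" "x \<noteq> y" "col_of x = col_of y" "s x = s y"
  shows "antisymmetrize C f s = 0"
proof -
  have "s \<circ> Transposition.transpose x y = s" using assms(5) by (auto simp: fun_eq_iff Transposition.transpose_def)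
  then show ?thesis using antisymmetrize_sign[OF group_C transpose_C[OF assms(1,2,4)], of f s] assms(3)
    by (simp add: sign_swap_id)
qed

lemma translate_tableau: "g permutes {1..n} \<Longrightarrow> young_tableau l (g \<circ> t)"
  by standard (use bij permutes_imp_bij in \<open>auto simp: tableaux_def intro!: bij_betw_trans\<close>)

lemma cell_translate:
  assumes g: "g permutes {1..n}" and x: "x \<in> {1..n}"
  shows "cell_of l (g \<circ> t) x = cell_of l t (inv' g x)"
proof -
  interpret g: young_tableau l "g \<circ> t" by (rule translate_tableau[OF g])
  have i: "inv' g x \<in> {1..n}" using x permutes_in_image[OF permutes_inv[OF g]] by blast
  have "(g \<circ> t) (cell_of l t (inv' g x)) = x" using t_cell[OF i] permutes_inverses(1)[OF g] by simp
  then show ?thesis using g.cell_t[OF cell_in[OF i]] by simp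
qed

lemma tabloid_translate:
  assumes g: "g permutes {1..n}" shows "tabloid l (g \<circ> t) = row_of \<circ> inv' g"
proof
  fix x show "tabloid l (g \<circ> t) x = (row_of \<circ> inv' g) x"
  proof (cases "x \<in> {1..n}")
    case True
    then have "inv' g x \<in> {1..n}" using permutes_in_image[OF permutes_inv[OF g]] by blast
    then show ?thesis unfolding tabloid_def o_apply cell_translate[OF g True] using True by simp
  next
    case False
    then show ?thesis using permutes_not_in[OF permutes_inv[OF g] False] unfolding tabloid_def o_apply by auto
  qed
qed

lemma column_stabilizer_translate:
  assumes g: "g permutes {1..n}"
  shows "column_stabilizer l (g \<circ> t) = (\<lambda>p. g \<circ> p \<circ> inv' g) ` C"
proof -
  interpret g: young_tableau l "g \<circ> t" by (rule translate_tableau[OF g])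
  have gi: "inv' g x \<in> {1..n} \<longleftrightarrow> x \<in> {1..n}" "g x \<in> {1..n} \<longleftrightarrow> x \<in> {1..n}" for x
    using permutes_in_image[OF permutes_inv[OF g]] permutes_in_image[OF g] by blast+
  have col_eq: "g.col_of x = col_of (inv' g x)" if "x \<in> {1..n}" for x
    using cell_translate[OF g that] by (simp add: g.col_of_def col_of_def)
  have inverses: "inv' g (g x) = x" "g (inv' g x) = x" for x using permutes_inverses[OF g] by auto
  have p_in: "p x \<in> {1..n}" if "p permutes {1..n}" "x \<in> {1..n}" for p x
    using that by (simp only: permutes_in_image)
  show ?thesis
  proof (intro equalityI subsetI)
    fix q assume "q \<in> column_stabilizer l (g \<circ> t)"
    then have q: "q permutes {1..n}" "\<And>x. x \<in> {1..n} \<Longrightarrow> g.col_of (q x) = g.col_of x" by (auto simp: g.C_alt)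
    have "col_of (inv' g (q (g x))) = col_of x" if "x \<in> {1..n}" for x
    proof -
      have gx: "g x \<in> {1..n}" using that gi by blast
      show ?thesis using q(2)[OF gx] col_eq[OF gx] col_eq[OF p_in[OF q(1) gx]] inverses by simp
    qed
    then have "inv' g \<circ> q \<circ> g \<in> C"
      using permutes_compose[OF g permutes_compose[OF q(1) permutes_inv[OF g]]] by (simp add: C_alt comp_assoc)
    moreover have "q = g \<circ> (inv' g \<circ> q \<circ> g) \<circ> inv' g" by (simp add: fun_eq_iff inverses)
    ultimately show "q \<in> (\<lambda>p. g \<circ> p \<circ> inv' g) ` C" by blast
  next
    fix q assume "q \<in> (\<lambda>p. g \<circ> p \<circ> inv' g) ` C"
    then obtain p where p: "p permutes {1..n}" "\<And>x. x \<in> {1..n} \<Longrightarrow> col_of (p x) = col_of x" "q = g \<circ> p \<circ> inv' g"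
      by (auto simp: C_alt)
    have "g.col_of (g (p (inv' g x))) = g.col_of x" if x: "x \<in> {1..n}" for x
    proof -
      have gx: "inv' g x \<in> {1..n}" using x gi by blast
      then have "g (p (inv' g x)) \<in> {1..n}" using p_in[OF p(1)] gi by blast
      then show ?thesis using p(2)[OF gx] col_eq[OF x] col_eq[of "g (p (inv' g x))"] inverses by simp
    qed
    then show "q \<in> column_stabilizer l (g \<circ> t)"
      using permutes_compose[OF permutes_inv[OF g] permutes_compose[OF p(1) g]] by (simp add: g.C_alt p(3) comp_assoc)
  qed
qed

lemma polytabloid_translate:
  assumes g: "g permutes {1..n}"
  shows "polytabloid l (g \<circ> t) = translate g (polytabloid l t)"
proof
  fix s
  have inj: "inj_on (\<lambda>p. g \<circ> p \<circ> inv' g) C"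
    by (rule inj_onI) (metis permutes_comp_inv(4)[OF g] permutes_comp_inv(6)[OF g])
  have *: "(s = tabloid l (g \<circ> t) \<circ> inv' (g \<circ> p \<circ> inv' g)) = (s \<circ> g = row_of \<circ> inv' p)"
    and **: "sign (g \<circ> p \<circ> inv' g) = sign p" if "p \<in> C" for p
  proof -
    have p: "p permutes {1..n}" using perm_groupD(1)[OF group_C that] .
    have "inv' (g \<circ> p \<circ> inv' g) = g \<circ> inv' p \<circ> inv' g"
      by (rule inv_unique_comp) (simp_all add: fun_eq_iff permutes_inverses[OF p] permutes_inverses[OF g])
    then have "tabloid l (g \<circ> t) \<circ> inv' (g \<circ> p \<circ> inv' g) = row_of \<circ> inv' p \<circ> inv' g"
      unfolding tabloid_translate[OF g] by (simp add: comp_assoc permutes_comp_inv[OF g])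
    then show "(s = tabloid l (g \<circ> t) \<circ> inv' (g \<circ> p \<circ> inv' g)) = (s \<circ> g = row_of \<circ> inv' p)"
      using permutes_comp_inv(3,4)[OF g] by metis
    show "sign (g \<circ> p \<circ> inv' g) = sign p"
      using sign_comp[OF permutes_compose[OF p g] permutes_inv[OF g]] sign_comp[OF g p] sign_inv[OF g] by simp
  qed
  show "polytabloid l (g \<circ> t) s = translate g (polytabloid l t) s"
  proof -
    let ?F = "\<lambda>q. if s = tabloid l (g \<circ> t) \<circ> inv' q then of_int (sign q) else (0::rat)"
    have "polytabloid l (g \<circ> t) s = sum ?F ((\<lambda>p. g \<circ> p \<circ> inv' g) ` C)"
      unfolding polytabloid_def column_stabilizer_translate[OF g] ..
    also have "\<dots> = (\<Sum>p\<in>C. ?F (g \<circ> p \<circ> inv' g))"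
      by (rule trans[OF sum.reindex[OF inj]], rule sum.cong, rule refl, rule o_apply)
    also have "\<dots> = translate g (polytabloid l t) s"
      unfolding polytabloid_def translate_def
    proof (rule sum.cong)
      fix p assume p: "p \<in> C"
      show "(if s = tabloid l (g \<circ> t) \<circ> inv' (g \<circ> p \<circ> inv' g) then of_int (sign (g \<circ> p \<circ> inv' g)) else 0) =
        (if s \<circ> g = row_of \<circ> inv' p then rat_of_int (sign p) else 0)"
        unfolding *[OF p] **[OF p] ..
    qed simp
    finally show ?thesis .
  qed
qed

text \<open>A tableau may take arbitrary values outside its diagram, so \<open>s\<close> and \<open>g \<circ> t\<close> agree only on the diagram
and in what depends on it.\<close>

lemma tableau_transitive:
  assumes s: "s \<in> tableaux l"
  obtains g where "g permutes {1..n}" "polytabloid l s = polytabloid l (g \<circ> t)" "tabloid l s = tabloid l (g \<circ> t)"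
    "\<And>c. c \<in> young_diagram l \<Longrightarrow> s c = g (t c)"
proof -
  interpret s: young_tableau l s by standard (rule s)
  define g where "g = (\<lambda>x. if x \<in> {1..n} then s (cell_of l t x) else x)"
  have "bij_betw (cell_of l t) {1..n} (young_diagram l)"
    unfolding cell_of_def using bij by (rule bij_betw_inv_into)
  then have "bij_betw (s \<circ> cell_of l t) {1..n} {1..n}" using s.bij by (rule bij_betw_trans)
  then have "bij_betw g {1..n} {1..n}" by (rule bij_betw_cong[THEN iffD1, rotated]) (simp add: g_def)
  then have g: "g permutes {1..n}" by (rule bij_imp_permutes) (simp only: g_def if_False)
  interpret g: young_tableau l "g \<circ> t" by (rule translate_tableau[OF g])
  have e: "(g \<circ> t) c = s c" if "c \<in> young_diagram l" for c
    using t_in[OF that] cell_t[OF that] by (simp add: g_def)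
  have cell: "cell_of l (g \<circ> t) = cell_of l s"
  proof (rule ext)
    fix x
    have "(\<lambda>c. c \<in> young_diagram l \<and> (g \<circ> t) c = x) = (\<lambda>c. c \<in> young_diagram l \<and> s c = x)"
      using e by auto
    then show "cell_of l (g \<circ> t) x = cell_of l s x" unfolding cell_of_def inv_into_def by (rule arg_cong)
  qed
  have "tabloid l s = tabloid l (g \<circ> t)" unfolding tabloid_def cell ..
  moreover have "column_stabilizer l s = column_stabilizer l (g \<circ> t)" unfolding column_stabilizer_def cell ..
  ultimately show thesis using that[OF g _ _ e[symmetric, simplified]] by (simp add: polytabloid_def)
qed

end

section \<open>Dominance and Young symmetrizers\<close>

text \<open>The first \<open>k\<close> parts, where missing parts count as zero; the pointwise order of these functions is the
dominance order.\<close>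

definition prefix_sum :: "nat list \<Rightarrow> nat \<Rightarrow> nat" where
  "prefix_sum l k = (\<Sum>i<k. if i < length l then l ! i else 0)"

definition young_op :: "nat list \<Rightarrow> (nat \<times> nat \<Rightarrow> nat) \<Rightarrow> ((nat \<Rightarrow> 'y) \<Rightarrow> rat) \<Rightarrow> (nat \<Rightarrow> 'y) \<Rightarrow> rat" where
  "young_op l t f = antisymmetrize (column_stabilizer l t) (symmetrize (row_stabilizer l t) f)"

definition tabloids :: "nat list \<Rightarrow> (nat \<Rightarrow> nat) set" where
  "tabloids l = tabloid l ` tableaux l"

context young_tableau
begin

lemma card_first_rows: "card {x \<in> {1..n}. row_of x < k} = prefix_sum l k"
proof -
  let ?D = "SIGMA i:{i. i < k \<and> i < length l}. {..<l ! i}"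
  have "bij_betw (\<lambda>x. (row_of x, col_of x)) {x \<in> {1..n}. row_of x < k} ?D"
  proof (rule bij_betw_byWitness[where f' = t])
    show "(\<lambda>x. (row_of x, col_of x)) ` {x \<in> {1..n}. row_of x < k} \<subseteq> ?D"
      using row_col by auto
    have "c \<in> young_diagram l" if "c \<in> ?D" for c using that by (auto simp: young_diagram_def)
    then have *: "t c \<in> {1..n}" "row_of (t c) = fst c" "col_of (t c) = snd c" if "c \<in> ?D" for c
      using t_in[of c] cell_t[of c] cell_eq[of "t c"] that by auto
    show "t ` ?D \<subseteq> {x \<in> {1..n}. row_of x < k}" using * by fastforce
    show "\<forall>c\<in>?D. (row_of (t c), col_of (t c)) = c" using * by auto
  qed (use t_row_col in auto)
  then have "card {x \<in> {1..n}. row_of x < k} = card ?D" by (rule bij_betw_same_card)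
  also have "\<dots> = (\<Sum>i\<in>{i. i < k \<and> i < length l}. l ! i)" by simp
  also have "\<dots> = prefix_sum l k"
    unfolding prefix_sum_def by (rule sum.mono_neutral_cong_left) auto
  finally show ?thesis .
qed

text \<open>Consider one column of the tableau. If it does not lie entirely in the first \<open>k\<close> rows, then it
meets each of these rows, since the lengths of the rows decrease, and so it has exactly \<open>k\<close> entries
there. A function that is injective on the column cannot take values below \<open>k\<close> more than \<open>k\<close> times.\<close>

lemma column_count:
  assumes sorted: "sorted_wrt (\<ge>) l"
    and inj: "\<And>x y. x \<in> {1..n} \<Longrightarrow> y \<in> {1..n} \<Longrightarrow> col_of x = col_of y \<Longrightarrow> u x = u y \<Longrightarrow> x = y"
  shows "card {x \<in> {1..n}. u x < k \<and> col_of x = c} \<le> card {x \<in> {1..n}. row_of x < k \<and> col_of x = c}"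
    (is "card ?A \<le> card ?B")
proof (cases "\<forall>x\<in>{1..n}. col_of x = c \<longrightarrow> row_of x < k")
  case True
  then show ?thesis by (intro card_mono) auto
next
  case False
  then obtain x where x: "x \<in> {1..n}" "col_of x = c" "k \<le> row_of x" by auto
  have cell: "(i, c) \<in> young_diagram l" if "i < k" for i
    using row_col[OF x(1)] x(2,3) that sorted_wrt_nth_less[OF sorted, of i "row_of x"]
    by (auto simp: young_diagram_def)
  have "card ?A \<le> card {..<k}"
    by (rule card_inj_on_le[of u]) (auto simp: inj_on_def intro: inj)
  also have "\<dots> \<le> card ?B"
  proof (rule card_inj_on_le[of "\<lambda>i. t (i, c)"])
    show "inj_on (\<lambda>i. t (i, c)) {..<k}"
    proof (rule inj_onI)
      fix i j assume ij: "i \<in> {..<k}" "j \<in> {..<k}" and eq: "t (i, c) = t (j, c)"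
      have "cell_of l t (t (i, c)) = (i, c)" "cell_of l t (t (j, c)) = (j, c)"
        using ij by (auto intro!: cell_t cell)
      then have "(i, c) = (j, c)" unfolding eq by (rule trans[OF sym])
      then show "i = j" by (rule Pair_inject)
    qed
    show "(\<lambda>i. t (i, c)) ` {..<k} \<subseteq> ?B"
    proof (rule image_subsetI)
      fix i assume "i \<in> {..<k}"
      then have i: "i < k" by simp
      show "t (i, c) \<in> ?B" using cell_t[OF cell[OF i]] t_in[OF cell[OF i]] cell_eq[OF t_in[OF cell[OF i]]] i by simp
    qed
  qed auto
  finally show ?thesis .
qed

lemma card_by_column: "card {x \<in> {1..n}. P x} = (\<Sum>c\<in>col_of ` {1..n}. card {x \<in> {1..n}. P x \<and> col_of x = c})"
proof -
  have "(\<Sum>c\<in>col_of ` {1..n}. card {x \<in> {x \<in> {1..n}. P x}. col_of x = c}) = card {x \<in> {1..n}. P x}"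
    using sum.group[of "{x \<in> {1..n}. P x}" "col_of ` {1..n}" col_of "\<lambda>_. 1::nat"] by fastforce
  then show ?thesis by (simp only: mem_Collect_eq conj_assoc)
qed

text \<open>The dominance lemma: counting by columns the entries in the first \<open>k\<close> rows of \<open>s\<close> gives at most the
number of entries in the first \<open>k\<close> rows of \<open>t\<close>.\<close>

lemma dominance:
  assumes sorted: "sorted_wrt (\<ge>) l" and s: "s \<in> tableaux m" and m: "sum_list m = n"
    and inj: "\<And>x y. x \<in> {1..n} \<Longrightarrow> y \<in> {1..n} \<Longrightarrow> col_of x = col_of y \<Longrightarrow> tabloid m s x = tabloid m s y \<Longrightarrow> x = y"
  shows "prefix_sum m k \<le> prefix_sum l k"
proof -
  interpret s: young_tableau m s by standard (rule s)
  have "prefix_sum m k = card {x \<in> {1..n}. tabloid m s x < k}" using s.card_first_rows m by simp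
  also have "\<dots> \<le> card {x \<in> {1..n}. row_of x < k}"
    unfolding card_by_column[of "\<lambda>x. tabloid m s x < k"] card_by_column[of "\<lambda>x. row_of x < k"]
    by (rule sum_mono) (rule column_count[OF sorted inj])
  finally show ?thesis unfolding card_first_rows .
qed

text \<open>For equal shapes the counts in \<open>dominance\<close> agree, hence they agree column by column and row by row.
So every entry can be moved within its column of \<open>t\<close> to the row that it has in \<open>s\<close>.\<close>

lemma column_rearrangement:
  assumes sorted: "sorted_wrt (\<ge>) l" and s: "s \<in> tableaux l"
    and inj: "\<And>x y. x \<in> {1..n} \<Longrightarrow> y \<in> {1..n} \<Longrightarrow> col_of x = col_of y \<Longrightarrow> tabloid l s x = tabloid l s y \<Longrightarrow> x = y"
  shows "\<exists>p\<in>C. tabloid l s = row_of \<circ> p"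
proof -
  interpret s: young_tableau l s by standard (rule s)
  let ?u = "tabloid l s"
  have eq: "card {x \<in> {1..n}. ?u x < k \<and> col_of x = c} = card {x \<in> {1..n}. row_of x < k \<and> col_of x = c}"
    if "c \<in> col_of ` {1..n}" for k c
  proof (rule sum_mono_inv[OF _ column_count[OF sorted inj] that])
    show "(\<Sum>c\<in>col_of ` {1..n}. card {x \<in> {1..n}. ?u x < k \<and> col_of x = c}) =
      (\<Sum>c\<in>col_of ` {1..n}. card {x \<in> {1..n}. row_of x < k \<and> col_of x = c})"
      using card_first_rows[of k] s.card_first_rows[of k]
      unfolding card_by_column[of "\<lambda>x. ?u x < k"] card_by_column[of "\<lambda>x. row_of x < k"] by simp
  qed auto
  have cell: "(?u x, col_of x) \<in> young_diagram l" if x: "x \<in> {1..n}" for x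
  proof -
    have split: "card {y \<in> {1..n}. f y < Suc k \<and> col_of y = col_of x} =
       card {y \<in> {1..n}. f y < k \<and> col_of y = col_of x} + card {y \<in> {1..n}. f y = k \<and> col_of y = col_of x}"
      for f :: "nat \<Rightarrow> nat" and k
      by (subst card_Un_disjoint[symmetric]) (auto intro!: arg_cong[where f = card])
    have "card {y \<in> {1..n}. ?u y = ?u x \<and> col_of y = col_of x} = card {y \<in> {1..n}. row_of y = ?u x \<and> col_of y = col_of x}"
      using split[of ?u "?u x"] split[of row_of "?u x"] eq[of "col_of x" "?u x"] eq[of "col_of x" "Suc (?u x)"] x by simp
    moreover have "card {y \<in> {1..n}. ?u y = ?u x \<and> col_of y = col_of x} > 0"
      using x by (auto simp: card_gt_0_iff)
    ultimately have "{y \<in> {1..n}. row_of y = ?u x \<and> col_of y = col_of x} \<noteq> {}" by (metis card.empty less_irrefl)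
    then obtain y where "y \<in> {1..n}" "row_of y = ?u x" "col_of y = col_of x" by auto
    then show ?thesis using row_col[of y] by (simp add: young_diagram_def)
  qed
  define p where "p x = (if x \<in> {1..n} then t (?u x, col_of x) else x)" for x
  have p: "p x \<in> {1..n} \<and> row_of (p x) = ?u x \<and> col_of (p x) = col_of x" if "x \<in> {1..n}" for x
    using t_in[OF cell[OF that]] cell_t[OF cell[OF that]] cell_eq[of "p x"] that by (auto simp: p_def)
  have "inj_on p {1..n}"
  proof (rule inj_onI)
    fix x y assume "x \<in> {1..n}" "y \<in> {1..n}" "p x = p y"
    then show "x = y" using p[of x] p[of y] inj by metis
  qed
  then have "bij_betw p {1..n} {1..n}"
    using p by (metis (mono_tags, lifting) endo_inj_surj bij_betw_imageI finite_atLeastAtMost image_subsetI)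
  then have "p permutes {1..n}" by (rule bij_imp_permutes) (auto simp: p_def)
  then have "p \<in> C" using p by (simp add: C_alt)
  moreover have "?u x = row_of (p x)" for x
    using p[of x] s.row_outside[of x] row_outside[of x] by (cases "x \<in> {1..n}") (auto simp: p_def)
  ultimately show ?thesis by (intro bexI[of _ p]) auto
qed

lemma tabloid_in: "row_of \<in> tabloids l" using tableau by (simp add: tabloids_def)

text \<open>Two entries in one row of \<open>t\<close> and in one column of \<open>s\<close> would give a transposition that is absorbed
by the row symmetrizer of \<open>t\<close> and negates the polytabloid of \<open>s\<close>.\<close>

lemma symmetrize_polytabloid_nonzero:
  assumes s: "s \<in> tableaux m" and m: "sum_list m = n"
    and nz: "symmetrize R (polytabloid m s) \<noteq> (\<lambda>_. 0)"
    and xy: "x \<in> {1..n}" "y \<in> {1..n}" "young_tableau.col_of m s x = young_tableau.col_of m s y" "row_of x = row_of y"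
  shows "x = y"
proof (rule ccontr)
  assume ne: "x \<noteq> y"
  interpret s: young_tableau m s by standard (rule s)
  let ?e = "polytabloid m s" and ?\<tau> = "Transposition.transpose x y"
  have "translate ?\<tau> ?e = (\<lambda>u. - ?e u)"
    using s.polytabloid_sign[OF s.transpose_C[of x y]] xy ne m by (auto simp: translate_def sign_swap_id)
  then have "symmetrize R ?e = symmetrize R (\<lambda>u. - ?e u)"
    using symmetrize_translate[OF group_R transpose_R[OF xy(1,2,4)], of ?e] by simp
  then have "symmetrize R ?e u = - symmetrize R ?e u" for u
    by (simp add: symmetrize_def fun_eq_iff sum_negf)
  then show False using nz by (auto simp: fun_eq_iff)
qed

lemma antisymmetrize_nonzero:
  assumes "antisymmetrize C f u \<noteq> 0" "x \<in> {1..n}" "y \<in> {1..n}" "col_of x = col_of y" "u x = u y"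
  shows "x = y"
  using antisymmetrize_vanish[of x y u f] assms by auto

end

lemma tabloids_comp:
  assumes u: "u \<in> tabloids l" and g: "g permutes {1..sum_list l}"
  shows "u \<circ> g \<in> tabloids l"
proof -
  obtain s where s: "s \<in> tableaux l" "u = tabloid l s" using u by (auto simp: tabloids_def)
  interpret s: young_tableau l s by standard (rule s)
  have "tabloid l (inv' g \<circ> s) = u \<circ> g"
    using s.tabloid_translate[OF permutes_inv[OF g]] permutes_inv_inv[OF g] s(2) by simp
  moreover have "inv' g \<circ> s \<in> tableaux l"
    using s.translate_tableau[OF permutes_inv[OF g]] by (simp add: young_tableau_def)
  ultimately show ?thesis unfolding tabloids_def by (metis image_eqI)
qed

lemma tabloids_comp_iff:
  assumes g: "g permutes {1..sum_list l}"
  shows "u \<circ> g \<in> tabloids l \<longleftrightarrow> u \<in> tabloids l"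
  using tabloids_comp[OF _ g] tabloids_comp[OF _ permutes_inv[OF g], of "u \<circ> g"] permutes_comp_inv(3)[OF g] by metis

lemma finite_tabloids: "finite (tabloids l)"
proof (cases "tableaux l = {}")
  case False
  then obtain t where "t \<in> tableaux l" by blast
  then interpret young_tableau l t by (rule young_tableau.intro)
  have "tabloids l \<subseteq> (\<lambda>g. tabloid l (g \<circ> t)) ` {g. g permutes {1..n}}"
    unfolding tabloids_def using tableau_transitive by blast
  then show ?thesis using finite_permutations[of "{1..n}"] by (meson finite_atLeastAtMost finite_surj)
qed (simp add: tabloids_def)

context young_tableau
begin

lemma antisymmetrize_support:
  assumes f: "\<And>u. f u \<noteq> 0 \<Longrightarrow> u \<in> tabloids m" and m: "sum_list m = n"
    and nz: "antisymmetrize C f u \<noteq> 0"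
  shows "u \<in> tabloids m"
proof -
  obtain p where p: "p \<in> C" "f (u \<circ> p) \<noteq> 0"
    using nz unfolding antisymmetrize_def by (metis (no_types, lifting) mult_zero_right sum.neutral)
  then show ?thesis using f[of "u \<circ> p"] tabloids_comp_iff[of p m] perm_groupD(1)[OF group_C] m by auto
qed

lemma symmetrize_support:
  assumes f: "\<And>u. f u \<noteq> 0 \<Longrightarrow> u \<in> tabloids m" and m: "sum_list m = n"
    and nz: "symmetrize R f u \<noteq> 0"
  shows "u \<in> tabloids m"
proof -
  obtain p where p: "p \<in> R" "f (u \<circ> p) \<noteq> 0"
    using nz unfolding symmetrize_def by (metis (no_types, lifting) sum.neutral)
  then show ?thesis using f[of "u \<circ> p"] tabloids_comp_iff[of p m] perm_groupD(1)[OF group_R] m by auto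
qed

lemma polytabloid_support: "polytabloid l t u \<noteq> 0 \<Longrightarrow> u \<in> tabloids l"
  unfolding polytabloid_antisymmetrize
  by (rule antisymmetrize_support) (auto simp: tabloid_in split: if_splits)

text \<open>If the row symmetrizer of \<open>t\<close> does not kill the polytabloid of \<open>s\<close>, then the rows of \<open>t\<close> are
transversal to the columns of \<open>s\<close>, and \<open>dominance\<close> applies. If the column antisymmetrizer of \<open>t\<close>
does not kill the result, then the columns of \<open>t\<close> are transversal to the rows of some tableau of the
shape of \<open>s\<close>, and \<open>dominance\<close> applies the other way round.\<close>

lemma young_op_other_shape:
  assumes s: "s \<in> tableaux m" and m: "sum_list m = n" and sorted: "sorted_wrt (\<ge>) l" "sorted_wrt (\<ge>) m"
    and nz: "young_op l t (polytabloid m s) \<noteq> (\<lambda>_. 0)"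
  shows "prefix_sum l = prefix_sum m"
proof
  fix k
  interpret s: young_tableau m s by standard (rule s)
  have "symmetrize R (polytabloid m s) \<noteq> (\<lambda>_. 0)"
    using nz by (auto simp: young_op_def antisymmetrize_def)
  from symmetrize_polytabloid_nonzero[OF s m this]
  have "prefix_sum l k \<le> prefix_sum m k"
    using s.dominance[OF sorted(2) tableau] m by auto
  moreover obtain u where u: "antisymmetrize C (symmetrize R (polytabloid m s)) u \<noteq> 0"
    using nz by (auto simp: young_op_def)
  have supp: "v \<in> tabloids m" if "symmetrize R (polytabloid m s) v \<noteq> 0" for v
    using symmetrize_support[OF s.polytabloid_support m that] .
  have "u \<in> tabloids m" using antisymmetrize_support[OF supp m u] .
  then obtain s' where "s' \<in> tableaux m" "u = tabloid m s'" by (auto simp: tabloids_def)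
  then have "prefix_sum m k \<le> prefix_sum l k"
    using dominance[OF sorted(1) _ m, of s'] antisymmetrize_nonzero[OF u] by auto
  ultimately show "prefix_sum l k = prefix_sum m k" by simp
qed

text \<open>By \<open>column_rearrangement\<close> the tabloids on which an antisymmetrized function can be nonzero form a
single orbit of the column stabilizer, so the function is determined by its value at \<open>t\<close>.\<close>

lemma antisymmetrize_same_shape:
  assumes f: "\<And>u. f u \<noteq> 0 \<Longrightarrow> u \<in> tabloids l" and sorted: "sorted_wrt (\<ge>) l"
  shows "antisymmetrize C f u = antisymmetrize C f row_of * polytabloid l t u"
proof (cases "antisymmetrize C f u = 0 \<and> polytabloid l t u = 0")
  case False
  \<comment> \<open>Either side may be the nonzero one; both are antisymmetrizations of functions on tabloids.\<close>
  let ?h = "if antisymmetrize C f u = 0 then (\<lambda>s. if s = row_of then 1 else 0) else f"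
  from False have nz: "antisymmetrize C ?h u \<noteq> 0" by (auto simp: polytabloid_antisymmetrize)
  have "u \<in> tabloids l" using nz by (rule antisymmetrize_support[rotated 2]) (auto simp: tabloid_in f split: if_splits)
  then obtain s where s: "s \<in> tableaux l" "u = tabloid l s" by (auto simp: tabloids_def)
  obtain p where p: "p \<in> C" "u = row_of \<circ> p"
    using column_rearrangement[OF sorted s(1)] antisymmetrize_nonzero[OF nz] s(2) by blast
  show ?thesis unfolding p(2) antisymmetrize_sign[OF group_C p(1)] polytabloid_sign[OF p(1)]
    by (simp add: polytabloid_row)
qed simp

end

text \<open>The inner product for which the tabloids are orthonormal; it is invariant under permutations.\<close>

definition tabloid_form :: "nat list \<Rightarrow> ((nat \<Rightarrow> nat) \<Rightarrow> rat) \<Rightarrow> ((nat \<Rightarrow> nat) \<Rightarrow> rat) \<Rightarrow> rat" where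
  "tabloid_form l f h = (\<Sum>u\<in>tabloids l. f u * h u)"

lemma tabloid_form_commute: "tabloid_form l f h = tabloid_form l h f"
  by (simp add: tabloid_form_def mult.commute)

lemma tabloid_form_translate:
  assumes g: "g permutes {1..sum_list l}"
  shows "tabloid_form l (translate g f) h = tabloid_form l f (translate (inv' g) h)"
  unfolding tabloid_form_def translate_def
  by (rule sum.reindex_bij_witness[where i = "\<lambda>u. u \<circ> inv' g" and j = "\<lambda>u. u \<circ> g"])
     (use tabloids_comp[OF _ g] tabloids_comp[OF _ permutes_inv[OF g]] in \<open>auto simp: permutes_comp_inv[OF g]\<close>)

context young_tableau
begin

lemma tabloid_form_symmetrize: "tabloid_form l (symmetrize R f) h = tabloid_form l f (symmetrize R h)"
proof -
  have "tabloid_form l (symmetrize R f) h = (\<Sum>r\<in>R. tabloid_form l (translate r f) h)"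
    unfolding tabloid_form_def symmetrize_def translate_def sum_distrib_right by (rule sum.swap)
  also have "\<dots> = (\<Sum>r\<in>R. tabloid_form l f (translate (inv' r) h))"
    by (intro sum.cong tabloid_form_translate) (use perm_groupD(1)[OF group_R] in auto)
  also have "\<dots> = (\<Sum>r\<in>R. tabloid_form l f (translate r h))"
    by (rule perm_group_sum_inv[OF group_R])
  also have "\<dots> = tabloid_form l f (symmetrize R h)"
    unfolding tabloid_form_def symmetrize_def translate_def sum_distrib_left by (rule sum.swap)
  finally show ?thesis .
qed

text \<open>The column antisymmetrizer is self-adjoint and maps the tabloid of \<open>t\<close> to the polytabloid of \<open>t\<close>.\<close>

lemma antisymmetrize_row: "antisymmetrize C f row_of = tabloid_form l f (polytabloid l t)"
proof -
  have "tabloid_form l f (polytabloid l t) = (\<Sum>p\<in>C. \<Sum>u\<in>tabloids l. of_int (sign p) * (if u = row_of \<circ> inv' p then f u else 0))"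
    unfolding tabloid_form_def polytabloid_def sum_distrib_left
    by (subst sum.swap) (auto intro!: sum.cong)
  also have "\<dots> = (\<Sum>p\<in>C. of_int (sign (inv' p)) * f (row_of \<circ> inv' p))"
  proof (rule sum.cong)
    fix p assume "p \<in> C"
    then have p: "p permutes {1..n}" using perm_groupD(1)[OF group_C] by blast
    have "(\<Sum>u\<in>tabloids l. of_int (sign p) * (if u = row_of \<circ> inv' p then f u else 0)) = of_int (sign p) * f (row_of \<circ> inv' p)"
      unfolding sum_distrib_left[symmetric]
      by (subst sum.delta[OF finite_tabloids]) (use tabloids_comp[OF tabloid_in permutes_inv[OF p]] in auto)
    then show "(\<Sum>u\<in>tabloids l. of_int (sign p) * (if u = row_of \<circ> inv' p then f u else 0)) = of_int (sign (inv' p)) * f (row_of \<circ> inv' p)"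
      using sign_inv[OF p] by simp
  qed simp
  also have "\<dots> = antisymmetrize C f row_of"
    unfolding antisymmetrize_def by (rule perm_group_sum_inv[OF group_C])
  finally show ?thesis ..
qed

lemma young_op_translate_polytabloid:
  assumes sorted: "sorted_wrt (\<ge>) l" and g: "g permutes {1..n}"
  shows "young_op l t (translate g (polytabloid l t)) =
    (\<lambda>u. tabloid_form l (symmetrize R (translate g (polytabloid l t))) (polytabloid l t) * polytabloid l t u)"
proof
  fix u
  have "v \<in> tabloids l" if "translate g (polytabloid l t) v \<noteq> 0" for v
    using that polytabloid_support[of "v \<circ> g"] tabloids_comp_iff[OF g] by (simp add: translate_def)
  then have "v \<in> tabloids l" if "symmetrize R (translate g (polytabloid l t)) v \<noteq> 0" for v
    using symmetrize_support[OF _ refl that] by blast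
  from antisymmetrize_same_shape[OF this sorted]
  show "young_op l t (translate g (polytabloid l t)) u =
    tabloid_form l (symmetrize R (translate g (polytabloid l t))) (polytabloid l t) * polytabloid l t u"
    unfolding young_op_def antisymmetrize_row[symmetric] .
qed

text \<open>Writing \<open>a\<close> for the row symmetrizer and \<open>e\<close> for the polytabloid, \<open>a a = |R| a\<close> and \<open>a\<close> is
self-adjoint, so \<open>|R| \<langle>a e, e\<rangle> = \<langle>a e, a e\<rangle>\<close>. This is positive, since \<open>a e\<close> has the coefficient \<open>|R|\<close>
at the tabloid of \<open>t\<close>.\<close>

lemma symmetrize_form_positive:
  "tabloid_form l (symmetrize R (polytabloid l t)) (polytabloid l t) > 0"
proof -
  let ?e = "polytabloid l t" let ?a = "symmetrize R ?e"
  have R: "0 < card R" using perm_group_finite[OF group_R] perm_groupD(2)[OF group_R] by (auto simp: card_gt_0_iff)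
  have "?a row_of = (\<Sum>r\<in>R. 1)" unfolding symmetrize_def
    by (rule sum.cong) (auto simp: row_stabilizer_def polytabloid_row)
  then have "?a row_of \<noteq> 0" using R by simp
  then have "0 < ?a row_of * ?a row_of" by (auto simp: zero_less_mult_iff neq_iff)
  also have "\<dots> \<le> tabloid_form l ?a ?a" unfolding tabloid_form_def
    by (rule member_le_sum[OF tabloid_in]) (auto simp: finite_tabloids)
  also have "\<dots> = tabloid_form l (symmetrize R ?a) ?e" by (rule tabloid_form_symmetrize[symmetric])
  also have "symmetrize R ?a = (\<lambda>u. of_nat (card R) * ?a u)"
    by (rule symmetrize_of_invariant) (rule symmetrize_invariant[OF group_R])
  also have "tabloid_form l \<dots> ?e = of_nat (card R) * tabloid_form l ?a ?e"
    by (simp add: tabloid_form_def sum_distrib_left mult.assoc)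
  finally show ?thesis using R by (simp add: zero_less_mult_iff)
qed

text \<open>By \<open>young_op_translate_polytabloid\<close> the operator \<open>b a\<close> sends each translate of the polytabloid \<open>e\<close> to
a multiple of \<open>e\<close>, with the coefficient \<open>\<gamma> g = \<langle>a g e, e\<rangle>\<close>. Pairing the sum with \<open>e\<close> gives the sum of the
squares of these coefficients, and \<open>\<gamma> id\<close> is positive.\<close>

lemma conjugate_sum_nonzero:
  assumes sorted: "sorted_wrt (\<ge>) l"
  shows "(\<lambda>u. \<Sum>g | g permutes {1..n}. translate g (symmetrize R (young_op l t (translate (inv' g) (polytabloid l t)))) u) \<noteq> (\<lambda>_. 0)"
proof
  let ?e = "polytabloid l t"
  let ?\<gamma> = "\<lambda>g. tabloid_form l (symmetrize R (translate g ?e)) ?e"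
  assume zero: "(\<lambda>u. \<Sum>g | g permutes {1..n}. translate g (symmetrize R (young_op l t (translate (inv' g) ?e))) u) = (\<lambda>_. 0)"
  have fin: "finite {g. g permutes {1..n}}" by (simp add: finite_permutations)
  have sc: "translate g (symmetrize R (\<lambda>u. q * ?e u)) = (\<lambda>u. q * translate g (symmetrize R ?e) u)" for q :: rat and g
    by (simp add: translate_def symmetrize_def sum_distrib_left)
  have sym: "tabloid_form l (translate g (symmetrize R ?e)) ?e = ?\<gamma> (inv' g)" if "g permutes {1..n}" for g
    using tabloid_form_translate[OF that] tabloid_form_symmetrize tabloid_form_commute by metis
  have "0 = tabloid_form l (\<lambda>u. \<Sum>g | g permutes {1..n}. translate g (symmetrize R (young_op l t (translate (inv' g) ?e))) u) ?e"
    unfolding zero by (simp add: tabloid_form_def)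
  also have "\<dots> = (\<Sum>g | g permutes {1..n}. tabloid_form l (translate g (symmetrize R (young_op l t (translate (inv' g) ?e)))) ?e)"
    unfolding tabloid_form_def sum_distrib_right by (rule sum.swap)
  also have "\<dots> = (\<Sum>g | g permutes {1..n}. ?\<gamma> (inv' g) * ?\<gamma> (inv' g))"
  proof (rule sum.cong)
    fix g assume "g \<in> {g. g permutes {1..n}}"
    then have g: "g permutes {1..n}" by simp
    have "tabloid_form l (translate g (symmetrize R (young_op l t (translate (inv' g) ?e)))) ?e =
       ?\<gamma> (inv' g) * tabloid_form l (translate g (symmetrize R ?e)) ?e"
      unfolding young_op_translate_polytabloid[OF sorted permutes_inv[OF g]] sc
      by (simp add: tabloid_form_def sum_distrib_left mult.assoc)
    then show "tabloid_form l (translate g (symmetrize R (young_op l t (translate (inv' g) ?e)))) ?e = ?\<gamma> (inv' g) * ?\<gamma> (inv' g)"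
      using sym[OF g] by simp
  qed simp
  also have "\<dots> \<ge> ?\<gamma> (inv' id) * ?\<gamma> (inv' id)"
    by (rule member_le_sum) (simp_all only: fin permutes_id mem_Collect_eq zero_le_square)
  finally have "?\<gamma> (inv' id) * ?\<gamma> (inv' id) \<le> 0" .
  moreover have "translate (inv' id) ?e = ?e" unfolding inv_id by (simp add: translate_def)
  ultimately show False using mult_pos_pos[OF symmetrize_form_positive symmetrize_form_positive] by simp
qed

end

interpretation fn: vector_space "\<lambda>(q::rat) (f :: 'a \<Rightarrow> rat). (\<lambda>x. q * f x)"
  by standard (auto simp: fun_eq_iff algebra_simps)

lemma sum_fun_apply: "(\<Sum>i\<in>A. F i) x = (\<Sum>i\<in>A. F i x)"
  by (induction A rule: infinite_finite_induct) auto

section \<open>Cycle types\<close>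

text \<open>The cycles are the rows of a tableau, and the permutation shifts each row cyclically.\<close>

definition has_cycle_type :: "(nat \<Rightarrow> nat) \<Rightarrow> nat list \<Rightarrow> bool" where
  "has_cycle_type p l \<longleftrightarrow>
     (\<exists>h\<in>tableaux l. \<forall>(r, c)\<in>young_diagram l. p (h (r, c)) = h (r, Suc c mod l ! r))"

text \<open>A decomposition into disjoint cycles, in a form that is insensitive to the order of the cycles, so
that they can be sorted by length afterwards.\<close>

lemma cycle_lists:
  assumes "cycle_decomp S p"
  shows "p permutes S \<and> (\<exists>css. distinct css \<and> (\<forall>cs\<in>set css. cs \<noteq> [] \<and> distinct cs) \<and>
     (\<forall>cs\<in>set css. \<forall>ds\<in>set css. cs \<noteq> ds \<longrightarrow> set cs \<inter> set ds = {}) \<and> \<Union>(set ` set css) = S \<and>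
     (\<forall>cs\<in>set css. \<forall>i<length cs. p (cs ! i) = cs ! (Suc i mod length cs)))"
  using assms
proof induction
  case empty
  then show ?case by (auto intro!: exI[of _ "[]"] simp: permutes_id)
next
  case (comp I p cs)
  have p: "p permutes I" using comp.IH by (rule conjunct1)
  from conjunct2[OF comp.IH] obtain css where css': "distinct css" "\<forall>cs\<in>set css. cs \<noteq> [] \<and> distinct cs"
     "\<forall>cs\<in>set css. \<forall>ds\<in>set css. cs \<noteq> ds \<longrightarrow> set cs \<inter> set ds = {}"
     "\<Union>(set ` set css) = I"
     "\<forall>cs\<in>set css. \<forall>i<length cs. p (cs ! i) = cs ! (Suc i mod length cs)"
    by (elim exE conjE)
  note css = css'(1) css'(2)[rule_format] css'(3)[rule_format] css'(4) css'(5)[rule_format]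
  have perm: "cycle_of_list cs \<circ> p permutes set cs \<union> I"
    using cycle_permutes[of cs] p by (auto intro!: permutes_compose elim: permutes_subset)
  show ?case
  proof (cases "cs = []")
    case True
    then show ?thesis using perm comp.IH by simp
  next
    case False
    have old: "(cycle_of_list cs \<circ> p) (ds ! i) = ds ! (Suc i mod length ds)" if "ds \<in> set css" "i < length ds" for ds i
    proof -
      have "ds ! (Suc i mod length ds) \<in> I" using that css(4) by (metis UN_I length_pos_if_in_set mod_less_divisor nth_mem)
      then show ?thesis using css(5)[OF that] comp.hyps(3) by (auto intro!: id_outside_supp)
    qed
    have new: "(cycle_of_list cs \<circ> p) (cs ! i) = cs ! (Suc i mod length cs)" if "i < length cs" for i
    proof -
      have "p (cs ! i) = cs ! i" using permutes_not_in[OF p, of "cs ! i"] that comp.hyps(3) nth_mem by blast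
      moreover have "map (cycle_of_list cs) cs ! i = rotate1 cs ! i"
        using cyclic_rotation[OF comp.hyps(2), of 1] by simp
      ultimately show ?thesis using that by (simp add: nth_rotate1)
    qed
    have dis: "set cs \<inter> set ds = {}" if "ds \<in> set css" for ds using that css(4) comp.hyps(3) by blast
    show ?thesis
    proof (intro conjI perm exI[of _ "cs # css"])
      show "distinct (cs # css)" using css(1) dis[of cs] False by auto
      show "\<forall>ds\<in>set (cs # css). ds \<noteq> [] \<and> distinct ds" using css(2) False comp.hyps(2) by auto
      show "\<forall>a\<in>set (cs # css). \<forall>b\<in>set (cs # css). a \<noteq> b \<longrightarrow> set a \<inter> set b = {}"
        using css(3) dis by auto
      show "\<Union> (set ` set (cs # css)) = set cs \<union> I" using css(4) by auto
      show "\<forall>ds\<in>set (cs # css). \<forall>i<length ds. (cycle_of_list cs \<circ> p) (ds ! i) = ds ! (Suc i mod length ds)"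
        using old new by auto
    qed
  qed
qed

lemma cycle_type_exists:
  assumes p: "p permutes {1..n}"
  obtains l where "sorted_wrt (\<ge>) l" "0 \<notin> set l" "sum_list l = n" "has_cycle_type p l"
proof -
  from conjunct2[OF cycle_lists[OF cycle_decomposition[OF p finite_atLeastAtMost]]]
  obtain css0 where css0': "distinct css0" "\<forall>cs\<in>set css0. cs \<noteq> [] \<and> distinct cs"
     "\<forall>cs\<in>set css0. \<forall>ds\<in>set css0. cs \<noteq> ds \<longrightarrow> set cs \<inter> set ds = {}"
     "\<Union>(set ` set css0) = {1..n}"
     "\<forall>cs\<in>set css0. \<forall>i<length cs. p (cs ! i) = cs ! (Suc i mod length cs)"
    by (elim exE conjE)
  note css0 = css0'(1) css0'(2)[rule_format] css0'(3)[rule_format] css0'(4) css0'(5)[rule_format]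
  \<comment> \<open>The rows of a diagram must have decreasing lengths.\<close>
  define css where "css = rev (sort_key length css0)"
  have set: "set css = set css0" by (simp add: css_def)
  note css = css0[folded set]
  have dist: "distinct css" using css0(1) by (simp add: css_def)
  define l where "l = map length css"
  have "sorted (map length (sort_key length css0))" by simp
  then have sorted: "sorted_wrt (\<ge>) l"
    by (simp add: l_def css_def rev_map[symmetric] sorted_wrt_rev)
  have pos: "0 \<notin> set l" using css(2) by (auto simp: l_def)
  define h where "h = (\<lambda>(r, c). css ! r ! c)"
  have yd: "young_diagram l = {(r, c). r < length css \<and> c < length (css ! r)}"
    by (auto simp: young_diagram_def l_def)
  have inj: "inj_on h (young_diagram l)"
  proof (rule inj_onI, clarify)
    fix r c r' c' assume a: "(r, c) \<in> young_diagram l" "(r', c') \<in> young_diagram l" "h (r, c) = h (r', c')"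
    have "css ! r \<in> set css" "css ! r ! c \<in> set (css ! r)" using a(1) by (simp_all add: yd)
    moreover have "css ! r' \<in> set css" "css ! r' ! c' \<in> set (css ! r')" using a(2) by (simp_all add: yd)
    moreover have "css ! r ! c = css ! r' ! c'" using a(3) by (simp add: h_def)
    ultimately have "css ! r = css ! r'" using css(3)[of "css ! r" "css ! r'"] by auto
    then have "r = r'" using a dist by (auto simp: yd nth_eq_iff_index_eq)
    moreover have "c = c'" using a css(2)[of "css ! r"] \<open>r = r'\<close> by (auto simp: yd h_def nth_eq_iff_index_eq)
    ultimately show "r = r' \<and> c = c'" ..
  qed
  have "h ` young_diagram l = \<Union>(set ` set css)"
  proof (intro equalityI subsetI)
    fix x assume "x \<in> \<Union>(set ` set css)"
    then obtain cs where "cs \<in> set css" "x \<in> set cs" by blast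
    then obtain r c where "r < length css" "cs = css ! r" "c < length cs" "x = cs ! c" by (metis in_set_conv_nth)
    then show "x \<in> h ` young_diagram l" by (auto simp: yd h_def intro!: image_eqI[of _ _ "(r, c)"])
  qed (auto simp: yd h_def intro!: bexI[OF _ nth_mem])
  then have bij: "bij_betw h (young_diagram l) {1..n}" using inj css(4) by (simp add: bij_betw_def)
  have "young_diagram l = (SIGMA r:{..<length l}. {..<l ! r})" by (auto simp: young_diagram_def)
  then have "card (young_diagram l) = sum_list l"
    by (simp add: sum_list_sum_nth atLeast0LessThan)
  then have sum: "sum_list l = n" using bij_betw_same_card[OF bij] by simp
  have "has_cycle_type p l"
    unfolding has_cycle_type_def
  proof (intro bexI[of _ h] ballI, clarify)
    fix r c assume "(r, c) \<in> young_diagram l"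
    then have "r < length css" "c < length (css ! r)" by (simp_all add: yd)
    then show "p (h (r, c)) = h (r, Suc c mod l ! r)"
      using css(5)[of "css ! r" c] by (simp add: h_def l_def)
  qed (use bij sum in \<open>simp add: tableaux_def\<close>)
  with sorted pos sum show thesis using that by blast
qed

text \<open>The permutation that carries one tableau of cycles to the other one conjugates the two permutations.\<close>

lemma cycle_type_conjugate:
  assumes p: "p permutes {1..sum_list l}" "has_cycle_type p l"
    and q: "q permutes {1..sum_list l}" "has_cycle_type q l"
  obtains g where "g permutes {1..sum_list l}" "q = g \<circ> p \<circ> inv' g"
proof -
  obtain h where h: "h \<in> tableaux l" "\<And>r c. (r, c) \<in> young_diagram l \<Longrightarrow> p (h (r, c)) = h (r, Suc c mod l ! r)"
    using p(2) unfolding has_cycle_type_def by fast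
  obtain k where k: "k \<in> tableaux l" "\<And>r c. (r, c) \<in> young_diagram l \<Longrightarrow> q (k (r, c)) = k (r, Suc c mod l ! r)"
    using q(2) unfolding has_cycle_type_def by fast
  interpret h: young_tableau l h by standard (rule h(1))
  obtain g where g: "g permutes {1..sum_list l}" "\<And>c. c \<in> young_diagram l \<Longrightarrow> k c = g (h c)"
    using h.tableau_transitive[OF k(1)] by metis
  have "q (g x) = g (p x)" for x
  proof (cases "x \<in> {1..sum_list l}")
    case True
    obtain r c where rc: "(r, c) \<in> young_diagram l" "x = h (r, c)"
      using h.cell_in[OF True] h.t_cell[OF True] by (metis surj_pair)
    then have rc': "(r, Suc c mod l ! r) \<in> young_diagram l" by (auto simp: young_diagram_def)
    show ?thesis using rc h(2)[OF rc(1)] k(2)[OF rc(1)] g(2)[OF rc(1)] g(2)[OF rc'] by simp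
  next
    case False
    then show ?thesis using p(1) q(1) g(1) by (simp add: permutes_not_in)
  qed
  from this[of "inv' g x" for x] have "q x = g (p (inv' g x))" for x
    by (simp add: permutes_inverses(1)[OF g(1)])
  then have "q = g \<circ> p \<circ> inv' g" by (simp add: fun_eq_iff)
  with g(1) show thesis using that by blast
qed

section \<open>Shapes with a long first row\<close>

text \<open>The partitions \<open>\<lambda>\<close> for which \<open>V(\<lambda>)_n\<close> is defined. Putting the missing boxes into a new first row makes
them correspond to the shapes of size \<open>n\<close>.\<close>

definition stable_index :: "nat \<Rightarrow> nat list set" where
  "stable_index n = {l. is_partition l \<and> n \<in> admissible l}"

definition padded :: "nat \<Rightarrow> nat list \<Rightarrow> nat list" where
  "padded n l = (n - sum_list l) # l"

lemma padded:
  assumes "l \<in> stable_index n"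
  shows "sum_list (padded n l) = n" "sorted_wrt (\<ge>) (padded n l)"
proof -
  show "sum_list (padded n l) = n" using assms by (auto simp: padded_def stable_index_def admissible_def)
  have "l = [] \<or> hd l \<le> n - sum_list l" "\<And>x. x \<in> set l \<Longrightarrow> x \<le> hd l"
    using assms by (auto simp: stable_index_def admissible_def is_partition_def neq_Nil_conv split: if_splits)
  then show "sorted_wrt (\<ge>) (padded n l)" using assms
    by (auto simp: padded_def stable_index_def is_partition_def intro: order_trans)
qed

lemma finite_stable_index: "finite (stable_index n)"
proof (rule finite_subset[OF _ finite_lists_length_le[of "{..n}" n]])
  have "length l \<le> sum_list l" if "0 \<notin> set l" for l :: "nat list"
    using that by (induction l) auto
  moreover have "x \<le> sum_list l" if "x \<in> set l" for x and l :: "nat list"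
    using that by (rule member_le_sum_list) simp
  ultimately show "stable_index n \<subseteq> {l. set l \<subseteq> {..n} \<and> length l \<le> n}"
    by (fastforce simp: stable_index_def is_partition_def admissible_def)
qed simp

lemma prefix_sum_padded_inj:
  assumes l: "l \<in> stable_index n" and m: "m \<in> stable_index n"
    and eq: "prefix_sum (padded n l) = prefix_sum (padded n m)"
  shows "l = m"
proof -
  have e: "(if i < length l then l ! i else 0) = (if i < length m then m ! i else 0)" for i
    using fun_cong[OF eq, of "Suc i"] fun_cong[OF eq, of "Suc (Suc i)"]
    by (simp add: prefix_sum_def padded_def cong: if_cong)
  have nz: "l ! i \<noteq> 0" if "i < length l" for i using l nth_mem[OF that] by (metis (mono_tags, lifting) is_partition_def mem_Collect_eq stable_index_def)
  have nz': "m ! i \<noteq> 0" if "i < length m" for i using m nth_mem[OF that] by (metis (mono_tags, lifting) is_partition_def mem_Collect_eq stable_index_def)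
  have "i < length l \<longleftrightarrow> i < length m" for i using e[of i] nz[of i] nz'[of i] by (auto split: if_splits)
  then have "length l = length m" by (metis nat_neq_iff)
  then show ?thesis using e by (intro nth_equalityI) metis+
qed

text \<open>For positive \<open>n\<close> the largest cycle is split off as the padded first row. For \<open>n = 0\<close> the padded shape
is the list with the single entry \<open>0\<close>, whose diagram is empty.\<close>

lemma cycle_type_stable:
  assumes p: "p permutes {1..n}"
  shows "\<exists>l\<in>stable_index n. has_cycle_type p (padded n l)"
proof (cases "n = 0")
  case True
  \<comment> \<open>Every function is a tableau of the empty diagram.\<close>
  have "young_diagram (padded n []) = {}" by (auto simp: True padded_def young_diagram_def less_Suc_eq_0_disj)
  then have "has_cycle_type p (padded n [])" unfolding has_cycle_type_def
    by (intro bexI[of _ undefined]) (auto simp: True padded_def tableaux_def bij_betw_def)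
  then show ?thesis using True by (intro bexI[of _ "[]"]) (auto simp: stable_index_def is_partition_def admissible_def)
next
  case False
  obtain l where l: "sorted_wrt (\<ge>) l" "0 \<notin> set l" "sum_list l = n" "has_cycle_type p l"
    using cycle_type_exists[OF p] .
  with False obtain a m where am: "l = a # m" by (cases l) auto
  have "padded n m = l" using l(3) am by (auto simp: padded_def)
  moreover have "m \<in> stable_index n"
    using l am by (cases m) (auto simp: stable_index_def is_partition_def admissible_def)
  ultimately show ?thesis using l(4) by auto
qed

section \<open>Central elements of the group algebra\<close>

text \<open>The action of the central element \<open>\<Sum>g. g a b a g\<^sup>-\<^sup>1\<close> of the group algebra; \<open>conj_coeff\<close> gives its
coefficients.\<close>

definition conj_op :: "nat \<Rightarrow> nat list \<Rightarrow> (nat \<times> nat \<Rightarrow> nat) \<Rightarrow> ((nat \<Rightarrow> 'y) \<Rightarrow> rat) \<Rightarrow> (nat \<Rightarrow> 'y) \<Rightarrow> rat" where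
  "conj_op n l t f = (\<lambda>s. \<Sum>g | g permutes {1..n}.
     translate g (symmetrize (row_stabilizer l t) (young_op l t (translate (inv' g) f))) s)"

definition conj_coeff :: "nat \<Rightarrow> nat list \<Rightarrow> (nat \<times> nat \<Rightarrow> nat) \<Rightarrow> (nat \<Rightarrow> nat) \<Rightarrow> rat" where
  "conj_coeff n l t h = (\<Sum>g | g permutes {1..n}.
     \<Sum>(r, p, r')\<in>row_stabilizer l t \<times> column_stabilizer l t \<times> row_stabilizer l t.
       if g \<circ> (r \<circ> p \<circ> r') \<circ> inv' g = h then of_int (sign p) else 0)"

context young_tableau
begin

lemma conj_op_coeff:
  "conj_op n l t f s = (\<Sum>h | h permutes {1..n}. conj_coeff n l t h * f (s \<circ> h))"
proof -
  let ?S = "{g. g permutes {1..n}}" and ?D = "R \<times> C \<times> R"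
  let ?k = "\<lambda>g. \<lambda>(r, p, r'). g \<circ> (r \<circ> p \<circ> r') \<circ> inv' g"
  let ?F = "\<lambda>g h d. if ?k g d = h then of_int (sign (fst (snd d))) * f (s \<circ> h) else 0"
  let ?G = "\<lambda>g d. of_int (sign (fst (snd d))) * f (s \<circ> ?k g d)"
  have fin: "finite ?S" by (simp add: finite_permutations)
  have "(\<Sum>h\<in>?S. conj_coeff n l t h * f (s \<circ> h)) = (\<Sum>h\<in>?S. \<Sum>g\<in>?S. \<Sum>d\<in>?D. ?F g h d)"
    unfolding conj_coeff_def sum_distrib_right by (intro sum.cong) auto
  also have "\<dots> = (\<Sum>g\<in>?S. \<Sum>h\<in>?S. \<Sum>d\<in>?D. ?F g h d)" by (rule sum.swap)
  also have "\<dots> = (\<Sum>g\<in>?S. \<Sum>d\<in>?D. ?G g d)"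
  proof (rule sum.cong[OF refl])
    fix g assume "g \<in> ?S"
    then have g: "g permutes {1..n}" by simp
    have "(\<Sum>h\<in>?S. \<Sum>d\<in>?D. ?F g h d) = (\<Sum>d\<in>?D. \<Sum>h\<in>?S. ?F g h d)" by (rule sum.swap)
    also have "\<dots> = (\<Sum>d\<in>?D. ?G g d)"
    proof (rule sum.cong[OF refl])
      fix d assume "d \<in> ?D"
      then have "?k g d permutes {1..n}"
        using g perm_groupD(1)[OF group_R] perm_groupD(1)[OF group_C]
        by (auto intro!: permutes_compose permutes_inv)
      then show "(\<Sum>h\<in>?S. ?F g h d) = ?G g d" by (subst sum.delta'[OF fin]) simp
    qed
    finally show "(\<Sum>h\<in>?S. \<Sum>d\<in>?D. ?F g h d) = (\<Sum>d\<in>?D. ?G g d)" .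
  qed
  also have "\<dots> = conj_op n l t f s"
    unfolding conj_op_def young_op_def symmetrize_def antisymmetrize_def translate_def
    by (simp add: sum.cartesian_product' sum_distrib_left comp_assoc)
  finally show ?thesis ..
qed

lemma conj_coeff_class:
  assumes k: "k permutes {1..n}"
  shows "conj_coeff n l t (k \<circ> h \<circ> inv' k) = conj_coeff n l t h"
proof -
  let ?D = "R \<times> C \<times> R"
  have "conj_coeff n l t (k \<circ> h \<circ> inv' k) = (\<Sum>g | g permutes {1..n}.
     \<Sum>(r, p, r')\<in>?D. if (k \<circ> g) \<circ> (r \<circ> p \<circ> r') \<circ> inv' (k \<circ> g) = k \<circ> h \<circ> inv' k then of_int (sign p) else 0)"
    unfolding conj_coeff_def
    by (rule perm_group_sum_left[OF perm_group_permutations, symmetric]) (use k in simp)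
  also have "\<dots> = conj_coeff n l t h" unfolding conj_coeff_def
  proof (rule sum.cong[OF refl])
    fix g assume "g \<in> {g. g permutes {1..n}}"
    then have g: "g permutes {1..n}" by simp
    have "((k \<circ> g) \<circ> x \<circ> inv' (k \<circ> g) = k \<circ> h \<circ> inv' k) = (g \<circ> x \<circ> inv' g = h)" for x
    proof -
      have "inv' (k \<circ> g) = inv' g \<circ> inv' k" using g k by (simp add: o_inv_distrib permutes_bij)
      then have "(k \<circ> g) \<circ> x \<circ> inv' (k \<circ> g) = k \<circ> (g \<circ> x \<circ> inv' g) \<circ> inv' k" by (simp add: comp_assoc)
      moreover have "(k \<circ> y \<circ> inv' k = k \<circ> h \<circ> inv' k) = (y = h)" for y
        using permutes_comp_inv(4,6)[OF k] by metis
      ultimately show ?thesis by simp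
    qed
    then show "(\<Sum>(r, p, r')\<in>?D. if (k \<circ> g) \<circ> (r \<circ> p \<circ> r') \<circ> inv' (k \<circ> g) = k \<circ> h \<circ> inv' k then rat_of_int (sign p) else 0) =
       (\<Sum>(r, p, r')\<in>?D. if g \<circ> (r \<circ> p \<circ> r') \<circ> inv' g = h then of_int (sign p) else 0)"
      by simp
  qed
  finally show ?thesis .
qed

end

text \<open>For a fixed \<open>n\<close> the choice of the tableaux is immaterial; it will matter when \<open>n\<close> grows. The
operator \<open>b a\<close> of the chosen tableau is \<open>Y l\<close>.\<close>

locale tableau_choice =
  fixes n :: nat and T :: "nat list \<Rightarrow> nat \<times> nat \<Rightarrow> nat"
  assumes T: "l \<in> stable_index n \<Longrightarrow> T l \<in> tableaux (padded n l)"
begin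

lemma young_tableau: "l \<in> stable_index n \<Longrightarrow> young_tableau (padded n l) (T l)"
  using T by (simp add: young_tableau_def)

abbreviation "Y l \<equiv> young_op (padded n l) (T l)"
abbreviation "S \<equiv> {g. g permutes {1..n}}"

lemma young_op_vanish:
  assumes l: "l \<in> stable_index n" and m: "m \<in> stable_index n" and ne: "l \<noteq> m"
    and s: "s \<in> tableaux (padded n m)"
  shows "Y l (polytabloid (padded n m) s) = (\<lambda>_. 0)"
  using young_tableau.young_op_other_shape[OF young_tableau[OF l] s] padded[OF l] padded[OF m]
    prefix_sum_padded_inj[OF l m] ne by auto

text \<open>On the polytabloid of the shape \<open>m\<close> only the central element of the same shape survives, and it acts
nontrivially.\<close>

lemma central_independent:
  assumes zero: "\<And>h. h permutes {1..n} \<Longrightarrow> (\<Sum>l\<in>stable_index n. \<alpha> l * conj_coeff n (padded n l) (T l) h) = 0"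
    and m: "m \<in> stable_index n"
  shows "\<alpha> m = 0"
proof -
  interpret m: young_tableau "padded n m" "T m" by (rule young_tableau[OF m])
  let ?e = "polytabloid (padded n m) (T m)"
  have "\<alpha> m * conj_op n (padded n m) (T m) ?e s = 0" for s
  proof -
    have "0 = (\<Sum>h\<in>S. (\<Sum>l\<in>stable_index n. \<alpha> l * conj_coeff n (padded n l) (T l) h) * ?e (s \<circ> h))"
      using zero by simp
    also have "\<dots> = (\<Sum>l\<in>stable_index n. \<alpha> l * (\<Sum>h\<in>S. conj_coeff n (padded n l) (T l) h * ?e (s \<circ> h)))"
      unfolding sum_distrib_right sum_distrib_left by (subst sum.swap) (simp add: mult.assoc)
    also have "\<dots> = (\<Sum>l\<in>stable_index n. if l = m then \<alpha> m * conj_op n (padded n m) (T m) ?e s else 0)"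
    proof (rule sum.cong[OF refl])
      fix l assume l: "l \<in> stable_index n"
      have e: "(\<Sum>h\<in>S. conj_coeff n (padded n l) (T l) h * ?e (s \<circ> h)) = conj_op n (padded n l) (T l) ?e s"
        using young_tableau.conj_op_coeff[OF young_tableau[OF l]] padded[OF l] by metis
      have "conj_op n (padded n l) (T l) ?e s = 0" if "l \<noteq> m"
        unfolding conj_op_def
      proof (rule sum.neutral, rule ballI)
        fix g assume "g \<in> S"
        then have g: "inv' g permutes {1..sum_list (padded n m)}" using padded[OF m] by (simp add: permutes_inv)
        have "Y l (translate (inv' g) ?e) = (\<lambda>_. 0)"
          unfolding m.polytabloid_translate[OF g, symmetric]
          by (rule young_op_vanish[OF l m that]) (use m.translate_tableau[OF g] in \<open>simp add: young_tableau_def\<close>)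
        then show "translate g (symmetrize (row_stabilizer (padded n l) (T l)) (Y l (translate (inv' g) ?e))) s = 0"
          by (simp add: translate_def symmetrize_def)
      qed
      then show "\<alpha> l * (\<Sum>h\<in>S. conj_coeff n (padded n l) (T l) h * ?e (s \<circ> h)) =
        (if l = m then \<alpha> m * conj_op n (padded n m) (T m) ?e s else 0)"
        unfolding e by simp
    qed
    also have "\<dots> = \<alpha> m * conj_op n (padded n m) (T m) ?e s"
      using m by (simp add: finite_stable_index)
    finally show ?thesis ..
  qed
  moreover have "conj_op n (padded n m) (T m) ?e \<noteq> (\<lambda>_. 0)"
    using m.conjugate_sum_nonzero padded[OF m] unfolding conj_op_def by simp
  ultimately show ?thesis by (auto simp: fun_eq_iff)
qed

text \<open>The coefficients of the central elements are class functions, and the class functions on \<open>S_n\<close> are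
spanned by the indicators of the cycle types, of which there are no more than shapes. A linearly
independent family with one member for each shape therefore spans them, and the indicator of the
identity is a class function.\<close>

lemma unit_decomposition_coeff:
  "\<exists>\<alpha>. \<forall>h. h permutes {1..n} \<longrightarrow>
     (\<Sum>l\<in>stable_index n. \<alpha> l * conj_coeff n (padded n l) (T l) h) = (if h = id then 1 else 0)"
proof -
  let ?P = "stable_index n"
  define ty where "ty h = (SOME l. l \<in> ?P \<and> has_cycle_type h (padded n l))" for h
  have ty: "ty h \<in> ?P \<and> has_cycle_type h (padded n (ty h))" if "h permutes {1..n}" for h
    unfolding ty_def by (rule someI_ex) (use cycle_type_stable[OF that] in auto)
  define K where "K l = (\<lambda>h. if h \<in> S \<and> ty h = l then 1 else (0::rat))" for l
  define Z where "Z l = (\<lambda>h. if h \<in> S then conj_coeff n (padded n l) (T l) h else 0)" for l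
  define \<delta> where "\<delta> = (\<lambda>h :: nat \<Rightarrow> nat. if h = id then 1 else (0::rat))"
  \<comment> \<open>A class function is the combination of the indicators with its values at chosen representatives.\<close>
  have spanned: "F \<in> fn.span (K ` ?P)"
    if out: "\<And>h. h \<notin> S \<Longrightarrow> F h = 0" and conj: "\<And>k h. k permutes {1..n} \<Longrightarrow> h permutes {1..n} \<Longrightarrow> F (k \<circ> h \<circ> inv' k) = F h" for F
  proof -
    define rep where "rep l = (SOME h. h \<in> S \<and> ty h = l)" for l
    have "F = (\<Sum>l\<in>?P. (\<lambda>h. F (rep l) * K l h))"
    proof
      fix h
      show "F h = (\<Sum>l\<in>?P. (\<lambda>h. F (rep l) * K l h)) h"
      proof (cases "h \<in> S")
        case True
        then have h: "h permutes {1..n}" by simp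
        have "rep (ty h) \<in> S \<and> ty (rep (ty h)) = ty h" unfolding rep_def by (rule someI[of _ h]) (use h in simp)
        then have r: "rep (ty h) permutes {1..n}" "ty (rep (ty h)) = ty h" by auto
        have s: "sum_list (padded n (ty h)) = n" using padded ty[OF h] by blast
        obtain g where g: "g permutes {1..n}" "rep (ty h) = g \<circ> h \<circ> inv' g"
          using cycle_type_conjugate[of h "padded n (ty h)" "rep (ty h)"] ty[OF h] ty[OF r(1)] r h s by metis
        have "F (rep (ty h)) = F h" unfolding g(2) by (rule conj[OF g(1) h])
        moreover have "(\<Sum>l\<in>?P. F (rep l) * K l h) = (\<Sum>l\<in>?P. if l = ty h then F (rep l) else 0)"
          by (rule sum.cong) (use True in \<open>auto simp: K_def\<close>)
        ultimately show ?thesis using ty[OF h] by (simp add: sum_fun_apply finite_stable_index)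
      qed (simp add: sum_fun_apply K_def out)
    qed
    also have "\<dots> \<in> fn.span (K ` ?P)"
      by (rule fn.span_sum, rule fn.span_scale, rule fn.span_base) simp
    finally show ?thesis .
  qed
  have Z_class: "Z l \<in> fn.span (K ` ?P)" if "l \<in> ?P" for l
  proof (rule spanned)
    fix k h assume "k permutes {1..n}" "h permutes {1..n}"
    then show "Z l (k \<circ> h \<circ> inv' k) = Z l h"
      using young_tableau.conj_coeff_class[OF young_tableau[OF that], of k h] padded[OF that]
      by (simp add: Z_def permutes_compose permutes_inv)
  qed (simp add: Z_def)
  have \<delta>_class: "\<delta> \<in> fn.span (K ` ?P)"
  proof (rule spanned)
    fix k h :: "nat \<Rightarrow> nat" assume k: "k permutes {1..n}"
    have "k \<circ> h \<circ> inv' k = id \<longleftrightarrow> h = id" using permutes_comp_inv[OF k] by (metis comp_id)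
    then show "\<delta> (k \<circ> h \<circ> inv' k) = \<delta> h" by (simp add: \<delta>_def)
  next
    fix h :: "nat \<Rightarrow> nat" assume "h \<notin> S"
    then show "\<delta> h = 0" by (auto simp: \<delta>_def permutes_id)
  qed
  have family: "\<alpha> m = 0" if "(\<Sum>l\<in>?P. (\<lambda>h. \<alpha> l * Z l h)) = 0" "m \<in> ?P" for \<alpha> m
  proof (rule central_independent[OF _ that(2)])
    fix h assume "h permutes {1..n}"
    then show "(\<Sum>l\<in>?P. \<alpha> l * conj_coeff n (padded n l) (T l) h) = 0"
      using fun_cong[OF that(1), of h] by (simp add: sum_fun_apply Z_def)
  qed
  have inj: "inj_on Z ?P"
  proof (rule inj_onI, rule ccontr)
    fix l m assume lm: "l \<in> ?P" "m \<in> ?P" "Z l = Z m" "l \<noteq> m"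
    define \<alpha> where "\<alpha> k = (if k = l then 1 else if k = m then -1 else (0::rat))" for k
    have "(\<Sum>k\<in>?P. (\<lambda>h. \<alpha> k * Z k h)) = 0"
    proof
      fix h
      have "(\<Sum>k\<in>?P. \<alpha> k * Z k h) = (\<Sum>k\<in>{l, m}. \<alpha> k * Z k h)"
        by (rule sum.mono_neutral_right) (use lm finite_stable_index in \<open>auto simp: \<alpha>_def\<close>)
      then show "(\<Sum>k\<in>?P. (\<lambda>h. \<alpha> k * Z k h)) h = 0 h" using lm by (simp add: sum_fun_apply \<alpha>_def)
    qed
    from family[OF this lm(1)] show False by (simp add: \<alpha>_def)
  qed
  have indep: "fn.independent (Z ` ?P)"
    unfolding fn.dependent_finite[OF finite_imageI[OF finite_stable_index]] sum.reindex[OF inj] o_def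
  proof (intro notI, elim exE conjE bexE)
    fix u v assume "v \<in> Z ` ?P" "u v \<noteq> 0" and sum: "(\<Sum>l\<in>?P. (\<lambda>h. u (Z l) * Z l h)) = 0"
    then obtain m where "m \<in> ?P" "u (Z m) \<noteq> 0" by blast
    then show False using family[OF sum] by blast
  qed
  have "\<delta> \<in> fn.span (Z ` ?P)"
  proof (rule ccontr)
    assume out: "\<delta> \<notin> fn.span (Z ` ?P)"
    then have "fn.independent (insert \<delta> (Z ` ?P))" using indep by (rule fn.independent_insertI)
    then have "card (insert \<delta> (Z ` ?P)) \<le> card (K ` ?P)"
      using fn.independent_span_bound[of "K ` ?P"] Z_class \<delta>_class finite_stable_index by blast
    also have "\<dots> \<le> card ?P" by (rule card_image_le[OF finite_stable_index])
    also have "card ?P = card (Z ` ?P)" by (rule card_image[OF inj, symmetric])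
    also have "\<dots> < card (insert \<delta> (Z ` ?P))"
      using out fn.span_base[of \<delta>] finite_stable_index by (subst card_insert_disjoint) auto
    finally show False by simp
  qed
  then obtain u where u: "\<delta> = (\<Sum>v\<in>Z ` ?P. (\<lambda>h. u v * v h))"
    unfolding fn.span_finite[OF finite_imageI[OF finite_stable_index]] by blast
  show ?thesis
  proof (intro exI[of _ "\<lambda>l. u (Z l)"] allI impI)
    fix h assume "h permutes {1..n}"
    then show "(\<Sum>l\<in>?P. u (Z l) * conj_coeff n (padded n l) (T l) h) = (if h = id then 1 else 0)"
      using fun_cong[OF u[unfolded sum.reindex[OF inj] o_def], of h]
      by (simp add: sum_fun_apply \<delta>_def) (simp add: Z_def)
  qed
qed

theorem unit_decomposition:
  "\<exists>\<alpha>. \<forall>f :: (nat \<Rightarrow> 'y) \<Rightarrow> rat. f = (\<lambda>s. \<Sum>l\<in>stable_index n. \<alpha> l * conj_op n (padded n l) (T l) f s)"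
proof -
  obtain \<alpha> where \<alpha>: "\<And>h. h permutes {1..n} \<Longrightarrow>
     (\<Sum>l\<in>stable_index n. \<alpha> l * conj_coeff n (padded n l) (T l) h) = (if h = id then 1 else 0)"
    using unit_decomposition_coeff by blast
  have "f s = (\<Sum>l\<in>stable_index n. \<alpha> l * conj_op n (padded n l) (T l) f s)" for f :: "(nat \<Rightarrow> 'y) \<Rightarrow> rat" and s
  proof -
    have "(\<Sum>l\<in>stable_index n. \<alpha> l * conj_op n (padded n l) (T l) f s) =
      (\<Sum>l\<in>stable_index n. \<alpha> l * (\<Sum>h\<in>S. conj_coeff n (padded n l) (T l) h * f (s \<circ> h)))"
    proof (rule sum.cong[OF refl])
      fix l assume l: "l \<in> stable_index n"
      show "\<alpha> l * conj_op n (padded n l) (T l) f s = \<alpha> l * (\<Sum>h\<in>S. conj_coeff n (padded n l) (T l) h * f (s \<circ> h))"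
        using young_tableau.conj_op_coeff[OF young_tableau[OF l], of f s] padded[OF l] by simp
    qed
    also have "\<dots> = (\<Sum>h\<in>S. (\<Sum>l\<in>stable_index n. \<alpha> l * conj_coeff n (padded n l) (T l) h) * f (s \<circ> h))"
      unfolding sum_distrib_right sum_distrib_left by (subst sum.swap) (simp add: mult.assoc)
    also have "\<dots> = (\<Sum>h\<in>S. if h = id then f (s \<circ> h) else 0)"
      by (rule sum.cong) (use \<alpha> in auto)
    also have "\<dots> = f s" by (simp add: finite_permutations permutes_id)
    finally show ?thesis ..
  qed
  then show ?thesis by blast
qed

end

section \<open>Homomorphisms out of Specht modules\<close>

text \<open>The homomorphism from functions on tabloids that sends the tabloid \<open>g t\<close> to \<open>g a w\<close>, where \<open>a\<close> is the row
symmetrizer of \<open>t\<close>. Summing over all \<open>g\<close> instead of tabloids avoids a choice of representatives and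
produces the symmetrizer.\<close>

definition specht_hom ::
  "nat list \<Rightarrow> (nat \<times> nat \<Rightarrow> nat) \<Rightarrow> ((nat \<Rightarrow> 'y) \<Rightarrow> rat) \<Rightarrow> ((nat \<Rightarrow> nat) \<Rightarrow> rat) \<Rightarrow> (nat \<Rightarrow> 'y) \<Rightarrow> rat" where
  "specht_hom l t w f =
     (\<lambda>s. \<Sum>g | g permutes {1..sum_list l}. f (tabloid l t \<circ> inv' g) * w (s \<circ> g))"

context young_tableau
begin

lemma specht_hom_add: "specht_hom l t w (\<lambda>u. f u + h u) = (\<lambda>s. specht_hom l t w f s + specht_hom l t w h s)"
  by (simp add: specht_hom_def algebra_simps sum.distrib)

lemma specht_hom_scale: "specht_hom l t w (\<lambda>u. q * f u) = (\<lambda>s. q * specht_hom l t w f s)"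
  by (simp add: specht_hom_def sum_distrib_left mult.assoc)

lemma specht_hom_sum: "specht_hom l t w (\<lambda>u. \<Sum>i\<in>A. q i * F i u) = (\<lambda>s. \<Sum>i\<in>A. q i * specht_hom l t w (F i) s)"
  unfolding specht_hom_def sum_distrib_right sum_distrib_left
  by (subst sum.swap) (simp add: mult.assoc)

lemma specht_hom_translate:
  assumes h: "h permutes {1..n}"
  shows "translate h (specht_hom l t w f) = specht_hom l t w (translate h f)"
proof
  fix s
  have "specht_hom l t w (translate h f) s = (\<Sum>g | g permutes {1..n}. f (row_of \<circ> inv' g \<circ> h) * w (s \<circ> g))"
    by (simp add: specht_hom_def translate_def)
  also have "\<dots> = (\<Sum>g | g permutes {1..n}. f (row_of \<circ> inv' (h \<circ> g) \<circ> h) * w (s \<circ> (h \<circ> g)))"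
    by (rule perm_group_sum_left[OF perm_group_permutations, symmetric]) (use h in simp)
  also have "\<dots> = translate h (specht_hom l t w f) s"
    unfolding specht_hom_def translate_def
  proof (rule sum.cong[OF refl])
    fix g assume "g \<in> {g. g permutes {1..n}}"
    then have "inv' (h \<circ> g) = inv' g \<circ> inv' h" using h by (simp add: o_inv_distrib permutes_bij)
    then have "row_of \<circ> inv' (h \<circ> g) \<circ> h = row_of \<circ> inv' g" by (simp add: comp_assoc permutes_comp_inv[OF h])
    then show "f (row_of \<circ> inv' (h \<circ> g) \<circ> h) * w (s \<circ> (h \<circ> g)) = f (row_of \<circ> inv' g) * w (s \<circ> h \<circ> g)"
      by (simp add: comp_assoc)
  qed
  finally show "translate h (specht_hom l t w f) s = specht_hom l t w (translate h f) s" ..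
qed

text \<open>The term \<open>p\<close> of the polytabloid collects the permutations \<open>g\<close> in the coset \<open>p R\<close>.\<close>

lemma specht_hom_polytabloid: "specht_hom l t w (polytabloid l t) = young_op l t w"
proof
  fix s
  let ?S = "{g. g permutes {1..n}}"
  have fin: "finite ?S" by (simp add: finite_permutations)
  have "specht_hom l t w (polytabloid l t) s =
    (\<Sum>p\<in>C. \<Sum>g\<in>?S. of_int (sign p) * (if row_of \<circ> inv' g \<circ> p = row_of then w (s \<circ> g) else 0))"
    unfolding specht_hom_def polytabloid_antisymmetrize antisymmetrize_def sum_distrib_right
    by (subst sum.swap) (intro sum.cong, auto)
  also have "\<dots> = (\<Sum>p\<in>C. of_int (sign p) * symmetrize R w (s \<circ> p))"
  proof (rule sum.cong[OF refl])
    fix p assume "p \<in> C"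
    then have p: "p permutes {1..n}" using perm_groupD(1)[OF group_C] by blast
    have "(\<Sum>g\<in>?S. if row_of \<circ> inv' g \<circ> p = row_of then w (s \<circ> g) else 0) =
      (\<Sum>g\<in>?S. if row_of \<circ> inv' (p \<circ> g) \<circ> p = row_of then w (s \<circ> (p \<circ> g)) else 0)"
      by (rule perm_group_sum_left[OF perm_group_permutations, symmetric]) (use p in simp)
    also have "\<dots> = (\<Sum>g\<in>?S. if g \<in> R then w (s \<circ> p \<circ> g) else 0)"
    proof (rule sum.cong[OF refl])
      fix g assume "g \<in> ?S"
      then have g: "g permutes {1..n}" by simp
      then have "inv' (p \<circ> g) = inv' g \<circ> inv' p" using p by (simp add: o_inv_distrib permutes_bij)
      then have "row_of \<circ> inv' (p \<circ> g) \<circ> p = row_of \<circ> inv' g" by (simp add: comp_assoc permutes_comp_inv[OF p])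
      moreover have "row_of \<circ> inv' g = row_of \<longleftrightarrow> row_of \<circ> g = row_of"
        using permutes_comp_inv(3,4)[OF g] by metis
      ultimately show "(if row_of \<circ> inv' (p \<circ> g) \<circ> p = row_of then w (s \<circ> (p \<circ> g)) else 0) =
        (if g \<in> R then w (s \<circ> p \<circ> g) else 0)"
        using g by (simp add: row_stabilizer_def comp_assoc)
    qed
    also have "\<dots> = symmetrize R w (s \<circ> p)"
      unfolding symmetrize_def
      by (rule sum.mono_neutral_cong_right[OF fin]) (auto simp: row_stabilizer_def)
    finally show "(\<Sum>g\<in>?S. of_int (sign p) * (if row_of \<circ> inv' g \<circ> p = row_of then w (s \<circ> g) else 0)) =
       of_int (sign p) * symmetrize R w (s \<circ> p)"
      unfolding sum_distrib_left[symmetric] by simp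
  qed
  also have "\<dots> = young_op l t w s" by (simp add: young_op_def antisymmetrize_def)
  finally show "specht_hom l t w (polytabloid l t) s = young_op l t w s" .
qed

end

lemma young_op_expand:
  "young_op l t f = (\<lambda>s. \<Sum>(p, r)\<in>column_stabilizer l t \<times> row_stabilizer l t. of_int (sign p) * translate (p \<circ> r) f s)"
  by (simp add: young_op_def antisymmetrize_def symmetrize_def translate_def sum_distrib_left
      sum.cartesian_product[symmetric] comp_assoc)

lemma young_op_add: "young_op l t (\<lambda>u. f u + h u) = (\<lambda>s. young_op l t f s + young_op l t h s)"
  by (simp add: young_op_def antisymmetrize_def symmetrize_def sum.distrib algebra_simps)

lemma young_op_scale: "young_op l t (\<lambda>u. q * f u) = (\<lambda>s. q * young_op l t f s)"
  by (simp add: young_op_def antisymmetrize_def symmetrize_def sum_distrib_left mult.left_commute)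

lemma young_op_sum: "young_op l t (\<lambda>u. \<Sum>i\<in>A. F i u) = (\<lambda>s. \<Sum>i\<in>A. young_op l t (F i) s)"
proof (induction A rule: infinite_finite_induct)
  case (insert x A)
  then show ?case by (simp add: young_op_add)
qed (simp_all add: young_op_def antisymmetrize_def symmetrize_def)

lemma young_op_zero: "young_op l t (\<lambda>_. 0) = (\<lambda>_. 0)"
  by (simp add: young_op_def antisymmetrize_def symmetrize_def)

section \<open>Specht modules as spans\<close>

lemma carrier_specht: "carrier (specht_module l) = fn.span (polytabloid l ` tableaux l)"
proof (intro equalityI subsetI)
  fix x assume "x \<in> carrier (specht_module l)"
  then obtain F c where F: "finite F" "F \<subseteq> tableaux l" "x = (\<lambda>s. \<Sum>t\<in>F. c t * polytabloid l t s)"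
    by (auto simp: specht_module_def)
  then have "x = (\<Sum>t\<in>F. (\<lambda>s. c t * polytabloid l t s))" by (simp add: fun_eq_iff sum_fun_apply)
  also have "\<dots> \<in> fn.span (polytabloid l ` tableaux l)"
    by (rule fn.span_sum, rule fn.span_scale, rule fn.span_base) (use F in auto)
  finally show "x \<in> fn.span (polytabloid l ` tableaux l)" .
next
  fix x assume "x \<in> fn.span (polytabloid l ` tableaux l)"
  then obtain A r where A: "finite A" "A \<subseteq> polytabloid l ` tableaux l" "x = (\<Sum>a\<in>A. (\<lambda>s. r a * a s))"
    unfolding fn.span_explicit by blast
  then obtain F where F: "F \<subseteq> tableaux l" "inj_on (polytabloid l) F" "A = polytabloid l ` F"
    by (auto simp: subset_image_inj)
  have "x = (\<lambda>s. \<Sum>t\<in>F. r (polytabloid l t) * polytabloid l t s)"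
    unfolding A(3) F(3) sum.reindex[OF F(2)] by (simp add: fun_eq_iff sum_fun_apply)
  moreover have "finite F" using A(1) F by (simp add: finite_image_iff)
  ultimately show "x \<in> carrier (specht_module l)" using F(1)
    unfolding specht_module_def by (auto intro!: exI[of _ F] exI[of _ "\<lambda>t. r (polytabloid l t)"])
qed

lemma specht_ops:
  "zero (specht_module l) = (\<lambda>_. 0)" "add (specht_module l) = (\<lambda>x y s. x s + y s)"
  "smult (specht_module l) = (\<lambda>q x s. q * x s)" "act (specht_module l) = translate"
  by (simp_all add: specht_module_def translate_def fun_eq_iff)

lemma specht_induct [consumes 1, case_names zero add scale polytabloid]:
  assumes x: "x \<in> carrier (specht_module l)"
    and "P (\<lambda>_. 0)" "\<And>x y. P x \<Longrightarrow> P y \<Longrightarrow> P (\<lambda>s. x s + y s)" "\<And>q x. P x \<Longrightarrow> P (\<lambda>s. q * x s)"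
    and "\<And>t. t \<in> tableaux l \<Longrightarrow> P (polytabloid l t)"
  shows "P x"
proof -
  have "fn.subspace (Collect P)"
    using assms(2-4) by (auto simp: fn.subspace_def zero_fun_def plus_fun_def)
  then have "fn.span (polytabloid l ` tableaux l) \<subseteq> Collect P"
    by (rule fn.span_minimal[rotated]) (use assms(5) in auto)
  then show ?thesis using x by (auto simp: carrier_specht)
qed

lemma specht_closed:
  "(\<lambda>_. 0) \<in> carrier (specht_module l)"
  "x \<in> carrier (specht_module l) \<Longrightarrow> y \<in> carrier (specht_module l) \<Longrightarrow> (\<lambda>s. x s + y s) \<in> carrier (specht_module l)"
  "x \<in> carrier (specht_module l) \<Longrightarrow> (\<lambda>s. q * x s) \<in> carrier (specht_module l)"
  "t \<in> tableaux l \<Longrightarrow> polytabloid l t \<in> carrier (specht_module l)"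
  unfolding carrier_specht
  using fn.span_zero fn.span_add fn.span_scale fn.span_base[of _ "polytabloid l ` tableaux l"]
  by (auto simp: zero_fun_def plus_fun_def)

lemma specht_translate:
  assumes x: "x \<in> carrier (specht_module l)" and g: "g permutes {1..sum_list l}"
  shows "translate g x \<in> carrier (specht_module l)"
  using x
proof (induction rule: specht_induct)
  case (polytabloid t)
  interpret young_tableau l t by standard (rule polytabloid)
  have "g \<circ> t \<in> tableaux l" using translate_tableau[OF g] by (simp add: young_tableau_def)
  then show ?case using polytabloid_translate[OF g] specht_closed(4) by metis
qed (use specht_closed in \<open>auto simp: translate_def\<close>)

lemma specht_support:
  assumes "x \<in> carrier (specht_module l)" shows "x u \<noteq> 0 \<Longrightarrow> u \<in> tabloids l"
proof -
  have "x u \<noteq> 0 \<longrightarrow> u \<in> tabloids l" using assms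
  proof (induction rule: specht_induct)
    case (polytabloid t)
    interpret young_tableau l t by standard (rule polytabloid)
    show ?case using polytabloid_support by blast
  qed auto
  then show "x u \<noteq> 0 \<Longrightarrow> u \<in> tabloids l" by blast
qed

section \<open>Bases of spaces of functions\<close>

definition basis_family :: "('a \<Rightarrow> rat) set \<Rightarrow> (nat \<Rightarrow> 'a \<Rightarrow> rat) \<Rightarrow> bool" where
  "basis_family W u \<longleftrightarrow> (\<forall>j<fn.dim W. u j \<in> W) \<and>
     (\<forall>x\<in>W. \<exists>a. x = (\<lambda>s. \<Sum>j<fn.dim W. a j * u j s)) \<and>
     (\<forall>a. (\<lambda>s. \<Sum>j<fn.dim W. a j * u j s) = (\<lambda>_. 0) \<longrightarrow> (\<forall>j<fn.dim W. a j = 0))"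

lemma basis_familyD:
  assumes "basis_family W u"
  shows "j < fn.dim W \<Longrightarrow> u j \<in> W"
    "x \<in> W \<Longrightarrow> \<exists>a. x = (\<lambda>s. \<Sum>j<fn.dim W. a j * u j s)"
    "(\<lambda>s. \<Sum>j<fn.dim W. a j * u j s) = (\<lambda>_. 0) \<Longrightarrow> j < fn.dim W \<Longrightarrow> a j = 0"
  using assms by (simp_all add: basis_family_def)

lemma basis_family_exists:
  fixes W :: "('a \<Rightarrow> rat) set"
  assumes W: "W \<subseteq> fn.span F" "finite F"
  shows "\<exists>u. basis_family W u"
proof -
  obtain B where B: "B \<subseteq> W" "fn.independent B" "W \<subseteq> fn.span B" "card B = fn.dim W"
    using fn.basis_exists[of W] by metis
  have fin: "finite B" using fn.independent_span_bound[OF W(2) B(2)] B(1) W(1) by blast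
  obtain u where u: "bij_betw u {..<fn.dim W} B"
    using ex_bij_betw_nat_finite[OF fin] unfolding B(4) by (auto simp: atLeast0LessThan)
  have reidx: "(\<Sum>v\<in>B. (\<lambda>s. q v * v s)) = (\<lambda>s. \<Sum>j<fn.dim W. q (u j) * u j s)" for q
    unfolding sum.reindex_bij_betw[OF u, symmetric] by (simp add: fun_eq_iff sum_fun_apply)
  show ?thesis unfolding basis_family_def
  proof (intro exI[of _ u] conjI allI ballI impI)
    show "u j \<in> W" if "j < fn.dim W" for j using u B(1) that by (auto simp: bij_betw_def)
    show "\<exists>a. x = (\<lambda>s. \<Sum>j<fn.dim W. a j * u j s)" if x: "x \<in> W" for x
    proof -
      have "x \<in> range (\<lambda>q. \<Sum>v\<in>B. (\<lambda>s. q v * v s))"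
        using subsetD[OF B(3) x] unfolding fn.span_finite[OF fin] .
      then obtain q where "x = (\<Sum>v\<in>B. (\<lambda>s. q v * v s))" by (rule rangeE)
      then have "x = (\<lambda>s. \<Sum>j<fn.dim W. q (u j) * u j s)" unfolding reidx .
      then show ?thesis by (rule exI[of _ "\<lambda>j. q (u j)"])
    qed
    show "a j = 0" if z: "(\<lambda>s. \<Sum>j<fn.dim W. a j * u j s) = (\<lambda>_. 0)" and j: "j < fn.dim W" for a j
    proof -
      define q where "q v = a (inv_into {..<fn.dim W} u v)" for v
      have q: "q (u i) = a i" if "i < fn.dim W" for i
        using u that by (simp add: q_def bij_betw_inv_into_left)
      have "(\<Sum>v\<in>B. (\<lambda>s. q v * v s)) = 0" unfolding reidx using z q by (auto simp: fun_eq_iff)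
      moreover have "u j \<in> B" using u j by (auto simp: bij_betw_def)
      ultimately have "q (u j) = 0" using B(2) unfolding fn.dependent_finite[OF fin] by blast
      then show ?thesis using q[OF j] by simp
    qed
  qed
qed

section \<open>Isomorphisms of representations\<close>

lemma rat_rep_isoI_inverse:
  assumes bij: "bij_betw f (carrier V) (carrier W)"
    and add: "\<And>x y. x \<in> carrier V \<Longrightarrow> y \<in> carrier V \<Longrightarrow> x \<oplus>\<^bsub>V\<^esub> y \<in> carrier V \<and> f (x \<oplus>\<^bsub>V\<^esub> y) = f x \<oplus>\<^bsub>W\<^esub> f y"
    and smult: "\<And>q x. x \<in> carrier V \<Longrightarrow> q \<odot>\<^bsub>V\<^esub> x \<in> carrier V \<and> f (q \<odot>\<^bsub>V\<^esub> x) = q \<odot>\<^bsub>W\<^esub> f x"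
    and act: "\<And>g x. g \<in> carrier G \<Longrightarrow> x \<in> carrier V \<Longrightarrow> act V g x \<in> carrier V \<and> f (act V g x) = act W g (f x)"
  shows "rat_rep_iso G W V"
proof -
  let ?h = "inv_into (carrier V) f"
  have h: "?h y \<in> carrier V" "f (?h y) = y" if "y \<in> carrier W" for y
    using that bij by (auto simp: bij_betw_def inv_into_into f_inv_into_f)
  have hf: "?h (f x) = x" if "x \<in> carrier V" for x using that bij by (simp add: bij_betw_def)
  show ?thesis unfolding rat_rep_iso_def
  proof (intro exI[of _ ?h] conjI ballI allI)
    show "bij_betw ?h (carrier W) (carrier V)" using bij by (rule bij_betw_inv_into)
    show "?h (x \<oplus>\<^bsub>W\<^esub> y) = ?h x \<oplus>\<^bsub>V\<^esub> ?h y" if "x \<in> carrier W" "y \<in> carrier W" for x y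
      using add[of "?h x" "?h y"] h[OF that(1)] h[OF that(2)] hf[of "?h x \<oplus>\<^bsub>V\<^esub> ?h y"] by simp
    show "?h (q \<odot>\<^bsub>W\<^esub> x) = q \<odot>\<^bsub>V\<^esub> ?h x" if "x \<in> carrier W" for x q
      using smult[of "?h x" q] h[OF that] hf[of "q \<odot>\<^bsub>V\<^esub> ?h x"] by simp
    show "?h (act W g x) = act V g (?h x)" if "g \<in> carrier G" "x \<in> carrier W" for g x
      using act[of g "?h x"] h[OF that(2)] hf[of "act V g (?h x)"] that(1) by simp
  qed
qed

lemma rat_rep_iso_trans:
  assumes "rat_rep_iso G U V" "rat_rep_iso G V W"
  shows "rat_rep_iso G U W"
proof -
  obtain f where f: "bij_betw f (carrier U) (carrier V)"
     "\<And>x y. x \<in> carrier U \<Longrightarrow> y \<in> carrier U \<Longrightarrow> f (x \<oplus>\<^bsub>U\<^esub> y) = f x \<oplus>\<^bsub>V\<^esub> f y"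
     "\<And>q x. x \<in> carrier U \<Longrightarrow> f (q \<odot>\<^bsub>U\<^esub> x) = q \<odot>\<^bsub>V\<^esub> f x"
     "\<And>g x. g \<in> carrier G \<Longrightarrow> x \<in> carrier U \<Longrightarrow> f (act U g x) = act V g (f x)"
    using assms(1) unfolding rat_rep_iso_def by auto
  obtain h where h: "bij_betw h (carrier V) (carrier W)"
     "\<And>x y. x \<in> carrier V \<Longrightarrow> y \<in> carrier V \<Longrightarrow> h (x \<oplus>\<^bsub>V\<^esub> y) = h x \<oplus>\<^bsub>W\<^esub> h y"
     "\<And>q x. x \<in> carrier V \<Longrightarrow> h (q \<odot>\<^bsub>V\<^esub> x) = q \<odot>\<^bsub>W\<^esub> h x"
     "\<And>g x. g \<in> carrier G \<Longrightarrow> x \<in> carrier V \<Longrightarrow> h (act V g x) = act W g (h x)"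
    using assms(2) unfolding rat_rep_iso_def by auto
  have in_V: "f x \<in> carrier V" if "x \<in> carrier U" for x using bij_betwE[OF f(1)] that by blast
  show ?thesis unfolding rat_rep_iso_def
    by (rule exI[of _ "h \<circ> f"]) (simp add: bij_betw_trans[OF f(1) h(1)] f(2-4) h(2-4) in_V)
qed

section \<open>Decomposition into Specht modules\<close>

definition function_rep :: "((nat \<Rightarrow> 'y) \<Rightarrow> rat) set \<Rightarrow> (nat \<Rightarrow> nat, (nat \<Rightarrow> 'y) \<Rightarrow> rat) rat_rep" where
  "function_rep V = \<lparr>carrier = V, monoid.mult = undefined, one = undefined, zero = (\<lambda>_. 0),
     add = (\<lambda>x y s. x s + y s), smult = (\<lambda>q x s. q * x s), act = translate\<rparr>"

text \<open>A representation of \<open>S_n\<close> of finite dimension by functions, where \<open>F\<close> is a finite set whose span contains it.\<close>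

locale function_representation = tableau_choice n T for n T +
  fixes V :: "((nat \<Rightarrow> 'y) \<Rightarrow> rat) set" and F
  assumes subspace: "fn.subspace V"
    and invariant: "\<And>g f. g permutes {1..n} \<Longrightarrow> f \<in> V \<Longrightarrow> translate g f \<in> V"
    and fin_dim: "V \<subseteq> fn.span F" "finite F"
begin

definition "specht_mult l = fn.dim (Y l ` V)"

lemma subspace_ops:
  assumes "fn.subspace U"
  shows "(\<lambda>_. 0) \<in> U" "x \<in> U \<Longrightarrow> y \<in> U \<Longrightarrow> (\<lambda>s. x s + y s) \<in> U" "x \<in> U \<Longrightarrow> (\<lambda>s. q * x s) \<in> U"
    "(\<And>i. i \<in> A \<Longrightarrow> G i \<in> U) \<Longrightarrow> (\<lambda>s. \<Sum>i\<in>A. G i s) \<in> U"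
proof -
  show "(\<lambda>_. 0) \<in> U" "x \<in> U \<Longrightarrow> y \<in> U \<Longrightarrow> (\<lambda>s. x s + y s) \<in> U" "x \<in> U \<Longrightarrow> (\<lambda>s. q * x s) \<in> U"
    using assms by (auto simp: fn.subspace_def zero_fun_def plus_fun_def)
  show "(\<lambda>s. \<Sum>i\<in>A. G i s) \<in> U" if "\<And>i. i \<in> A \<Longrightarrow> G i \<in> U"
  proof -
    have "(\<lambda>s. \<Sum>i\<in>A. G i s) = sum G A" by (simp add: fun_eq_iff sum_fun_apply)
    then show ?thesis using fn.subspace_sum[OF assms, of A G] that by simp
  qed
qed

lemma group_perm:
  assumes "l \<in> stable_index n"
  shows "p \<in> column_stabilizer (padded n l) (T l) \<Longrightarrow> p permutes {1..n}"
    "p \<in> row_stabilizer (padded n l) (T l) \<Longrightarrow> p permutes {1..n}"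
  using perm_groupD(1)[OF young_tableau.group_C[OF young_tableau[OF assms]]]
    perm_groupD(1)[OF young_tableau.group_R[OF young_tableau[OF assms]]] padded(1)[OF assms] by auto

lemma young_op_in:
  assumes l: "l \<in> stable_index n" and U: "fn.subspace U" "\<And>g f. g permutes {1..n} \<Longrightarrow> f \<in> U \<Longrightarrow> translate g f \<in> U"
    and f: "f \<in> U"
  shows "Y l f \<in> U"
  unfolding young_op_expand
proof (rule subspace_ops(4)[OF U(1)], clarify)
  fix p r assume "p \<in> column_stabilizer (padded n l) (T l)" "r \<in> row_stabilizer (padded n l) (T l)"
  then show "(\<lambda>s. of_int (sign p) * translate (p \<circ> r) f s) \<in> U"
    by (intro subspace_ops(3)[OF U(1)] U(2) f permutes_compose) (auto dest: group_perm[OF l])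
qed

lemma young_op_span:
  assumes l: "l \<in> stable_index n"
  shows "Y l ` V \<subseteq> fn.span F"
  using young_op_in[OF l subspace invariant] fin_dim(1) by auto

lemma symmetrize_in:
  assumes l: "l \<in> stable_index n" and U: "fn.subspace U" "\<And>g f. g permutes {1..n} \<Longrightarrow> f \<in> U \<Longrightarrow> translate g f \<in> U"
    and f: "f \<in> U"
  shows "symmetrize (row_stabilizer (padded n l) (T l)) f \<in> U"
  unfolding symmetrize_def
  by (rule subspace_ops(4)[OF U(1)]) (use U(2) f group_perm[OF l] in \<open>auto simp: translate_def\<close>)

lemma specht_hom_in:
  assumes l: "l \<in> stable_index n" and w: "w \<in> V"
  shows "specht_hom (padded n l) (T l) w f \<in> V"
  unfolding specht_hom_def padded(1)[OF l]
proof (rule subspace_ops(4)[OF subspace])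
  fix g assume "g \<in> {g. g permutes {1..n}}"
  then have "translate g w \<in> V" using invariant w by blast
  from subspace_ops(3)[OF subspace this]
  show "(\<lambda>s. f (tabloid (padded n l) (T l) \<circ> inv' g) * w (s \<circ> g)) \<in> V"
    by (simp add: translate_def)
qed

lemma specht_hom_young_op:
  assumes l: "l \<in> stable_index n" and m: "m \<in> stable_index n" and g: "g permutes {1..n}"
  shows "Y l (translate g (specht_hom (padded n m) (T m) w f)) = specht_hom (padded n m) (T m) w (Y l (translate g f))"
proof -
  interpret m: young_tableau "padded n m" "T m" by (rule young_tableau[OF m])
  have tr: "translate h (specht_hom (padded n m) (T m) w f) = specht_hom (padded n m) (T m) w (translate h f)"
    if "h permutes {1..n}" for h f
    using m.specht_hom_translate[of h w f] that padded(1)[OF m] by simp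
  have "specht_hom (padded n m) (T m) w (Y l (translate g f)) =
    (\<lambda>s. \<Sum>d\<in>column_stabilizer (padded n l) (T l) \<times> row_stabilizer (padded n l) (T l).
       of_int (sign (fst d)) * specht_hom (padded n m) (T m) w (translate (fst d \<circ> snd d) (translate g f)) s)"
    unfolding young_op_expand case_prod_beta by (rule m.specht_hom_sum)
  also have "\<dots> = Y l (translate g (specht_hom (padded n m) (T m) w f))"
    unfolding young_op_expand case_prod_beta
  proof (intro ext sum.cong[OF refl] arg_cong2[where f = "(*)"] refl)
    fix s d assume d: "d \<in> column_stabilizer (padded n l) (T l) \<times> row_stabilizer (padded n l) (T l)"
    then have "fst d \<circ> snd d permutes {1..n}"
      by (intro permutes_compose) (auto dest: group_perm[OF l])
    then show "specht_hom (padded n m) (T m) w (translate (fst d \<circ> snd d) (translate g f)) s =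
        translate (fst d \<circ> snd d) (translate g (specht_hom (padded n m) (T m) w f)) s"
      using tr g by metis
  qed
  finally show ?thesis ..
qed

lemma specht_young_op_other:
  assumes l: "l \<in> stable_index n" and m: "m \<in> stable_index n" and ne: "l \<noteq> m"
    and x: "x \<in> carrier (specht_module (padded n m))"
  shows "Y l x = (\<lambda>_. 0)"
  using x by (induction rule: specht_induct)
    (simp_all add: young_op_zero young_op_add young_op_scale young_op_vanish[OF l m ne])

text \<open>The row symmetrizer keeps elements of the Specht module among the functions on tabloids of the same
shape, which the column antisymmetrizer maps to a line by \<open>antisymmetrize_same_shape\<close>.\<close>

lemma specht_young_op_same:
  assumes l: "l \<in> stable_index n" and x: "x \<in> carrier (specht_module (padded n l))"
  shows "\<exists>q. Y l x = (\<lambda>s. q * polytabloid (padded n l) (T l) s)"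
proof -
  interpret young_tableau "padded n l" "T l" by (rule young_tableau[OF l])
  have "u \<in> tabloids (padded n l)" if "symmetrize R x u \<noteq> 0" for u
    by (rule symmetrize_support[OF _ refl that]) (rule specht_support[OF x])
  from antisymmetrize_same_shape[OF this padded(2)[OF l]]
  show ?thesis unfolding young_op_def by blast
qed

text \<open>The identity lies in the two-sided ideal generated by the operators \<open>b a\<close>, so together with the
translations they detect every vector.\<close>

lemma zero_if_young_ops_vanish:
  fixes f :: "(nat \<Rightarrow> 'z) \<Rightarrow> rat"
  assumes "\<And>l g. l \<in> stable_index n \<Longrightarrow> g permutes {1..n} \<Longrightarrow> Y l (translate g f) = (\<lambda>_. 0)"
  shows "f = (\<lambda>_. 0)"
proof -
  obtain \<alpha> where "\<And>f :: (nat \<Rightarrow> 'z) \<Rightarrow> rat. f = (\<lambda>s. \<Sum>l\<in>stable_index n. \<alpha> l * conj_op n (padded n l) (T l) f s)"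
    using unit_decomposition by blast
  moreover have "conj_op n (padded n l) (T l) f s = 0" if "l \<in> stable_index n" for l s
    unfolding conj_op_def
  proof (rule sum.neutral, rule ballI)
    fix g assume "g \<in> S"
    then have "Y l (translate (inv' g) f) = (\<lambda>_. 0)" using assms[OF that] permutes_inv by blast
    then show "translate g (symmetrize (row_stabilizer (padded n l) (T l)) (Y l (translate (inv' g) f))) s = 0"
      by (simp add: translate_def symmetrize_def)
  qed
  ultimately show ?thesis by (metis (no_types, lifting) mult_zero_right sum.neutral)
qed

text \<open>The map \<open>\<Theta>\<close> adds up the homomorphisms given by bases \<open>u l j = b a (w l j)\<close> of the spaces \<open>b a V\<close>. A vector
in its kernel stays in the kernel under \<open>b a\<close>, where its components have become multiples of
polytabloids, which are mapped to linearly independent vectors; so all operators \<open>b a\<close> kill it. The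
image contains every \<open>b a v\<close> and is invariant, so \<open>unit_decomposition\<close> puts all of \<open>V\<close> into it.\<close>

theorem decomposition:
  "rat_rep_iso (sym_group n) (function_rep V)
     (direct_sum (SIGMA l : {l. is_partition l \<and> n \<in> admissible l}. {..<specht_mult l}) (\<lambda>(l, _). V_irr l n))"
proof -
  let ?P = "stable_index n"
  define I where "I = (SIGMA l:?P. {..<specht_mult l})"
  have finI: "finite I" by (simp add: I_def finite_stable_index)
  have "\<exists>u. basis_family (Y l ` V) u" if "l \<in> ?P" for l
    using basis_family_exists[OF young_op_span[OF that] fin_dim(2)] .
  then obtain u where "\<And>l. l \<in> ?P \<Longrightarrow> basis_family (Y l ` V) (u l)"
    by (metis bchoice)
  note u = basis_familyD[OF this, folded specht_mult_def]
  define w where "w l j = (SOME v. v \<in> V \<and> u l j = Y l v)" for l j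
  have w: "w l j \<in> V \<and> u l j = Y l (w l j)" if "l \<in> ?P" "j < specht_mult l" for l j
  proof -
    have "\<exists>v. v \<in> V \<and> u l j = Y l v" using u(1)[OF that] by blast
    then show ?thesis unfolding w_def by (rule someI_ex)
  qed
  define \<theta> where "\<theta> i = specht_hom (padded n (fst i)) (T (fst i)) (w (fst i) (snd i))" for i
  define \<Theta> where "\<Theta> x = (\<lambda>s. \<Sum>i\<in>I. \<theta> i (x i) s)" for x
  define Sp where "Sp i = carrier (specht_module (padded n (fst i)))" for i :: "nat list \<times> nat"
  \<comment> \<open>The generator of each Specht module that the operator of its own shape singles out.\<close>
  define e where "e l = polytabloid (padded n l) (T l)" for l
  have iP: "fst i \<in> ?P" "snd i < specht_mult (fst i)" if "i \<in> I" for i using that by (auto simp: I_def)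
  have yt: "young_tableau (padded n (fst i)) (T (fst i))" if "i \<in> I" for i using young_tableau iP[OF that] by blast
  have \<theta>_add: "\<theta> i (\<lambda>s. x s + y s) = (\<lambda>s. \<theta> i x s + \<theta> i y s)" if "i \<in> I" for i x y
    unfolding \<theta>_def by (rule young_tableau.specht_hom_add[OF yt[OF that]])
  have \<theta>_scale: "\<theta> i (\<lambda>s. q * x s) = (\<lambda>s. q * \<theta> i x s)" if "i \<in> I" for i x q
    unfolding \<theta>_def by (rule young_tableau.specht_hom_scale[OF yt[OF that]])
  have \<theta>_zero: "\<theta> i (\<lambda>s. 0) = (\<lambda>s. 0)" if "i \<in> I" for i
    using \<theta>_scale[OF that, of 0] by simp
  have \<theta>_tr: "\<theta> i (translate g x) = translate g (\<theta> i x)" if "i \<in> I" "g permutes {1..n}" for i g x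
    unfolding \<theta>_def
    by (rule young_tableau.specht_hom_translate[OF yt[OF that(1)], symmetric]) (simp only: padded(1)[OF iP(1)[OF that(1)]] that(2))
  have \<theta>_e: "\<theta> (l, j) (e l) = u l j" if "(l, j) \<in> I" for l j
    unfolding \<theta>_def e_def using young_tableau.specht_hom_polytabloid[OF yt[OF that]] w[of l j] that by (simp add: I_def)
  have \<theta>_in: "\<theta> i x \<in> V" if "i \<in> I" for i x
    unfolding \<theta>_def using iP[OF that] w by (intro specht_hom_in) auto
  have e_Sp: "e l \<in> Sp (l, j)" if "l \<in> ?P" for l j
    unfolding Sp_def e_def using specht_closed(4) T[OF that] by simp
  have sum_I: "(\<Sum>i\<in>I. if fst i = l then h (snd i) else 0) = (\<Sum>j<specht_mult l. h j)" if l: "l \<in> ?P" for l and h :: "nat \<Rightarrow> rat"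
  proof -
    have "(\<Sum>i\<in>I. if fst i = l then h (snd i) else 0) = (\<Sum>m\<in>?P. \<Sum>j<specht_mult m. if m = l then h j else 0)"
      unfolding I_def by (subst sum.Sigma) (auto simp: finite_stable_index case_prod_beta intro!: sum.cong)
    also have "\<dots> = (\<Sum>m\<in>?P. if m = l then (\<Sum>j<specht_mult l. h j) else 0)" by (intro sum.cong) auto
    finally show ?thesis using l by (simp add: finite_stable_index)
  qed
  \<comment> \<open>A vector of the direct sum in the kernel of the map is zero.\<close>
  have inj: "d i = (\<lambda>_. 0)" if d: "\<And>i. i \<in> I \<Longrightarrow> d i \<in> Sp i" and zero: "\<Theta> d = (\<lambda>_. 0)" and i: "i \<in> I" for d i
  proof (rule zero_if_young_ops_vanish)
    fix l g assume l: "l \<in> ?P" and g: "g permutes {1..n}"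
    have tr_Sp: "translate g (d k) \<in> Sp k" if "k \<in> I" for k
      using specht_translate[of "d k" _ g] d[OF that] g padded(1)[OF iP(1)[OF that]] by (simp add: Sp_def)
    have other: "Y l (translate g (d k)) = (\<lambda>_. 0)" if "k \<in> I" "fst k \<noteq> l" for k
      using specht_young_op_other[OF l iP(1)[OF that(1)]] that(2) tr_Sp[OF that(1)] by (simp add: Sp_def)
    have "\<exists>q. Y l (translate g (d (l, j))) = (\<lambda>s. q * e l s)" if "j < specht_mult l" for j
      using specht_young_op_same[OF l] tr_Sp[of "(l, j)"] that l by (simp add: Sp_def I_def e_def)
    then obtain q where q: "\<And>j. j < specht_mult l \<Longrightarrow> Y l (translate g (d (l, j))) = (\<lambda>s. q j * e l s)" by metis
    have "(\<lambda>_. 0) = Y l (translate g (\<Theta> d))" unfolding zero by (simp add: translate_def young_op_zero)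
    also have "\<dots> = (\<lambda>s. \<Sum>k\<in>I. Y l (translate g (\<theta> k (d k))) s)"
      unfolding \<Theta>_def translate_def by (rule young_op_sum)
    also have "\<dots> = (\<lambda>s. \<Sum>k\<in>I. if fst k = l then q (snd k) * u l (snd k) s else 0)"
    proof (intro ext sum.cong[OF refl])
      fix s k assume k: "k \<in> I"
      have "Y l (translate g (\<theta> k (d k))) = \<theta> k (Y l (translate g (d k)))"
        unfolding \<theta>_def by (rule specht_hom_young_op[OF l iP(1)[OF k] g])
      also have "\<dots> = (\<lambda>s. if fst k = l then q (snd k) * u l (snd k) s else 0)"
      proof (cases "fst k = l")
        case True
        then have kl: "k = (l, snd k)" "snd k < specht_mult l" using iP[OF k] by auto
        have "\<theta> k (Y l (translate g (d k))) = \<theta> k (\<lambda>s. q (snd k) * e l s)"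
          using q[OF kl(2)] kl(1) by metis
        also have "\<dots> = (\<lambda>s. q (snd k) * u l (snd k) s)"
          using \<theta>_scale[OF k] \<theta>_e[of l "snd k"] kl(1) k by metis
        finally show ?thesis using True by simp
      qed (simp add: other[OF k] \<theta>_zero[OF k])
      finally show "Y l (translate g (\<theta> k (d k))) s = (if fst k = l then q (snd k) * u l (snd k) s else 0)" by simp
    qed
    also have "\<dots> = (\<lambda>s. \<Sum>j<specht_mult l. q j * u l j s)" by (rule ext) (rule sum_I[OF l])
    finally have "q j = 0" if "j < specht_mult l" for j using u(3)[OF l _ that] by metis
    then show "Y l (translate g (d i)) = (\<lambda>_. 0)"
      using q[of "snd i"] other[OF i] iP[OF i] by (cases "fst i = l") auto
  qed
  let ?D = "direct_sum I (\<lambda>(l, _). V_irr l n)"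
  have Vi: "(case i of (l, _) \<Rightarrow> V_irr l n) = specht_module (padded n (fst i))" for i :: "nat list \<times> nat"
    by (simp add: V_irr_def padded_def case_prod_beta)
  have D: "carrier ?D = (\<Pi>\<^sub>E i\<in>I. Sp i)" "add ?D = (\<lambda>x y. \<lambda>i\<in>I. (\<lambda>s. x i s + y i s))"
    "smult ?D = (\<lambda>q x. \<lambda>i\<in>I. (\<lambda>s. q * x i s))" "act ?D = (\<lambda>g x. \<lambda>i\<in>I. translate g (x i))"
    using finI unfolding direct_sum_def Vi specht_ops Sp_def by (auto simp: specht_ops)
  have D_add: "x \<oplus>\<^bsub>?D\<^esub> y \<in> carrier ?D \<and> \<Theta> (x \<oplus>\<^bsub>?D\<^esub> y) = (\<lambda>s. \<Theta> x s + \<Theta> y s)"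
    if "x \<in> carrier ?D" "y \<in> carrier ?D" for x y
  proof
    show "x \<oplus>\<^bsub>?D\<^esub> y \<in> carrier ?D"
      using that specht_closed(2) unfolding D by (auto simp: Sp_def PiE_iff)
    show "\<Theta> (x \<oplus>\<^bsub>?D\<^esub> y) = (\<lambda>s. \<Theta> x s + \<Theta> y s)"
      unfolding \<Theta>_def D sum.distrib[symmetric] by (intro ext sum.cong) (simp_all add: \<theta>_add)
  qed
  have D_smult: "q \<odot>\<^bsub>?D\<^esub> x \<in> carrier ?D \<and> \<Theta> (q \<odot>\<^bsub>?D\<^esub> x) = (\<lambda>s. q * \<Theta> x s)"
    if "x \<in> carrier ?D" for x q
  proof
    show "q \<odot>\<^bsub>?D\<^esub> x \<in> carrier ?D"
      using that specht_closed(3) unfolding D by (auto simp: Sp_def PiE_iff)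
    show "\<Theta> (q \<odot>\<^bsub>?D\<^esub> x) = (\<lambda>s. q * \<Theta> x s)"
      unfolding \<Theta>_def D sum_distrib_left by (intro ext sum.cong) (simp_all add: \<theta>_scale)
  qed
  have D_act: "act ?D g x \<in> carrier ?D \<and> \<Theta> (act ?D g x) = translate g (\<Theta> x)"
    if "g permutes {1..n}" "x \<in> carrier ?D" for x g
  proof
    show "act ?D g x \<in> carrier ?D"
      using that specht_translate[of _ _ g] padded(1)[OF iP(1)] unfolding D by (auto simp: Sp_def PiE_iff)
    show "\<Theta> (act ?D g x) = translate g (\<Theta> x)"
      unfolding \<Theta>_def D translate_def[of g "\<lambda>s. sum (G s) I" for G]
      by (intro ext sum.cong) (simp_all add: \<theta>_tr[OF _ that(1)], simp add: translate_def)
  qed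
  have D_zero: "(\<lambda>i\<in>I. (\<lambda>_. 0)) \<in> carrier ?D" "\<Theta> (\<lambda>i\<in>I. (\<lambda>_. 0)) = (\<lambda>_. 0)"
    using specht_closed(1) \<theta>_zero unfolding D by (auto simp: Sp_def \<Theta>_def)
  let ?U = "\<Theta> ` carrier ?D"
  have U_sub: "fn.subspace ?U"
    unfolding fn.subspace_def
  proof (intro conjI ballI allI)
    show "0 \<in> ?U" using imageI[OF D_zero(1), of \<Theta>] unfolding D_zero(2) zero_fun_def .
    fix x y assume "x \<in> ?U" "y \<in> ?U"
    then obtain d d' where "d \<in> carrier ?D" "d' \<in> carrier ?D" "x = \<Theta> d" "y = \<Theta> d'" by (elim imageE)
    then show "x + y \<in> ?U"
      using D_add[of d d'] unfolding plus_fun_def using imageI[of "d \<oplus>\<^bsub>?D\<^esub> d'" "carrier ?D" \<Theta>] by simp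
  next
    fix q x assume "x \<in> ?U"
    then obtain d where "d \<in> carrier ?D" "x = \<Theta> d" by (elim imageE)
    then show "(\<lambda>s. q * x s) \<in> ?U"
      using D_smult[of d q] using imageI[of "q \<odot>\<^bsub>?D\<^esub> d" "carrier ?D" \<Theta>] by simp
  qed
  have U_tr: "translate g f \<in> ?U" if g: "g permutes {1..n}" and f: "f \<in> ?U" for g f
  proof -
    obtain d where "d \<in> carrier ?D" "f = \<Theta> d" using f by (elim imageE)
    then show ?thesis using D_act[OF g, of d] using imageI[of "act ?D g d" "carrier ?D" \<Theta>] by simp
  qed
  \<comment> \<open>The image contains the spaces spanned by the chosen bases.\<close>
  have U_young: "Y l v \<in> ?U" if l: "l \<in> ?P" and v: "v \<in> V" for l v
  proof -
    obtain a where a: "Y l v = (\<lambda>s. \<Sum>j<specht_mult l. a j * u l j s)" using u(2)[OF l imageI[OF v]] by blast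
    let ?x = "\<lambda>i\<in>I. if fst i = l then (\<lambda>s. a (snd i) * e l s) else (\<lambda>_. 0)"
    have "?x \<in> carrier ?D"
      using specht_closed(1,3) e_Sp[OF l] unfolding D by (auto simp: Sp_def)
    moreover have "\<Theta> ?x = Y l v"
      unfolding a sum_I[OF l, symmetric] \<Theta>_def
    proof (intro ext sum.cong[OF refl])
      fix s i assume i: "i \<in> I"
      show "\<theta> i (?x i) s = (if fst i = l then a (snd i) * u l (snd i) s else 0)"
        using i \<theta>_scale[OF i, of _ "e l"] \<theta>_e[of "fst i" "snd i"] \<theta>_zero[OF i] by auto
    qed
    ultimately show ?thesis using imageI[of ?x "carrier ?D" \<Theta>] by simp
  qed
  have "bij_betw \<Theta> (carrier ?D) (carrier (function_rep V))"
    unfolding bij_betw_def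
  proof
    show "inj_on \<Theta> (carrier ?D)"
    proof (rule inj_onI)
      fix x y assume x: "x \<in> carrier ?D" and y: "y \<in> carrier ?D" and eq: "\<Theta> x = \<Theta> y"
      let ?d = "x \<oplus>\<^bsub>?D\<^esub> ((-1) \<odot>\<^bsub>?D\<^esub> y)"
      have d: "?d \<in> carrier ?D" "\<Theta> ?d = (\<lambda>_. 0)"
        using D_smult[OF y, of "-1"] D_add[OF x] eq by auto
      have "?d i = (\<lambda>_. 0)" if "i \<in> I" for i
        by (rule inj[OF _ d(2) that]) (use d(1) D(1) in auto)
      then have "x i = y i" if "i \<in> I" for i
        using that unfolding D by (auto simp: fun_eq_iff)
      then show "x = y" using x y unfolding D by (rule PiE_ext[rotated 2])
    qed
    show "\<Theta> ` carrier ?D = carrier (function_rep V)"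
    proof (intro equalityI subsetI)
      fix f assume "f \<in> \<Theta> ` carrier ?D"
      moreover have "\<Theta> x \<in> V" for x unfolding \<Theta>_def by (rule subspace_ops(4)[OF subspace]) (rule \<theta>_in)
      ultimately show "f \<in> carrier (function_rep V)" by (auto simp: function_rep_def)
    next
      fix f assume "f \<in> carrier (function_rep V)"
      then have f: "f \<in> V" by (simp add: function_rep_def)
      obtain \<alpha> where \<alpha>: "\<And>f :: (nat \<Rightarrow> 'y) \<Rightarrow> rat. f = (\<lambda>s. \<Sum>l\<in>stable_index n. \<alpha> l * conj_op n (padded n l) (T l) f s)"
        using unit_decomposition by blast
      have "conj_op n (padded n l) (T l) f \<in> ?U" if l: "l \<in> ?P" for l
        unfolding conj_op_def
      proof (rule subspace_ops(4)[OF U_sub])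
        fix g assume "g \<in> {g. g permutes {1..n}}"
        then have g: "g permutes {1..n}" by simp
        show "translate g (symmetrize (row_stabilizer (padded n l) (T l)) (Y l (translate (inv' g) f))) \<in> ?U"
          by (intro U_tr[OF g] symmetrize_in[OF l U_sub U_tr] U_young[OF l] invariant[OF permutes_inv[OF g]] f)
      qed
      then have "(\<lambda>s. \<Sum>l\<in>?P. \<alpha> l * conj_op n (padded n l) (T l) f s) \<in> ?U"
        by (intro subspace_ops(3,4)[OF U_sub])
      then show "f \<in> ?U" unfolding \<alpha>[of f, symmetric] .
    qed
  qed
  then have "rat_rep_iso (sym_group n) (function_rep V) ?D"
    by (rule rat_rep_isoI_inverse) (use D_add D_smult D_act in \<open>auto simp: function_rep_def sym_group_carrier\<close>)
  then show ?thesis unfolding I_def stable_index_def .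
qed

end

section \<open>Length and Bruhat order for growing symmetric groups\<close>

definition inversions :: "(nat \<Rightarrow> nat) \<Rightarrow> (nat \<times> nat) set" where
  "inversions v = {(x, y). x < y \<and> v y < v x}"

lemma inversions_subset:
  assumes v: "v permutes {1..n}"
  shows "inversions v \<subseteq> {1..n} \<times> {1..n}"
proof
  fix d assume "d \<in> inversions v"
  then obtain x y where xy: "d = (x, y)" "x < y" "v y < v x" by (auto simp: inversions_def)
  have out: "v z = z" if "z \<notin> {1..n}" for z using permutes_not_in[OF v that] .
  have ins: "v z \<in> {1..n}" if "z \<in> {1..n}" for z using permutes_in_image[OF v] that by blast
  have "y \<le> n"
  proof (rule ccontr)
    assume "\<not> y \<le> n"
    then have "v y = y" using out by simp
    then show False using xy out[of x] ins[of x] \<open>\<not> y \<le> n\<close> by (cases "x \<in> {1..n}") auto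
  qed
  moreover have "x \<noteq> 0" using xy out[of 0] by (cases "x = 0") auto
  ultimately show "d \<in> {1..n} \<times> {1..n}" using xy by auto
qed

lemma finite_inversions: "v permutes {1..n} \<Longrightarrow> finite (inversions v)"
  by (rule finite_subset[OF inversions_subset]) auto

text \<open>Applying the transposition to both members of an inversion, or keeping the pair where this would
reverse its order, is an injection into the new inversions that misses \<open>(a, b)\<close>.\<close>

lemma inversions_transpose:
  assumes v: "v permutes {1..n}" and ab: "a \<in> {1..n}" "b \<in> {1..n}" "a < b" "v a < v b"
  shows "card (inversions v) < card (inversions (v \<circ> Transposition.transpose a b))"
proof -
  let ?\<tau> = "Transposition.transpose a b"
  let ?\<phi> = "\<lambda>(x, y). if ?\<tau> x < ?\<tau> y then (?\<tau> x, ?\<tau> y) else (x, y)"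
  have v': "v \<circ> ?\<tau> permutes {1..n}" using ab v by (intro permutes_compose permutes_swap_id) auto
  have \<tau>: "?\<tau> (?\<tau> x) = x" for x by simp
  have into: "?\<phi> d \<in> inversions (v \<circ> ?\<tau>) - {(a, b)}" if "d \<in> inversions v" for d
  proof -
    obtain x y where d: "d = (x, y)" "x < y" "v y < v x" using \<open>d \<in> _\<close> by (auto simp: inversions_def)
    show ?thesis
    proof (cases "?\<tau> x < ?\<tau> y")
      case True
      have "(?\<tau> x, ?\<tau> y) \<noteq> (a, b)"
      proof
        assume "(?\<tau> x, ?\<tau> y) = (a, b)"
        then have "?\<tau> x = a" "?\<tau> y = b" by auto
        then have "?\<tau> (?\<tau> x) = ?\<tau> a" "?\<tau> (?\<tau> y) = ?\<tau> b" by (simp_all only:)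
        then have "x = b" "y = a" unfolding \<tau> by simp_all
        then show False using d(2) ab(3) by simp
      qed
      then show ?thesis using True d by (auto simp: inversions_def)
    next
      case False
      \<comment> \<open>The pair meets \<open>{a, b}\<close>, and \<open>v a < v b\<close> makes it an inversion again.\<close>
      then have "x = a \<or> x = b \<or> y = a \<or> y = b" using d(2) by (metis transpose_apply_other)
      then show ?thesis using False d ab by (auto simp: inversions_def Transposition.transpose_def split: if_splits)
    qed
  qed
  have inj: "inj_on ?\<phi> (inversions v)"
  proof (rule inj_onI)
    fix d e assume "d \<in> inversions v" "e \<in> inversions v" and eq: "?\<phi> d = ?\<phi> e"
    then obtain x y x' y' where de: "d = (x, y)" "e = (x', y')" "x < y" "x' < y'" by (auto simp: inversions_def)
    have "?\<tau> z = ?\<tau> z' \<longleftrightarrow> z = z'" for z z' by (metis \<tau>)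
    then show "d = e"
      using eq de \<tau>[of x] \<tau>[of y] \<tau>[of x'] \<tau>[of y'] by (auto split: if_splits)
  qed
  have ab_in: "(a, b) \<in> inversions (v \<circ> ?\<tau>)" using ab by (simp add: inversions_def)
  have "card (inversions v) \<le> card (inversions (v \<circ> ?\<tau>) - {(a, b)})"
  proof (rule card_inj_on_le[OF inj])
    show "?\<phi> ` inversions v \<subseteq> inversions (v \<circ> ?\<tau>) - {(a, b)}" by (rule image_subsetI) (rule into)
    show "finite (inversions (v \<circ> ?\<tau>) - {(a, b)})" using finite_inversions[OF v'] by (rule finite_Diff)
  qed
  also have "\<dots> < card (inversions (v \<circ> ?\<tau>))"
    using ab_in finite_inversions[OF v'] by (rule card_Diff1_less[rotated])
  finally show ?thesis .
qed

text \<open>An adjacent transposition preserves the order of every pair except the one that it exchanges.\<close>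

lemma inversions_adjacent:
  assumes v: "v permutes {1..n}"
  shows "card (inversions (v \<circ> Transposition.transpose j (Suc j))) \<le> Suc (card (inversions v))"
proof -
  let ?\<tau> = "Transposition.transpose j (Suc j)" and ?I = "inversions (v \<circ> Transposition.transpose j (Suc j))"
  have "card (?I - {(j, Suc j)}) \<le> card (inversions v)"
  proof (rule card_inj_on_le[of "map_prod ?\<tau> ?\<tau>"])
    show "inj_on (map_prod ?\<tau> ?\<tau>) (?I - {(j, Suc j)})"
      by (rule inj_on_subset[OF prod.inj_map]) auto
    show "map_prod ?\<tau> ?\<tau> ` (?I - {(j, Suc j)}) \<subseteq> inversions v"
    proof
      fix d assume "d \<in> map_prod ?\<tau> ?\<tau> ` (?I - {(j, Suc j)})"
      then obtain x y where d: "d = (?\<tau> x, ?\<tau> y)" "x < y" "v (?\<tau> y) < v (?\<tau> x)" "(x, y) \<noteq> (j, Suc j)"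
        by (auto simp: inversions_def)
      then have "?\<tau> x < ?\<tau> y" by (auto simp: Transposition.transpose_def)
      then show "d \<in> inversions v" using d by (simp add: inversions_def)
    qed
  qed (rule finite_inversions[OF v])
  moreover have "card ?I \<le> Suc (card (?I - {(j, Suc j)}))"
    using card_insert_le[of ?I "(j, Suc j)"] card.insert_remove[of ?I "(j, Suc j)"] by (cases "finite ?I") auto
  ultimately show ?thesis by simp
qed

abbreviation simple_product :: "nat list \<Rightarrow> (nat \<Rightarrow> nat) \<Rightarrow> nat \<Rightarrow> nat" where
  "simple_product js p \<equiv> foldr (\<lambda>j p. Transposition.transpose j (Suc j) \<circ> p) js p"

lemma simple_product_comp: "simple_product js p = simple_product js id \<circ> p"
  by (induction js) (simp_all add: comp_assoc)

lemma simple_product_snoc: "simple_product (js @ [j]) id = simple_product js id \<circ> Transposition.transpose j (Suc j)"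
  using simple_product_comp[of js "Transposition.transpose j (Suc j)"] by simp

lemma simple_product_permutes: "set js \<subseteq> {1..<n} \<Longrightarrow> simple_product js id permutes {1..n}"
  by (induction js) (auto intro!: permutes_compose permutes_swap_id simp: permutes_id)

lemma inversions_le_length: "set js \<subseteq> {1..<n} \<Longrightarrow> card (inversions (simple_product js id)) \<le> length js"
proof (induction js rule: rev_induct)
  case Nil
  have "inversions (\<lambda>x. x) = {}" by (auto simp: inversions_def)
  then show ?case by (simp add: id_def)
next
  case (snoc j js)
  then have p: "simple_product js id permutes {1..n}" by (intro simple_product_permutes) auto
  have "card (inversions (simple_product js id)) \<le> length js" by (rule snoc.IH) (use snoc.prems in auto)
  then have "card (inversions (simple_product (js @ [j]) id)) \<le> Suc (length js)"
    unfolding simple_product_snoc by (intro le_trans[OF inversions_adjacent[OF p, of j]] Suc_leI le_imp_less_Suc)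
  then show ?case by (simp only: length_append_singleton)
qed

lemma no_inversions_id:
  assumes v: "v permutes {1..n}" and e: "inversions v = {}"
  shows "v = id"
proof -
  have mono: "v x < v y" if "x < y" for x y
  proof -
    have "\<not> v y < v x" using e that by (auto simp: inversions_def)
    moreover have "v x \<noteq> v y" using permutes_inj[OF v] that by (auto dest: injD)
    ultimately show ?thesis by simp
  qed
  then have "strict_mono v" by (simp add: strict_mono_def)
  moreover have "strict_mono (inv' v)"
  proof (rule strict_monoI)
    fix x y :: nat assume "x < y"
    then have "v (inv' v x) < v (inv' v y)" using permutes_inverses(1)[OF v] by simp
    then show "inv' v x < inv' v y" using mono[of "inv' v y" "inv' v x"] by (metis less_asym linorder_cases less_irrefl)
  qed
  ultimately have "x \<le> v x" "v x \<le> inv' v (v x)" for x by (simp_all add: strict_mono_imp_increasing)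
  then show ?thesis using permutes_inverses(2)[OF v] by (auto simp: fun_eq_iff intro: antisym)
qed

text \<open>Undoing a descent at two adjacent positions removes exactly one inversion.\<close>

lemma reduced_word_exists:
  assumes "v permutes {1..n}"
  shows "\<exists>js. length js = card (inversions v) \<and> set js \<subseteq> {1..<n} \<and> v = simple_product js id"
  using assms
proof (induction "card (inversions v)" arbitrary: v rule: less_induct)
  case less
  show ?case
  proof (cases "inversions v = {}")
    case True
    then show ?thesis using no_inversions_id[OF less.prems True] by (intro exI[of _ "[]"]) simp
  next
    case False
    then obtain x y where xy: "(x, y) \<in> inversions v" by auto
    have xyn: "1 \<le> x" "x < y" "y \<le> n" "v y < v x"
      using inversions_subset[OF less.prems] xy by (auto simp: inversions_def)
    have "\<exists>j. x \<le> j \<and> j < y \<and> v (Suc j) < v j"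
    proof (rule ccontr)
      assume *: "\<not> ?thesis"
      have "v x \<le> v k" if "x \<le> k" "k \<le> y" for k
        using that
      proof (induction k rule: dec_induct)
        case (step k)
        then have "v k \<le> v (Suc k)" using * by (meson Suc_le_lessD not_le)
        then show ?case using step by simp
      qed simp
      from this[of y] show False using xyn by simp
    qed
    then obtain j where j: "x \<le> j" "j < y" "v (Suc j) < v j" by blast
    have jn: "1 \<le> j" "j < n" using j xyn by auto
    let ?s = "Transposition.transpose j (Suc j)"
    have v': "v \<circ> ?s permutes {1..n}"
      using jn less.prems by (intro permutes_compose permutes_swap_id) auto
    have undo: "v \<circ> ?s \<circ> ?s = v" by (simp add: comp_assoc)
    have lt: "card (inversions (v \<circ> ?s)) < card (inversions v)"
      using inversions_transpose[OF v', of j "Suc j"] jn j(3) unfolding undo by simp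
    have "card (inversions v) \<le> Suc (card (inversions (v \<circ> ?s)))"
      using inversions_adjacent[OF v', of j] unfolding undo .
    with lt have eq: "card (inversions v) = Suc (card (inversions (v \<circ> ?s)))" by simp
    obtain js where js: "length js = card (inversions (v \<circ> ?s))" "set js \<subseteq> {1..<n}" "v \<circ> ?s = simple_product js id"
      using less.hyps[OF lt v'] by blast
    have "v = simple_product (js @ [j]) id" unfolding simple_product_snoc js(3)[symmetric] undo ..
    then show ?thesis using js(1,2) eq jn by (intro exI[of _ "js @ [j]"]) auto
  qed
qed

lemma coxeter_length_inversions:
  assumes v: "v permutes {1..n}"
  shows "coxeter_length n v = card (inversions v)"
  unfolding coxeter_length_def
proof (rule Least_equality)
  show "\<exists>js. length js = card (inversions v) \<and> set js \<subseteq> {1..<n} \<and> v = simple_product js id"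
    by (rule reduced_word_exists[OF v])
  fix k assume "\<exists>js. length js = k \<and> set js \<subseteq> {1..<n} \<and> v = simple_product js id"
  then show "card (inversions v) \<le> k" using inversions_le_length by auto
qed

lemma permutes_larger: "v permutes {1..m} \<Longrightarrow> m \<le> n \<Longrightarrow> v permutes {1..n::nat}"
  by (rule permutes_subset) auto

lemma bruhat_step_larger:
  assumes "bruhat_step m u v" "m \<le> n"
  shows "bruhat_step n u v"
proof -
  have u: "u permutes {1..m}" and v: "v permutes {1..m}" using assms(1) by (auto simp: bruhat_step_def sym_group_carrier)
  have "(\<exists>a\<in>{1..n}. \<exists>b\<in>{1..n}. v = u \<circ> Transposition.transpose a b)"
    using assms unfolding bruhat_step_def by fastforce
  then show ?thesis using assms(1) permutes_larger[OF u assms(2)] permutes_larger[OF v assms(2)]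
    unfolding bruhat_step_def sym_group_carrier coxeter_length_inversions[OF u] coxeter_length_inversions[OF v]
    by (simp add: coxeter_length_inversions)
qed

text \<open>If the reflection moved a point \<open>b > m\<close>, then \<open>v a < b = v b\<close>, and undoing it would create inversions
instead of removing them.\<close>

lemma bruhat_step_smaller:
  assumes step: "bruhat_step n u v" and v: "v permutes {1..m}" and mn: "m \<le> n"
  shows "bruhat_step m u v"
proof -
  have un: "u permutes {1..n}" and vn: "v permutes {1..n}" using step by (auto simp: bruhat_step_def sym_group_carrier)
  obtain a0 b0 where ab0: "a0 \<in> {1..n}" "b0 \<in> {1..n}" "v = u \<circ> Transposition.transpose a0 b0"
    using step by (auto simp: bruhat_step_def)
  have lt: "card (inversions u) < card (inversions v)"
    using step coxeter_length_inversions[OF un] coxeter_length_inversions[OF vn] by (simp add: bruhat_step_def)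
  then have "a0 \<noteq> b0" using ab0 by auto
  then obtain a b where ab: "a \<in> {1..n}" "b \<in> {1..n}" "a < b" "v = u \<circ> Transposition.transpose a b"
    using ab0 by (metis linorder_neqE_nat transpose_commute)
  have u_eq: "u = v \<circ> Transposition.transpose a b" unfolding ab(4) by (simp add: comp_assoc)
  have "b \<le> m"
  proof (rule ccontr)
    assume "\<not> b \<le> m"
    then have b: "v b = b" using permutes_not_in[OF v] by simp
    have "v a < b"
      using \<open>\<not> b \<le> m\<close> ab(3) permutes_not_in[OF v, of a] permutes_in_image[OF v, of a] by (cases "a \<in> {1..m}") auto
    then have "card (inversions v) < card (inversions u)"
      using inversions_transpose[OF vn ab(1,2,3)] b u_eq by simp
    then show False using lt by simp
  qed
  then have abm: "a \<in> {1..m}" "b \<in> {1..m}" using ab by auto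
  then have um: "u permutes {1..m}" unfolding u_eq using v by (intro permutes_compose permutes_swap_id) auto
  show ?thesis
    unfolding bruhat_step_def sym_group_carrier coxeter_length_inversions[OF um] coxeter_length_inversions[OF v]
    using um v lt abm ab(4) by blast
qed

lemma bruhat_le_stable:
  assumes w: "w permutes {1..m}" and mn: "m \<le> n"
  shows "bruhat_le n v w \<longleftrightarrow> bruhat_le m v w"
    "bruhat_le m v w \<Longrightarrow> v permutes {1..m}"
proof -
  have "bruhat_le n v w \<Longrightarrow> bruhat_le m v w \<and> v permutes {1..m}"
    unfolding bruhat_le_def
  proof (induction rule: converse_rtranclp_induct)
    case base then show ?case using w by simp
  next
    case (step y z)
    then have "bruhat_step m y z" using bruhat_step_smaller mn by blast
    then show ?case using step.IH by (auto simp: bruhat_step_def sym_group_carrier intro: converse_rtranclp_into_rtranclp)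
  qed
  moreover have le: "bruhat_le m v w \<Longrightarrow> bruhat_le n v w"
    unfolding bruhat_le_def by (rule rtranclp_mono[THEN predicate2D, rotated]) (use bruhat_step_larger mn in auto)
  ultimately show "bruhat_le n v w \<longleftrightarrow> bruhat_le m v w" "bruhat_le m v w \<Longrightarrow> v permutes {1..m}" by blast+
qed

lemma bruhat_interval_stable:
  assumes w: "w permutes {1..m}" and mn: "m \<le> n"
  shows "{v \<in> carrier (sym_group n). bruhat_le n v w} = {v \<in> carrier (sym_group m). bruhat_le m v w}"
  using bruhat_le_stable[OF w mn] permutes_larger[OF _ mn] by (auto simp: sym_group_carrier)

section \<open>Monomials as states\<close>

definition supported_functions :: "'a set \<Rightarrow> ('a \<Rightarrow> rat) set" where
  "supported_functions X = {f. \<forall>s. s \<notin> X \<longrightarrow> f s = 0}"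

lemma subspace_supported: "fn.subspace (supported_functions X)"
  by (auto simp: fn.subspace_def supported_functions_def)

lemma supported_span:
  assumes "finite X"
  shows "supported_functions X \<subseteq> fn.span ((\<lambda>s u. if u = s then 1 else 0) ` X)"
proof
  fix f assume f: "f \<in> supported_functions X"
  have "f = (\<Sum>s\<in>X. (\<lambda>u. f s * (if u = s then 1 else 0)))"
  proof
    fix u
    have "(\<Sum>s\<in>X. f s * (if u = s then 1 else 0)) = (\<Sum>s\<in>X. if u = s then f s else 0)"
      by (rule sum.cong) auto
    also have "\<dots> = f u" using f assms by (simp add: supported_functions_def)
    finally show "f u = (\<Sum>s\<in>X. (\<lambda>u. f s * (if u = s then 1 else 0))) u" by (simp add: sum_fun_apply)
  qed
  also have "\<dots> \<in> fn.span ((\<lambda>s u. if u = s then 1 else 0) ` X)"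
    by (rule fn.span_sum, rule fn.span_scale, rule fn.span_base) auto
  finally show "f \<in> fn.span ((\<lambda>s u. if u = s then 1 else 0) ` X)" .
qed

text \<open>The pair of an index \<open>q\<close> and a monomial with exponent vector \<open>a\<close> is encoded as the function
\<open>\<lambda>j. (q, a j)\<close>, so that permutations of the variables act by precomposition. The degree of the monomial
is prescribed by \<open>q\<close>; it may be negative, in which case there is no state.\<close>

definition states :: "'q set \<Rightarrow> ('q \<Rightarrow> int) \<Rightarrow> nat \<Rightarrow> (nat \<Rightarrow> 'q \<times> nat) set" where
  "states Q wt n = {s. \<exists>q\<in>Q. \<exists>a. (\<forall>j. j \<notin> {1..n} \<longrightarrow> a j = 0) \<and> int (\<Sum>j\<in>{1..n}. a j) = wt q \<and> s = (\<lambda>j. (q, a j))}"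

lemma states_comp:
  assumes s: "s \<in> states Q wt n" and g: "g permutes {1..n}"
  shows "s \<circ> g \<in> states Q wt n"
proof -
  obtain q a where q: "q \<in> Q" "\<And>j. j \<notin> {1..n} \<Longrightarrow> a j = 0" "int (\<Sum>j\<in>{1..n}. a j) = wt q" "s = (\<lambda>j. (q, a j))"
    using s by (auto simp: states_def)
  have "(\<Sum>j\<in>{1..n}. a (g j)) = (\<Sum>j\<in>{1..n}. a j)"
    using sum.permute[OF g, of a] by (simp add: o_def)
  then have "int (\<Sum>j\<in>{1..n}. (a \<circ> g) j) = wt q" using q(3) by simp
  moreover have "(a \<circ> g) j = 0" if "j \<notin> {1..n}" for j using q(2) permutes_not_in[OF g that] that by simp
  moreover have "s \<circ> g = (\<lambda>j. (q, (a \<circ> g) j))" using q(4) by auto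
  ultimately show ?thesis using q(1) unfolding states_def by blast
qed

lemma states_comp_iff:
  assumes g: "g permutes {1..n}"
  shows "s \<circ> g \<in> states Q wt n \<longleftrightarrow> s \<in> states Q wt n"
  using states_comp[OF _ g] states_comp[OF _ permutes_inv[OF g], of "s \<circ> g"] permutes_comp_inv(3)[OF g, of s] by auto

lemma states_Suc: "s \<in> states Q wt n \<longleftrightarrow> s \<in> states Q wt (Suc n) \<and> snd (s (Suc n)) = 0"
proof
  assume "s \<in> states Q wt n"
  then obtain q a where q: "q \<in> Q" "\<And>j. j \<notin> {1..n} \<Longrightarrow> a j = 0" "int (\<Sum>j\<in>{1..n}. a j) = wt q" "s = (\<lambda>j. (q, a j))"
    by (auto simp: states_def)
  then have "(\<Sum>j\<in>{1..Suc n}. a j) = (\<Sum>j\<in>{1..n}. a j)" by simp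
  with q show "s \<in> states Q wt (Suc n) \<and> snd (s (Suc n)) = 0"
    unfolding states_def by (auto intro!: bexI[of _ q] exI[of _ a])
next
  assume "s \<in> states Q wt (Suc n) \<and> snd (s (Suc n)) = 0"
  then obtain q a where q: "q \<in> Q" "\<And>j. j \<notin> {1..Suc n} \<Longrightarrow> a j = 0" "int (\<Sum>j\<in>{1..Suc n}. a j) = wt q" "s = (\<lambda>j. (q, a j))"
     "snd (s (Suc n)) = 0"
    unfolding states_def by blast
  then have a0: "a (Suc n) = 0" by simp
  then have "(\<Sum>j\<in>{1..Suc n}. a j) = (\<Sum>j\<in>{1..n}. a j)" by simp
  moreover have "a j = 0" if "j \<notin> {1..n}" for j using q(2)[of j] a0 that by (cases "j = Suc n") auto
  ultimately show "s \<in> states Q wt n" using q unfolding states_def by auto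
qed

lemma states_eq: "s \<in> states Q wt n \<Longrightarrow> snd (s x) = snd (s y) \<Longrightarrow> s x = s y"
  by (auto simp: states_def)

text \<open>A monomial of degree at most \<open>D\<close> involves at most \<open>D\<close> of the more than \<open>D\<close> variables beyond \<open>N\<close>.\<close>

lemma states_zero_entry:
  assumes s: "s \<in> states Q wt n" and D: "\<And>q. q \<in> Q \<Longrightarrow> wt q \<le> int D" and n: "N + D < n"
  shows "\<exists>y. N < y \<and> y \<le> n \<and> snd (s y) = 0"
proof (rule ccontr)
  assume *: "\<nexists>y. N < y \<and> y \<le> n \<and> snd (s y) = 0"
  obtain q a where q: "q \<in> Q" "int (\<Sum>j\<in>{1..n}. a j) = wt q" "s = (\<lambda>j. (q, a j))"
    using s by (auto simp: states_def)
  have "n - N = (\<Sum>j\<in>{N<..n}. 1)" by simp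
  also have "\<dots> \<le> (\<Sum>j\<in>{N<..n}. a j)" by (rule sum_mono) (use * q(3) in \<open>auto simp: Suc_le_eq\<close>)
  also have "\<dots> \<le> (\<Sum>j\<in>{1..n}. a j)" by (rule sum_mono2) auto
  also have "\<dots> \<le> D" using q(2) D[OF q(1)] by (metis of_nat_le_iff)
  finally show False using n by simp
qed

lemma finite_states:
  assumes Q: "finite Q"
  shows "finite (states Q wt n)"
proof -
  have "states Q wt n \<subseteq> (\<Union>q\<in>Q. (\<lambda>a j. (q, a j)) ` {a. (\<forall>j\<in>{1..n}. a j \<in> {..nat (wt q)}) \<and> (\<forall>j. j \<notin> {1..n} \<longrightarrow> a j = 0)})"
  proof
    fix s assume "s \<in> states Q wt n"
    then obtain q a where q: "q \<in> Q" "\<And>j. j \<notin> {1..n} \<Longrightarrow> a j = 0" "int (\<Sum>j\<in>{1..n}. a j) = wt q" "s = (\<lambda>j. (q, a j))"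
      by (auto simp: states_def)
    have "a j \<le> nat (wt q)" if "j \<in> {1..n}" for j
    proof -
      have "a j \<le> (\<Sum>j\<in>{1..n}. a j)" by (rule member_le_sum[OF that]) auto
      then show ?thesis using q(3) by linarith
    qed
    then show "s \<in> (\<Union>q\<in>Q. (\<lambda>a j. (q, a j)) ` {a. (\<forall>j\<in>{1..n}. a j \<in> {..nat (wt q)}) \<and> (\<forall>j. j \<notin> {1..n} \<longrightarrow> a j = 0)})"
      using q by blast
  qed
  moreover have "finite {a. (\<forall>j\<in>{1..n}. a j \<in> {..nat (wt q)}) \<and> (\<forall>j. j \<notin> {1..n} \<longrightarrow> a j = (0::nat))}" for q
    using finite_set_of_finite_funs[of "{1..n}" "{..nat (wt q)}" 0] by (simp add: Ball_def conj_commute all_conj_distrib imp_conjR cong: conj_cong)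
  ultimately show ?thesis using Q by (meson finite_UN_I finite_imageI finite_subset)
qed

lemma dim_image_injective:
  fixes L :: "('a \<Rightarrow> rat) \<Rightarrow> 'b \<Rightarrow> rat"
  assumes W: "fn.subspace W"
    and add: "\<And>x y. L (x + y) = L x + L y" and scale: "\<And>q x. L (\<lambda>s. q * x s) = (\<lambda>s. q * L x s)"
    and inj: "\<And>x. x \<in> W \<Longrightarrow> L x = 0 \<Longrightarrow> x = 0"
  shows "fn.dim (L ` W) = fn.dim W"
proof -
  interpret L: Vector_Spaces.linear "\<lambda>(q::rat) f x. q * f x" "\<lambda>(q::rat) f x. q * f x" L
    by unfold_locales (rule add, rule scale)
  obtain B where B: "B \<subseteq> W" "fn.independent B" "W \<subseteq> fn.span B" "card B = fn.dim W"
    using fn.basis_exists[of W] by metis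
  have sB: "fn.span B = W" using B(1,3) W by (simp add: fn.span_minimal subset_antisym)
  have injW: "inj_on L W"
  proof (rule inj_onI)
    fix x y assume "x \<in> W" "y \<in> W" "L x = L y"
    then have "x - y \<in> W" "L (x - y) = 0" using fn.subspace_diff[OF W] L.diff by auto
    then show "x = y" using inj by fastforce
  qed
  have "fn.independent (L ` B)"
    by (rule L.independent_injective_image[OF B(2)]) (simp add: sB injW)
  moreover have "L ` W \<subseteq> fn.span (L ` B)" by (simp add: L.span_image sB)
  ultimately have "card (L ` B) = fn.dim (L ` W)" using B(1) by (intro fn.basis_card_eq_dim) auto
  moreover have "card (L ` B) = card B" by (rule card_image) (rule inj_on_subset[OF injW B(1)])
  ultimately show ?thesis using B(4) by simp
qed

section \<open>Stability of the multiplicity spaces\<close>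

text \<open>The shape of the data for a fixed partition and growing \<open>n\<close>: the row function \<open>\<rho>\<close> of the tableaux puts
all entries beyond \<open>N\<close> into row \<open>0\<close>, the column stabilizer \<open>C\<close> moves no entry beyond \<open>N\<close>, and both are
independent of \<open>n\<close>. Here \<open>row_perms n\<close> is the row stabilizer and \<open>mult_space n\<close> is the space \<open>b a V\<close>.\<close>

locale stable_system =
  fixes Q :: "'q set" and wt :: "'q \<Rightarrow> int" and D :: nat
    and \<rho> :: "nat \<Rightarrow> nat" and N :: nat and C :: "(nat \<Rightarrow> nat) set"
  assumes wt: "\<And>q. q \<in> Q \<Longrightarrow> wt q \<le> int D"
    and \<rho>: "\<And>x. N < x \<Longrightarrow> \<rho> x = 0"
    and C: "perm_group N C"
begin

abbreviation "X n \<equiv> states Q wt n"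
abbreviation "V n \<equiv> supported_functions (X n)"
definition "row_perms n = {r. r permutes {1..n} \<and> \<rho> \<circ> r = \<rho>}"
definition "row_invariants n = {f \<in> V n. \<forall>r\<in>row_perms n. \<forall>s. f (s \<circ> r) = f s}"
definition "restriction n f = (\<lambda>s. if s \<in> X n then f s else (0::rat))"
definition "mult_space n = (\<lambda>f. antisymmetrize C (symmetrize (row_perms n) f)) ` V n"

lemma group_row_perms: "perm_group n (row_perms n)"
proof -
  have "inv' r \<in> row_perms n" if "r \<in> row_perms n" for r
  proof -
    have r: "r permutes {1..n}" "\<rho> \<circ> r = \<rho>" using that by (auto simp: row_perms_def)
    have "\<rho> \<circ> inv' r = \<rho>" using permutes_comp_inv(3)[OF r(1), of \<rho>] r(2) by simp
    then show ?thesis using r(1) by (simp add: row_perms_def permutes_inv)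
  qed
  moreover have "p \<circ> q \<in> row_perms n" if "p \<in> row_perms n" "q \<in> row_perms n" for p q
    using that unfolding row_perms_def by (auto simp: permutes_compose comp_assoc[symmetric])
  ultimately show ?thesis unfolding perm_group_def by (auto simp: row_perms_def permutes_id)
qed

lemma row_perms_Suc: "row_perms n \<subseteq> row_perms (Suc n)"
  using permutes_larger[of _ n "Suc n"] by (auto simp: row_perms_def)

lemma C_permutes: "p \<in> C \<Longrightarrow> N \<le> n \<Longrightarrow> p permutes {1..n}"
  using perm_groupD(1)[OF C] permutes_larger by blast

lemma transpose_row_perms:
  assumes "N < x" "x \<le> n" "N < y" "y \<le> n"
  shows "Transposition.transpose x y \<in> row_perms n"
proof -
  have "Transposition.transpose x y permutes {1..n}" using assms by (intro permutes_swap_id) auto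
  moreover have "\<rho> \<circ> Transposition.transpose x y = \<rho>"
    using \<rho>[of x] \<rho>[of y] assms by (auto simp: fun_eq_iff Transposition.transpose_def)
  ultimately show ?thesis by (simp add: row_perms_def)
qed

text \<open>An invariant function is the symmetrization of its quotient by the order of the group.\<close>

lemma symmetrize_image: "symmetrize (row_perms n) ` V n = row_invariants n"
proof (intro equalityI subsetI)
  fix f assume "f \<in> symmetrize (row_perms n) ` V n"
  then obtain h where h: "h \<in> V n" "f = symmetrize (row_perms n) h" by blast
  have "f \<in> V n"
    using h perm_groupD(1)[OF group_row_perms] unfolding supported_functions_def symmetrize_def
    by (auto intro!: sum.neutral simp: states_comp_iff)
  then show "f \<in> row_invariants n" using symmetrize_invariant[OF group_row_perms, of _ n h] h(2) by (auto simp: row_invariants_def)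
next
  fix f assume f: "f \<in> row_invariants n"
  let ?c = "of_nat (card (row_perms n)) :: rat"
  have c: "?c \<noteq> 0" using perm_group_finite[OF group_row_perms, of n] perm_groupD(2)[OF group_row_perms, of n] by auto
  have "symmetrize (row_perms n) (\<lambda>s. f s / ?c) = (\<lambda>s. ?c * (f s / ?c))"
    by (rule symmetrize_of_invariant) (use f in \<open>auto simp: row_invariants_def\<close>)
  then have "f = symmetrize (row_perms n) (\<lambda>s. f s / ?c)" using c by simp
  moreover have "(\<lambda>s. f s / ?c) \<in> V n" using f by (auto simp: row_invariants_def supported_functions_def)
  ultimately show "f \<in> symmetrize (row_perms n) ` V n" by (rule image_eqI)
qed

lemma mult_space_alt: "mult_space n = antisymmetrize C ` row_invariants n"
  unfolding mult_space_def symmetrize_image[symmetric] image_image ..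

lemma subspace_mult_space: "fn.subspace (mult_space n)"
  unfolding fn.subspace_def
proof (intro conjI ballI allI)
  let ?A = "\<lambda>f. antisymmetrize C (symmetrize (row_perms n) f)"
  note sub = subspace_supported[of "X n", unfolded fn.subspace_def]
  have "?A 0 = 0" by (simp add: antisymmetrize_def symmetrize_def fun_eq_iff)
  moreover have "0 \<in> V n" using sub by blast
  ultimately show "0 \<in> mult_space n" unfolding mult_space_def by (metis imageI)
  fix x y assume "x \<in> mult_space n" "y \<in> mult_space n"
  then obtain f h where fh: "f \<in> V n" "h \<in> V n" "x = ?A f" "y = ?A h" by (auto simp: mult_space_def)
  have "?A (f + h) = ?A f + ?A h"
    by (simp add: antisymmetrize_def symmetrize_def fun_eq_iff sum.distrib algebra_simps)
  moreover have "f + h \<in> V n" using sub fh by blast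
  ultimately show "x + y \<in> mult_space n" unfolding mult_space_def fh by (metis imageI)
next
  let ?A = "\<lambda>f. antisymmetrize C (symmetrize (row_perms n) f)"
  note sub = subspace_supported[of "X n", unfolded fn.subspace_def]
  fix q :: rat and x assume "x \<in> mult_space n"
  then obtain f where f: "f \<in> V n" "x = ?A f" by (auto simp: mult_space_def)
  have "?A (\<lambda>s. q * f s) = (\<lambda>s. q * ?A f s)"
    by (simp add: antisymmetrize_def symmetrize_def fun_eq_iff sum_distrib_left mult.left_commute)
  moreover have "(\<lambda>s. q * f s) \<in> V n" using sub f by blast
  ultimately show "(\<lambda>s. q * x s) \<in> mult_space n" unfolding mult_space_def f by (metis (no_types, lifting) imageI)
qed

text \<open>The column stabilizer preserves the states for \<open>n\<close> variables, because it fixes all entries beyond \<open>N\<close>.\<close>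

lemma restriction_antisymmetrize:
  assumes "N \<le> n"
  shows "restriction n (antisymmetrize C f) = antisymmetrize C (restriction n f)"
proof
  fix s
  have "s \<circ> p \<in> X n \<longleftrightarrow> s \<in> X n" if "p \<in> C" for p by (rule states_comp_iff[OF C_permutes[OF that assms]])
  then show "restriction n (antisymmetrize C f) s = antisymmetrize C (restriction n f) s"
    unfolding restriction_def antisymmetrize_def by (cases "s \<in> X n") auto
qed

text \<open>Two states for \<open>n\<close> variables that are related by the row stabilizer for \<open>n + 1\<close> are already related by
that for \<open>n\<close>: if \<open>r\<close> moves \<open>n + 1\<close> to \<open>y\<close>, then \<open>y\<close> and \<open>n + 1\<close> lie in the same row and both are absent from \<open>s\<close>, so
\<open>r\<close> can be corrected by their transposition.\<close>

lemma same_orbit: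
  assumes s: "s \<in> X n" "s \<circ> r \<in> X n" and r: "r \<in> row_perms (Suc n)" and f: "f \<in> row_invariants n" and n: "N \<le> n"
  shows "f (s \<circ> r) = f s"
proof -
  have rp: "r permutes {1..Suc n}" "\<rho> \<circ> r = \<rho>" using r by (auto simp: row_perms_def)
  define y where "y = r (Suc n)"
  let ?\<tau> = "Transposition.transpose y (Suc n)"
  have y: "y \<in> {1..Suc n}" unfolding y_def using permutes_in_image[OF rp(1)] by auto
  have \<rho>y: "\<rho> y = \<rho> (Suc n)" using fun_cong[OF rp(2), of "Suc n"] by (simp add: y_def)
  have "snd (s y) = 0" using s(2) states_Suc[of "s \<circ> r" Q wt n] by (simp add: y_def)
  moreover have "snd (s (Suc n)) = 0" using s(1) states_Suc[of s Q wt n] by simp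
  ultimately have sy: "s y = s (Suc n)" using states_eq[OF s(1)] by simp
  then have s\<tau>: "s \<circ> ?\<tau> = s" by (auto simp: fun_eq_iff Transposition.transpose_def)
  have "?\<tau> \<circ> r permutes {1..Suc n}" using y by (intro permutes_compose rp permutes_swap_id) auto
  then have "?\<tau> \<circ> r permutes {1..n}"
    by (rule permutes_superset) (auto simp: y_def le_Suc_eq)
  moreover have "\<rho> \<circ> ?\<tau> = \<rho>" using \<rho>y by (auto simp: fun_eq_iff Transposition.transpose_def)
  then have "\<rho> \<circ> (?\<tau> \<circ> r) = \<rho>" using rp(2) by (simp add: comp_assoc[symmetric])
  ultimately have "?\<tau> \<circ> r \<in> row_perms n" by (simp add: row_perms_def)
  then have "f (s \<circ> (?\<tau> \<circ> r)) = f s" using f by (simp add: row_invariants_def)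
  then show ?thesis using s\<tau> by (simp add: comp_assoc[symmetric])
qed

lemma move_into:
  assumes s: "s \<in> X (Suc n)" and n: "N + D \<le> n"
  shows "\<exists>y. N < y \<and> y \<le> Suc n \<and> s \<circ> Transposition.transpose y (Suc n) \<in> X n"
proof -
  obtain y where y: "N < y" "y \<le> Suc n" "snd (s y) = 0"
    using states_zero_entry[OF s wt, of N] n by auto
  have "Transposition.transpose y (Suc n) permutes {1..Suc n}" using y by (intro permutes_swap_id) auto
  then have "s \<circ> Transposition.transpose y (Suc n) \<in> X (Suc n)" using states_comp[OF s] by blast
  then have "s \<circ> Transposition.transpose y (Suc n) \<in> X n" using y(3) by (subst states_Suc) simp
  then show ?thesis using y by blast
qed

text \<open>Every orbit of the larger row stabilizer meets the states for \<open>n\<close> variables (\<open>move_into\<close>), and it does so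
in a single orbit of the smaller one (\<open>same_orbit\<close>). Hence every invariant function extends.\<close>

lemma restriction_row_invariants:
  assumes n: "N + D \<le> n"
  shows "restriction n ` row_invariants (Suc n) = row_invariants n"
proof (intro equalityI subsetI)
  fix f assume "f \<in> restriction n ` row_invariants (Suc n)"
  then obtain h where h: "h \<in> row_invariants (Suc n)" "f = restriction n h" by blast
  have "f (s \<circ> r) = f s" if r: "r \<in> row_perms n" for r s
  proof -
    have rp: "r permutes {1..n}" using r by (simp add: row_perms_def)
    have "r \<in> row_perms (Suc n)" using row_perms_Suc r by blast
    then show ?thesis using h states_comp_iff[OF rp, of s] by (simp add: row_invariants_def restriction_def)
  qed
  then show "f \<in> row_invariants n" using h(2) by (auto simp: row_invariants_def restriction_def supported_functions_def)
next
  fix f assume f: "f \<in> row_invariants n"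
  have nN: "N \<le> n" using n by simp
  let ?P = "\<lambda>s s'. s' \<in> X n \<and> (\<exists>r\<in>row_perms (Suc n). s' = s \<circ> r)"
  \<comment> \<open>A representative in \<open>n\<close> variables of the orbit of \<open>s\<close>.\<close>
  define c where "c s = (SOME s'. ?P s s')" for s
  define f' where "f' s = (if s \<in> X (Suc n) then f (c s) else 0)" for s
  have c: "?P s (c s)" if s: "s \<in> X (Suc n)" for s
  proof -
    have "\<exists>s'. ?P s s'" using move_into[OF s n] transpose_row_perms[of _ "Suc n" "Suc n"] nN by fastforce
    then show ?thesis unfolding c_def by (rule someI_ex)
  qed
  have c_eq: "f (c s) = f s'" if s: "s \<in> X (Suc n)" and s': "?P s s'" for s s'
  proof -
    obtain r1 where r1: "r1 \<in> row_perms (Suc n)" "c s = s \<circ> r1" using c[OF s] by blast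
    obtain r2 where r2: "r2 \<in> row_perms (Suc n)" "s' = s \<circ> r2" using s' by blast
    have "r2 permutes {1..Suc n}" using r2 by (simp add: row_perms_def)
    then have e: "c s = s' \<circ> (inv' r2 \<circ> r1)"
      unfolding r1(2) r2(2) by (simp add: comp_assoc permutes_comp_inv)
    have "inv' r2 \<circ> r1 \<in> row_perms (Suc n)" using perm_groupD[OF group_row_perms] r1 r2 by blast
    then show ?thesis using same_orbit[OF _ _ _ f nN, of s' "inv' r2 \<circ> r1"] s' c[OF s] e by simp
  qed
  have "f' \<in> row_invariants (Suc n)"
    unfolding row_invariants_def
  proof (intro CollectI conjI ballI allI)
    show "f' \<in> V (Suc n)" by (simp add: f'_def supported_functions_def)
    fix r s assume r: "r \<in> row_perms (Suc n)"
    then have rp: "r permutes {1..Suc n}" by (simp add: row_perms_def)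
    show "f' (s \<circ> r) = f' s"
    proof (cases "s \<in> X (Suc n)")
      case True
      then have sr: "s \<circ> r \<in> X (Suc n)" using states_comp_iff[OF rp] by blast
      obtain r1 where r1: "r1 \<in> row_perms (Suc n)" "c (s \<circ> r) = s \<circ> r \<circ> r1" using c[OF sr] by blast
      have "?P s (c (s \<circ> r))"
        using c[OF sr] r1 perm_groupD(3)[OF group_row_perms r r1(1)] by (auto simp: comp_assoc)
      then show ?thesis using True sr c_eq by (simp add: f'_def)
    next
      case False
      then show ?thesis using states_comp_iff[OF rp, of s] by (simp add: f'_def)
    qed
  qed
  moreover have "f = restriction n f'"
  proof
    fix s show "f s = restriction n f' s"
    proof (cases "s \<in> X n")
      case True
      then have s: "s \<in> X (Suc n)" using states_Suc by blast
      have "?P s s" using True perm_groupD(2)[OF group_row_perms, of "Suc n"] by (auto intro: bexI[of _ id])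
      then show ?thesis using c_eq[OF s] True s by (simp add: restriction_def f'_def)
    qed (use f in \<open>simp add: restriction_def row_invariants_def supported_functions_def\<close>)
  qed
  ultimately show "f \<in> restriction n ` row_invariants (Suc n)" by blast
qed

lemma restriction_mult_space:
  assumes "N + D \<le> n"
  shows "restriction n ` mult_space (Suc n) = mult_space n"
  unfolding mult_space_alt restriction_row_invariants[OF assms, symmetric] image_image
  using restriction_antisymmetrize[of n] assms by simp

text \<open>The functions in \<open>mult_space\<close> are invariant under transpositions of entries beyond \<open>N\<close>, which lie in
the row stabilizer and commute with the column stabilizer. Such a transposition moves any state for
\<open>n + 1\<close> variables into \<open>n\<close> variables.\<close>

lemma restriction_injective:
  assumes n: "N + D \<le> n" and x: "x \<in> mult_space (Suc n)" and z: "restriction n x = 0"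
  shows "x = 0"
proof
  fix s
  obtain f where f: "f \<in> row_invariants (Suc n)" "x = antisymmetrize C f" using x by (auto simp: mult_space_alt)
  show "x s = 0 s"
  proof (cases "s \<in> X (Suc n)")
    case True
    then obtain y where y: "N < y" "y \<le> Suc n" "s \<circ> Transposition.transpose y (Suc n) \<in> X n"
      using move_into n by blast
    let ?\<tau> = "Transposition.transpose y (Suc n)"
    have \<tau>: "?\<tau> \<in> row_perms (Suc n)" using y n by (intro transpose_row_perms) auto
    have "x (s \<circ> ?\<tau>) = x s"
      unfolding f(2) antisymmetrize_def
    proof (rule sum.cong[OF refl])
      fix p assume "p \<in> C"
      then have p: "p permutes {1..N}" using perm_groupD(1)[OF C] by blast
      have "?\<tau> \<circ> p = p \<circ> ?\<tau>"
      proof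
        fix k show "(?\<tau> \<circ> p) k = (p \<circ> ?\<tau>) k"
          using permutes_not_in[OF p, of y] permutes_not_in[OF p, of "Suc n"] permutes_in_image[OF p, of k]
            permutes_not_in[OF p, of k] y n
          by (cases "k \<in> {1..N}") (auto simp: Transposition.transpose_def)
      qed
      then have "s \<circ> ?\<tau> \<circ> p = s \<circ> p \<circ> ?\<tau>" by (simp add: comp_assoc)
      then show "of_int (sign p) * f (s \<circ> ?\<tau> \<circ> p) = of_int (sign p) * f (s \<circ> p)"
        using f(1) \<tau> by (simp add: row_invariants_def)
    qed
    moreover have "x (s \<circ> ?\<tau>) = restriction n x (s \<circ> ?\<tau>)" using y(3) by (simp add: restriction_def)
    ultimately show ?thesis using z by simp
  next
    case False
    have "f (s \<circ> p) = 0" if "p \<in> C" for p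
      using False f(1) states_comp_iff[OF C_permutes[OF that], of "Suc n" s] n by (simp add: row_invariants_def supported_functions_def)
    then show ?thesis using f(2) by (simp add: antisymmetrize_def)
  qed
qed

lemma dim_mult_space_Suc:
  assumes "N + D \<le> n"
  shows "fn.dim (mult_space (Suc n)) = fn.dim (mult_space n)"
proof -
  have "fn.dim (restriction n ` mult_space (Suc n)) = fn.dim (mult_space (Suc n))"
    by (rule dim_image_injective[OF subspace_mult_space _ _ restriction_injective[OF assms]])
       (auto simp: restriction_def fun_eq_iff)
  then show ?thesis by (simp add: restriction_mult_space[OF assms])
qed

lemma dim_mult_space_stable:
  assumes "N + D \<le> n"
  shows "fn.dim (mult_space n) = fn.dim (mult_space (N + D))"
  using assms by (induction n rule: dec_induct) (simp_all add: dim_mult_space_Suc)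

end

section \<open>Tableaux with a fixed core\<close>

definition first_part :: "nat list \<Rightarrow> nat" where
  "first_part l = (if l = [] then 0 else hd l)"

text \<open>The part of the diagram that does not change with \<open>n\<close>: the given partition, and as much of the long
first row as lies above it.\<close>

definition core :: "nat list \<Rightarrow> nat list" where
  "core l = first_part l # l"

definition core_tableau :: "nat list \<Rightarrow> nat \<times> nat \<Rightarrow> nat" where
  "core_tableau l = (SOME t. t \<in> tableaux (core l))"

definition stable_tableau :: "nat list \<Rightarrow> nat \<times> nat \<Rightarrow> nat" where
  "stable_tableau l = (\<lambda>(r, c). if r = 0 \<and> first_part l \<le> c then sum_list l + c + 1 else core_tableau l (r, c))"

lemma tableau_exists: "\<exists>t. t \<in> tableaux l"
proof -
  have "young_diagram l = (SIGMA r:{..<length l}. {..<l ! r})" by (auto simp: young_diagram_def)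
  then have "finite (young_diagram l)" "card (young_diagram l) = sum_list l"
    by (simp_all add: sum_list_sum_nth atLeast0LessThan)
  then show ?thesis using finite_same_card_bij[of "young_diagram l" "{1..sum_list l}"] by (simp add: tableaux_def)
qed

lemma core_tableau: "young_tableau (core l) (core_tableau l)"
  unfolding core_tableau_def by standard (rule someI_ex[OF tableau_exists])

lemma stable_tableau:
  assumes l: "l \<in> stable_index n"
  shows "stable_tableau l \<in> tableaux (padded n l)"
proof -
  interpret c: young_tableau "core l" "core_tableau l" by (rule core_tableau)
  let ?k = "sum_list l" and ?h = "first_part l"
  have kh: "?k + ?h \<le> n" using l by (auto simp: stable_index_def admissible_def first_part_def)
  \<comment> \<open>The cells of the first row beyond the core; they receive the entries beyond the core in order.\<close>
  let ?E = "{0::nat} \<times> {?h..<n - ?k}"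
  have E: "young_diagram (padded n l) = young_diagram (core l) \<union> ?E"
    using kh by (auto simp: young_diagram_def padded_def core_def nth_Cons split: nat.splits)
  have "bij_betw (stable_tableau l) (young_diagram (core l)) {1..?k + ?h}"
  proof (rule bij_betw_cong[THEN iffD1])
    show "bij_betw (core_tableau l) (young_diagram (core l)) {1..?k + ?h}"
      using c.bij by (simp add: core_def add.commute)
    show "core_tableau l c = stable_tableau l c" if "c \<in> young_diagram (core l)" for c
      using that by (auto simp: core_def stable_tableau_def young_diagram_def)
  qed
  moreover have "bij_betw (stable_tableau l) ?E {?k + ?h + 1..n}"
    by (rule bij_betw_byWitness[where f' = "\<lambda>x. (0, x - ?k - 1)"]) (use kh in \<open>auto simp: stable_tableau_def\<close>)
  ultimately have "bij_betw (stable_tableau l) (young_diagram (core l) \<union> ?E) ({1..?k + ?h} \<union> {?k + ?h + 1..n})"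
    by (rule bij_betw_combine) auto
  moreover have "{1..?k + ?h} \<union> {?k + ?h + 1..n} = {1..n}" using kh by auto
  ultimately show ?thesis using padded(1)[OF l] by (simp add: tableaux_def E)
qed

lemma stable_cells:
  assumes l: "l \<in> stable_index n"
  shows "x \<in> {1..sum_list (core l)} \<Longrightarrow> cell_of (padded n l) (stable_tableau l) x = cell_of (core l) (core_tableau l) x"
    "sum_list (core l) < x \<Longrightarrow> x \<le> n \<Longrightarrow> cell_of (padded n l) (stable_tableau l) x = (0, x - sum_list l - 1)"
proof -
  interpret c: young_tableau "core l" "core_tableau l" by (rule core_tableau)
  interpret t: young_tableau "padded n l" "stable_tableau l" by standard (rule stable_tableau[OF l])
  have kh: "sum_list l + first_part l \<le> n" using l by (auto simp: stable_index_def admissible_def first_part_def)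
  show "cell_of (padded n l) (stable_tableau l) x = cell_of (core l) (core_tableau l) x"
    if x: "x \<in> {1..sum_list (core l)}"
  proof -
    let ?c = "cell_of (core l) (core_tableau l) x"
    have "?c \<in> young_diagram (core l)" by (rule c.cell_in[OF x])
    then have c: "?c \<in> young_diagram (padded n l)" "\<not> (fst ?c = 0 \<and> first_part l \<le> snd ?c)"
      using kh by (auto simp: young_diagram_def padded_def core_def nth_Cons split: nat.splits)
    then have "stable_tableau l ?c = x" using c.t_cell[OF x] by (auto simp: stable_tableau_def case_prod_beta)
    then show ?thesis using t.cell_t[OF c(1)] by simp
  qed
  show "cell_of (padded n l) (stable_tableau l) x = (0, x - sum_list l - 1)"
    if x: "sum_list (core l) < x" "x \<le> n"
  proof -
    have c: "(0, x - sum_list l - 1) \<in> young_diagram (padded n l)" using x by (auto simp: young_diagram_def padded_def core_def)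
    have "stable_tableau l (0, x - sum_list l - 1) = x" using x by (auto simp: stable_tableau_def core_def)
    then show ?thesis using t.cell_t[OF c] by simp
  qed
qed

lemma stable_tabloid:
  assumes l: "l \<in> stable_index n"
  shows "tabloid (padded n l) (stable_tableau l) = tabloid (core l) (core_tableau l)"
proof
  fix x
  have le: "sum_list (core l) \<le> n" using l by (auto simp: stable_index_def admissible_def core_def first_part_def)
  consider "x = 0" | "x \<in> {1..sum_list (core l)}" | "sum_list (core l) < x" "x \<le> n" | "n < x" by fastforce
  then show "tabloid (padded n l) (stable_tableau l) x = tabloid (core l) (core_tableau l) x"
    by cases (use le padded(1)[OF l] stable_cells[OF l] in \<open>auto simp: tabloid_def\<close>)
qed

text \<open>Beyond the core every column is a single cell.\<close>

lemma stable_columns: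
  assumes l: "l \<in> stable_index n"
  shows "column_stabilizer (padded n l) (stable_tableau l) = column_stabilizer (core l) (core_tableau l)"
proof -
  interpret c: young_tableau "core l" "core_tableau l" by (rule core_tableau)
  interpret t: young_tableau "padded n l" "stable_tableau l" by standard (rule stable_tableau[OF l])
  have le: "sum_list (core l) \<le> n" using l by (auto simp: stable_index_def admissible_def core_def first_part_def)
  let ?M = "sum_list (core l)"
  have small: "t.col_of x = c.col_of x" if "x \<in> {1..?M}" for x
    using stable_cells(1)[OF l that] by (simp add: t.col_of_def c.col_of_def)
  have big: "t.col_of x = x - sum_list l - 1" if "?M < x" "x \<le> n" for x
    using stable_cells(2)[OF l that] by (simp add: t.col_of_def)
  have small_lt: "c.col_of x < first_part l" if "x \<in> {1..?M}" for x
  proof -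
    have "c.col_of x < core l ! c.row_of x" "c.row_of x < length (core l)" using c.row_col[OF that] by auto
    moreover have "core l ! i \<le> first_part l" if "i < length (core l)" for i
      using that l sorted_wrt_nth_less[of "(\<ge>)" l 0 "i - 1"]
      by (cases i; cases "i - 1") (auto simp: core_def first_part_def stable_index_def is_partition_def hd_conv_nth)
    ultimately show ?thesis by (meson less_le_trans)
  qed
  show ?thesis
  proof (intro equalityI subsetI)
    fix p assume "p \<in> t.C"
    then have p: "p permutes {1..n}" "\<And>x. x \<in> {1..n} \<Longrightarrow> t.col_of (p x) = t.col_of x"
      unfolding t.C_alt padded(1)[OF l] by auto
    have p_in: "p x \<in> {1..n}" if "x \<in> {1..n}" for x using permutes_in_image[OF p(1)] that by blast
    have fix_big: "p x = x" if x: "?M < x" "x \<le> n" for x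
    proof -
      have px: "p x \<in> {1..n}" using p_in x by auto
      have col: "t.col_of (p x) = x - sum_list l - 1" using p(2)[of x] big[OF x] x by auto
      have "?M < p x"
      proof (rule ccontr)
        assume "\<not> ?M < p x"
        then have "p x \<in> {1..?M}" using px by auto
        then have "x - sum_list l - 1 < first_part l" using small small_lt col by metis
        then show False using x by (simp add: core_def)
      qed
      then have "p x - sum_list l - 1 = x - sum_list l - 1" using big[of "p x"] px col by simp
      then show ?thesis using x \<open>?M < p x\<close> by (simp add: core_def)
    qed
    have "p permutes {1..?M}" by (rule permutes_superset[OF p(1)]) (use fix_big in auto)
    moreover have "c.col_of (p x) = c.col_of x" if x: "x \<in> {1..?M}" for x
    proof -
      have "p x \<in> {1..?M}" using permutes_in_image[OF \<open>p permutes {1..?M}\<close>] x by blast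
      then show ?thesis using p(2)[of x] small x le by auto
    qed
    ultimately show "p \<in> c.C" by (simp add: c.C_alt)
  next
    fix p assume "p \<in> c.C"
    then have p: "p permutes {1..?M}" "\<And>x. x \<in> {1..?M} \<Longrightarrow> c.col_of (p x) = c.col_of x"
      unfolding c.C_alt by auto
    have "t.col_of (p x) = t.col_of x" if x: "x \<in> {1..n}" for x
    proof (cases "x \<in> {1..?M}")
      case True
      then have "p x \<in> {1..?M}" using permutes_in_image[OF p(1)] by blast
      then show ?thesis using True p(2) small by simp
    qed (simp add: permutes_not_in[OF p(1)])
    then show "p \<in> t.C" using permutes_larger[OF p(1) le] unfolding t.C_alt padded(1)[OF l] by blast
  qed
qed

section \<open>Polynomials as functions on monomials\<close>

lemma lookup_Abs_support:
  assumes "\<And>j. j \<notin> {1..n::nat} \<Longrightarrow> a j = (0::nat)"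
  shows "Poly_Mapping.lookup (Abs_poly_mapping a) = a"
proof -
  have "{j. a j \<noteq> 0} \<subseteq> {1..n}"
  proof
    fix j assume "j \<in> {j. a j \<noteq> 0}"
    then show "j \<in> {1..n}" using assms[of j] by (cases "j \<in> {1..n}") simp_all
  qed
  then have "finite {j. a j \<noteq> 0}" by (rule finite_subset) simp
  then show ?thesis by (simp add: Abs_poly_mapping_inverse)
qed

lemma monomial_state:
  assumes q: "q \<in> Q"
  shows "(\<lambda>j. (q, Poly_Mapping.lookup \<alpha> j)) \<in> states Q wt n \<longleftrightarrow>
    Poly_Mapping.keys \<alpha> \<subseteq> {1..n} \<and> int (\<Sum>j\<in>Poly_Mapping.keys \<alpha>. Poly_Mapping.lookup \<alpha> j) = wt q"
proof -
  have keys: "Poly_Mapping.keys \<alpha> \<subseteq> {1..n} \<longleftrightarrow> (\<forall>j. j \<notin> {1..n} \<longrightarrow> Poly_Mapping.lookup \<alpha> j = 0)"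
    by (metis in_keys_iff subset_iff)
  have "(\<lambda>j. (q, Poly_Mapping.lookup \<alpha> j)) \<in> states Q wt n \<longleftrightarrow>
      (\<forall>j. j \<notin> {1..n} \<longrightarrow> Poly_Mapping.lookup \<alpha> j = 0) \<and> int (\<Sum>j\<in>{1..n}. Poly_Mapping.lookup \<alpha> j) = wt q"
    unfolding states_def using q by (auto simp: fun_eq_iff)
  moreover have "(\<Sum>j\<in>{1..n}. Poly_Mapping.lookup \<alpha> j) = (\<Sum>j\<in>Poly_Mapping.keys \<alpha>. Poly_Mapping.lookup \<alpha> j)"
    if "Poly_Mapping.keys \<alpha> \<subseteq> {1..n}"
    using that by (intro sum.mono_neutral_right) (auto simp: in_keys_iff)
  ultimately show ?thesis using keys by metis
qed

lemma state_monomial: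
  assumes s: "s \<in> states Q wt n"
  obtains q \<alpha> where "q \<in> Q" "s = (\<lambda>j. (q, Poly_Mapping.lookup \<alpha> j))" "Abs_poly_mapping (\<lambda>j. snd (s j)) = \<alpha>"
proof -
  obtain q a where q: "q \<in> Q" "\<And>j. j \<notin> {1..n} \<Longrightarrow> a j = 0" "s = (\<lambda>j. (q, a j))"
    using s unfolding states_def by blast
  have "Poly_Mapping.lookup (Abs_poly_mapping a) = a" by (rule lookup_Abs_support[OF q(2)])
  then show thesis using that[of q "Abs_poly_mapping a"] q by simp
qed

lemma inj_map_key:
  assumes g: "g permutes S"
  shows "inj (Poly_Mapping.map_key g :: (nat \<Rightarrow>\<^sub>0 nat) \<Rightarrow> _)"
proof (rule injI)
  fix a b :: "nat \<Rightarrow>\<^sub>0 nat" assume e: "Poly_Mapping.map_key g a = Poly_Mapping.map_key g b"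
  have i: "inj g" using permutes_inj[OF g] .
  show "a = b"
  proof (rule poly_mapping_eqI)
    fix k
    have "Poly_Mapping.lookup a (g (inv' g k)) = Poly_Mapping.lookup b (g (inv' g k))"
      using arg_cong[OF e, of "\<lambda>p. Poly_Mapping.lookup p (inv' g k)"] by (simp add: map_key.rep_eq[OF i])
    then show "Poly_Mapping.lookup a k = Poly_Mapping.lookup b k" by (simp add: permutes_inverses(1)[OF g])
  qed
qed

definition poly_function ::
  "'q set \<Rightarrow> ('q \<Rightarrow> int) \<Rightarrow> nat \<Rightarrow> ('q \<Rightarrow> (nat \<Rightarrow>\<^sub>0 nat) \<Rightarrow>\<^sub>0 rat) \<Rightarrow> (nat \<Rightarrow> 'q \<times> nat) \<Rightarrow> rat" where
  "poly_function Q wt n p = (\<lambda>s. if s \<in> states Q wt n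
     then Poly_Mapping.lookup (p (fst (s 0))) (Abs_poly_mapping (\<lambda>j. snd (s j))) else 0)"

lemma poly_function_monomial:
  "poly_function Q wt n p (\<lambda>j. (q, Poly_Mapping.lookup \<alpha> j)) =
    (if (\<lambda>j. (q, Poly_Mapping.lookup \<alpha> j)) \<in> states Q wt n then Poly_Mapping.lookup (p q) \<alpha> else 0)"
  by (simp add: poly_function_def)

text \<open>A family of polynomials is the function that assigns to a state its coefficient.\<close>

lemma poly_sum_iso:
  assumes Q: "finite Q"
  shows "rat_rep_iso (sym_group n) (direct_sum Q (\<lambda>q. hom_polys n (wt q))) (function_rep (supported_functions (states Q wt n)))"
proof -
  let ?D = "direct_sum Q (\<lambda>q. hom_polys n (wt q))" and ?X = "states Q wt n"
  let ?V = "supported_functions ?X" and ?\<Psi> = "poly_function Q wt n"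
  have carrier: "p \<in> carrier ?D \<longleftrightarrow> p \<in> extensional Q \<and> (\<forall>q\<in>Q. \<forall>\<alpha>. Poly_Mapping.lookup (p q) \<alpha> \<noteq> 0 \<longrightarrow> (\<lambda>j. (q, Poly_Mapping.lookup \<alpha> j)) \<in> ?X)" for p
  proof -
    have "x \<in> carrier (hom_polys n (wt q)) \<longleftrightarrow> (\<forall>\<alpha>. Poly_Mapping.lookup x \<alpha> \<noteq> 0 \<longrightarrow> (\<lambda>j. (q, Poly_Mapping.lookup \<alpha> j)) \<in> ?X)"
      if "q \<in> Q" for q and x :: "(nat \<Rightarrow>\<^sub>0 nat) \<Rightarrow>\<^sub>0 rat"
      unfolding monomial_state[OF that] by (simp add: hom_polys_def Ball_def in_keys_iff[of _ x])
    then show ?thesis using Q by (auto simp: direct_sum_def PiE_iff)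
  qed
  have "inj_on ?\<Psi> (carrier ?D)"
  proof (rule inj_onI)
    fix p p' assume p: "p \<in> carrier ?D" "p' \<in> carrier ?D" and e: "?\<Psi> p = ?\<Psi> p'"
    show "p = p'"
    proof (rule extensionalityI)
      show "p \<in> extensional Q" "p' \<in> extensional Q" using p carrier by auto
      fix q assume q: "q \<in> Q"
      show "p q = p' q"
      proof (rule poly_mapping_eqI)
        fix \<alpha> :: "nat \<Rightarrow>\<^sub>0 nat"
        let ?s = "\<lambda>j. (q, Poly_Mapping.lookup \<alpha> j)"
        show "Poly_Mapping.lookup (p q) \<alpha> = Poly_Mapping.lookup (p' q) \<alpha>"
        proof (cases "?s \<in> ?X")
          case True
          then show ?thesis using fun_cong[OF e, of ?s] by (simp add: poly_function_monomial)
        next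
          case False
          then have "Poly_Mapping.lookup (p q) \<alpha> = 0" "Poly_Mapping.lookup (p' q) \<alpha> = 0"
            using p q unfolding carrier by blast+
          then show ?thesis by simp
        qed
      qed
    qed
  qed
  moreover have "?\<Psi> ` carrier ?D = ?V"
  proof (intro equalityI subsetI)
    fix f assume "f \<in> ?\<Psi> ` carrier ?D"
    then show "f \<in> ?V" by (auto simp: supported_functions_def poly_function_def)
  next
    fix f assume f: "f \<in> ?V"
    define p where "p = (\<lambda>q\<in>Q. Abs_poly_mapping (\<lambda>\<alpha>. f (\<lambda>j. (q, Poly_Mapping.lookup \<alpha> j))))"
    have lp: "Poly_Mapping.lookup (p q) \<alpha> = f (\<lambda>j. (q, Poly_Mapping.lookup \<alpha> j))" if q: "q \<in> Q" for q \<alpha>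
    proof -
      let ?h = "\<lambda>(\<alpha> :: nat \<Rightarrow>\<^sub>0 nat) j. (q, Poly_Mapping.lookup \<alpha> j)"
      have "inj ?h" by (rule injI) (auto simp: fun_eq_iff intro: poly_mapping_eqI)
      then have "finite (?h -` ?X)" by (rule finite_vimageI[OF finite_states[OF Q]])
      moreover have "{\<alpha>. f (?h \<alpha>) \<noteq> 0} \<subseteq> ?h -` ?X" using f by (auto simp: supported_functions_def)
      ultimately have "finite {\<alpha>. f (?h \<alpha>) \<noteq> 0}" by (rule finite_subset[rotated])
      then show ?thesis using q by (simp add: p_def Abs_poly_mapping_inverse)
    qed
    have "p \<in> carrier ?D" unfolding carrier
      using lp f by (auto simp: supported_functions_def) (auto simp: p_def)
    moreover have "f = ?\<Psi> p"
    proof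
      fix s show "f s = ?\<Psi> p s"
      proof (cases "s \<in> ?X")
        case True
        then obtain q \<alpha> where "q \<in> Q" "s = (\<lambda>j. (q, Poly_Mapping.lookup \<alpha> j))"
          using state_monomial by blast
        then show ?thesis using True lp by (simp add: poly_function_monomial)
      qed (use f in \<open>simp add: supported_functions_def poly_function_def\<close>)
    qed
    ultimately show "f \<in> ?\<Psi> ` carrier ?D" by blast
  qed
  ultimately have bij: "bij_betw ?\<Psi> (carrier ?D) ?V" by (simp add: bij_betw_def)
  have fst_in: "fst (s 0) \<in> Q" if "s \<in> ?X" for s using that by (auto simp: states_def)
  show ?thesis unfolding rat_rep_iso_def
  proof (intro exI[of _ ?\<Psi>] conjI ballI allI)
    show "bij_betw ?\<Psi> (carrier ?D) (carrier (function_rep ?V))" using bij by (simp add: function_rep_def)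
    show "?\<Psi> (x \<oplus>\<^bsub>?D\<^esub> y) = ?\<Psi> x \<oplus>\<^bsub>function_rep ?V\<^esub> ?\<Psi> y" for x y
      using fst_in by (auto simp: function_rep_def direct_sum_def hom_polys_def poly_function_def fun_eq_iff lookup_add)
    show "?\<Psi> (q \<odot>\<^bsub>?D\<^esub> x) = q \<odot>\<^bsub>function_rep ?V\<^esub> ?\<Psi> x" for q x
      using fst_in by (auto simp: function_rep_def direct_sum_def hom_polys_def poly_function_def fun_eq_iff map.rep_eq when_def)
    fix g x assume "g \<in> carrier (sym_group n)"
    then have g: "g permutes {1..n}" by (simp add: sym_group_carrier)
    show "?\<Psi> (act ?D g x) = act (function_rep ?V) g (?\<Psi> x)"
    proof
      fix s
      show "?\<Psi> (act ?D g x) s = act (function_rep ?V) g (?\<Psi> x) s"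
      proof (cases "s \<in> ?X")
        case True
        then obtain q \<alpha> where q: "q \<in> Q" "s = (\<lambda>j. (q, Poly_Mapping.lookup \<alpha> j))"
          using state_monomial by blast
        have sg: "s \<circ> g = (\<lambda>j. (q, Poly_Mapping.lookup (Poly_Mapping.map_key g \<alpha>) j))"
          by (simp add: q(2) fun_eq_iff map_key.rep_eq[OF permutes_inj[OF g]])
        have "?\<Psi> (act ?D g x) s = Poly_Mapping.lookup (x q) (Poly_Mapping.map_key g \<alpha>)"
          using True q unfolding q(2) poly_function_monomial
          by (simp add: direct_sum_def hom_polys_def map_key.rep_eq[OF inj_map_key[OF g]])
        also have "\<dots> = ?\<Psi> x (s \<circ> g)"
          using states_comp[OF True g] unfolding sg poly_function_monomial by simp
        finally show ?thesis by (simp add: function_rep_def translate_def)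
      next
        case False
        then show ?thesis using states_comp_iff[OF g, of s] by (simp add: function_rep_def translate_def poly_function_def)
      qed
    qed
  qed
qed

section \<open>Equivariant cohomology of Schubert varieties\<close>

text \<open>With the tableau \<open>stable_tableau l\<close> the spaces \<open>b a V\<close> form a stable system.\<close>

lemma stable_multiplicity:
  fixes wt :: "'q \<Rightarrow> int"
  assumes D: "\<And>q. q \<in> Q \<Longrightarrow> wt q \<le> int D" and l: "is_partition l"
    and n: "sum_list (core l) + D \<le> n"
  shows "fn.dim (young_op (padded n l) (stable_tableau l) ` supported_functions (states Q wt n)) =
    fn.dim (stable_system.mult_space Q wt (tabloid (core l) (core_tableau l)) (column_stabilizer (core l) (core_tableau l)) (sum_list (core l) + D))"
proof -
  interpret c: young_tableau "core l" "core_tableau l" by (rule core_tableau)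
  interpret s: stable_system Q wt D "tabloid (core l) (core_tableau l)" "sum_list (core l)" "column_stabilizer (core l) (core_tableau l)"
    by standard (use D c.row_outside c.group_C in auto)
  have li: "l \<in> stable_index n"
    using l n by (auto simp: stable_index_def admissible_def core_def first_part_def)
  have "row_stabilizer (padded n l) (stable_tableau l) = s.row_perms n"
    unfolding row_stabilizer_def s.row_perms_def stable_tabloid[OF li] padded(1)[OF li] ..
  then have "young_op (padded n l) (stable_tableau l) ` s.V n = s.mult_space n"
    unfolding s.mult_space_def young_op_def stable_columns[OF li] by simp
  then show ?thesis using s.dim_mult_space_stable[OF n] by simp
qed

lemma direct_sum_cong:
  assumes eq: "\<And>i. i \<in> I \<Longrightarrow> A i = B i"
  shows "direct_sum I A = direct_sum I B"
proof -
  have "(\<Pi>\<^sub>E i\<in>I. carrier (A i)) = (\<Pi>\<^sub>E i\<in>I. carrier (B i))"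
    by (rule PiE_cong) (simp only: eq)
  moreover have "{i \<in> I. x i \<noteq> \<zero>\<^bsub>A i\<^esub>} = {i \<in> I. x i \<noteq> \<zero>\<^bsub>B i\<^esub>}" for x
    by (rule Collect_cong) (simp only: eq cong: conj_cong)
  moreover have "(\<lambda>i\<in>I. G (A i) i) = (\<lambda>i\<in>I. G (B i) i)" for G :: "('c, 'b) rat_rep \<Rightarrow> 'a \<Rightarrow> 'b"
    by (rule restrict_ext) (simp only: eq)
  from this[of "\<lambda>V i. zero V"] this[of "\<lambda>V i. add V (x i) (y i)" for x y] this[of "\<lambda>V i. smult V q (x i)" for x q]
    this[of "\<lambda>V i. act V g (x i)" for g x]
  have "(\<lambda>i\<in>I. zero (A i)) = (\<lambda>i\<in>I. zero (B i))"
    "(\<lambda>i\<in>I. add (A i) (x i) (y i)) = (\<lambda>i\<in>I. add (B i) (x i) (y i))"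
    "(\<lambda>i\<in>I. smult (A i) q (x i)) = (\<lambda>i\<in>I. smult (B i) q (x i))"
    "(\<lambda>i\<in>I. act (A i) g (x i)) = (\<lambda>i\<in>I. act (B i) g (x i))" for x y q g
    by blast+
  ultimately show ?thesis unfolding direct_sum_def by (simp only:)
qed

lemma shifted_poly_sum_states:
  assumes w: "w permutes {1..m}" and mn: "m \<le> n"
  shows "shifted_poly_sum n w i = direct_sum {v \<in> carrier (sym_group m). bruhat_le m v w}
     (\<lambda>v. hom_polys n (int i - int (card (inversions v))))"
proof -
  let ?Q = "{v \<in> carrier (sym_group m). bruhat_le m v w}"
  have "coxeter_length n v = card (inversions v)" if "v \<in> ?Q" for v
    using that by (intro coxeter_length_inversions permutes_larger[OF _ mn]) (simp add: sym_group_carrier)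
  then show ?thesis unfolding shifted_poly_sum_def bruhat_interval_stable[OF w mn]
    by (intro direct_sum_cong) (simp only:)
qed

theorem theorem7p4:
  fixes w :: "nat \<Rightarrow> nat" and m :: nat
    and \<rho> :: "nat \<Rightarrow> nat \<Rightarrow> (nat \<Rightarrow> nat) \<Rightarrow> eq_class \<Rightarrow> eq_class"
    and H :: "nat \<Rightarrow> nat \<Rightarrow> (nat \<Rightarrow> nat, eq_class) rat_rep"
  assumes w: "w \<in> carrier (sym_group m)"
    and H: "\<And>n i. H n i = with_action (equivariant_cohomology n (schubert_variety n w) i) (\<rho> n i)"
    and tymoczko_rep: "\<And>n i. n \<ge> m \<Longrightarrow> rat_representation (sym_group n) (H n i)"
    and tymoczko_iso: "\<And>n i. n \<ge> m \<Longrightarrow> rat_rep_iso (sym_group n) (H n i) (shifted_poly_sum n w i)"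
  shows "\<forall>i. multiplicity_stable m (\<lambda>n. H n i)"
proof
  fix i
  have wp: "w permutes {1..m}" using w by (simp add: sym_group_carrier)
  define Q where "Q = {v \<in> carrier (sym_group m). bruhat_le m v w}"
  \<comment> \<open>The degree of the polynomials in the summand of \<open>v\<close>.\<close>
  define wt where "wt v = int i - int (card (inversions v))" for v
  define X where "X n = states Q wt n" for n
  define c where "c l n = fn.dim (young_op (padded n l) (stable_tableau l) ` supported_functions (X n))" for l n
  have Q: "finite Q" unfolding Q_def sym_group_def
    by (rule finite_subset[OF _ finite_permutations[of "{1..m}"]]) auto
  show "multiplicity_stable m (\<lambda>n. H n i)"
    unfolding multiplicity_stable_def
  proof (intro exI[of _ c] conjI allI impI)
    fix n assume mn: "m \<le> n"
    interpret function_representation n stable_tableau "supported_functions (X n)" "(\<lambda>s u. if u = s then 1 else 0) ` X n"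
    proof
      show "translate g f \<in> supported_functions (X n)" if "g permutes {1..n}" "f \<in> supported_functions (X n)" for g f
        using that states_comp_iff[OF that(1)] by (auto simp: supported_functions_def translate_def X_def)
    qed (auto intro: stable_tableau subspace_supported simp: X_def finite_states[OF Q] supported_span[OF finite_states[OF Q], THEN subsetD])
    have "rat_rep_iso (sym_group n) (H n i) (direct_sum Q (\<lambda>v. hom_polys n (wt v)))"
      using tymoczko_iso[OF mn] unfolding shifted_poly_sum_states[OF wp mn] Q_def wt_def .
    moreover have "rat_rep_iso (sym_group n) (direct_sum Q (\<lambda>v. hom_polys n (wt v))) (function_rep (supported_functions (X n)))"
      unfolding X_def by (rule poly_sum_iso[OF Q])
    moreover have "specht_mult l = c l n" for l by (simp add: specht_mult_def c_def)
    ultimately show "rat_rep_iso (sym_group n) (H n i)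
       (direct_sum (SIGMA l : {l. is_partition l \<and> n \<in> admissible l}. {..<c l n}) (\<lambda>(l, _). V_irr l n))"
      using decomposition by (auto intro: rat_rep_iso_trans)
  next
    fix l assume l: "is_partition l"
    have "wt q \<le> int i" for q by (simp add: wt_def)
    note st = stable_multiplicity[of Q wt i l, OF this l, folded X_def]
    show "\<exists>N. \<forall>n\<ge>N. c l n = c l N"
      by (rule exI[of _ "sum_list (core l) + i"]) (use st in \<open>simp add: c_def\<close>)
  qed
qed

end
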